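(* Let $N\ge2$, $\alpha\in(0,1)$, and let $p\in(1,\frac{N}{N-2\alpha})$. Let $u_1$ be the unique weak solution of $$(-\Delta)^\alpha u+u^p=\delta_0\ \text{ in }\mathbb{R}^N,\qquad\lim_{|x|\to+\infty}u(x)=0 .$$ Then there exist $c_2>1$ and $R>2$ such that for all $|x|\ge R$: (i) if $p\in(1,1+\frac{2\alpha}{N})$, then $$\frac1{c_2}|x|^{-\frac{N+2\alpha}{p}}\le u_1(x)\le c_2|x|^{-\frac{N+2\alpha}{p}};$$ (ii) if $p=1+\frac{2\alpha}{N}$, then $$\frac1{c_2}|x|^{-N}\log^{\frac{N}{2\alpha}}(|x|)\le u_1(x)\le c_2|x|^{-N}\log^{\frac{N}{2\alpha}}(|x|);$$ (iii) if $p\in(1+\frac{2\alpha}{N},\frac{N}{N-2\alpha})$, then $$\frac1{c_2}|x|^{-\frac{2\alpha}{p-1}}\le u_1(x)\le c_2|x|^{-\frac{2\alpha}{p-1}}.$$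
   Context: $\delta_0$ is the Dirac mass at the origin, $d\omega(x)=\frac{dx}{1+|x|^{N+2\alpha}}$. Fractional Laplacian: for $\epsilon>0$, $(-\Delta)^\alpha_\epsilon u(x)=-\int_{\{|z-x|>\epsilon\}}\frac{u(z)-u(x)}{|z-x|^{N+2\alpha}}\,dz$, and $(-\Delta)^\alpha u(x)=\lim_{\epsilon\to0^+}(-\Delta)^\alpha_\epsilon u(x)$ (no normalizing constant). Test functions: $\mathbb{X}_{\mathbb{R}^N}\subset C(\mathbb{R}^N)$ is the space of functions $\xi$ such that (i) $\xi$ has compact support; (ii) $(-\Delta)^\alpha\xi(x)$ exists for every $x\in\mathbb{R}^N$ and there is $C>0$ with $|(-\Delta)^\alpha\xi(x)|\le\frac{C}{1+|x|^{N+2\alpha}}$ for all $x$; (iii) there exist $\varphi\in L^1(\mathbb{R}^N)$ and $\epsilon_0>0$ such that $|(-\Delta)^\alpha_\epsilon\xi|\le\varphi$ a.e. in $\mathbb{R}^N$ for all $\epsilon\in(0,\epsilon_0]$. Weak solution of the problem: a nonnegative function $u\in L^1(\mathbb{R}^N,d\omega)$ with $u^p\in L^1(\mathbb{R}^N,d\omega)$, $\lim_{|x|\to\infty}u(x)=0$, and $\int_{\mathbb{R}^N}[u(-\Delta)^\alpha\xi+u^p\xi]\,dx=\xi(0)$ for all $\xi\in\mathbb{X}_{\mathbb{R}^N}$. For $p\in(0,\frac N{N-2\alpha})$ this weak solution exists, is unique, and is a classical solution of $(-\Delta)^\alpha u+u^p=0$ in $\mathbb{R}^N\setminus\{0\}$;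 pointwise values refer to its continuous representative in $\mathbb{R}^N\setminus\{0\}$. *)

theory Defs
  imports "HOL-Analysis.Analysis"
begin

text \<open>
  Truncated and full fractional Laplacian, without normalizing constant. The dimension \<open>N\<close> is
  \<open>DIM('a)\<close>. For continuous compactly supported \<open>u\<close> the integrand of the truncated operator is
  absolutely integrable, so the convention that non-integrable functions have integral 0 plays
  no role on the test functions below.
\<close>

definition frac_lap_eps :: "real \<Rightarrow> real \<Rightarrow> ('a::euclidean_space \<Rightarrow> real) \<Rightarrow> 'a \<Rightarrow> real" where
  "frac_lap_eps \<alpha> \<epsilon> u x =
     - (LINT z:{z. norm (z - x) > \<epsilon>}|lebesgue.
          (u z - u x) / norm (z - x) powr (real DIM('a) + 2 * \<alpha>))"

definition frac_lap_exists :: "real \<Rightarrow> ('a::euclidean_space \<Rightarrow> real) \<Rightarrow> 'a \<Rightarrow> bool" where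
  "frac_lap_exists \<alpha> u x \<longleftrightarrow> (\<exists>l. ((\<lambda>\<epsilon>. frac_lap_eps \<alpha> \<epsilon> u x) \<longlongrightarrow> l) (at_right 0))"

text \<open>Only meaningful where \<open>frac_lap_exists\<close> holds.\<close>

definition frac_lap :: "real \<Rightarrow> ('a::euclidean_space \<Rightarrow> real) \<Rightarrow> 'a \<Rightarrow> real" where
  "frac_lap \<alpha> u x = Lim (at_right 0) (\<lambda>\<epsilon>. frac_lap_eps \<alpha> \<epsilon> u x)"

definition omega :: "real \<Rightarrow> 'a::euclidean_space measure" where
  "omega \<alpha> = density lebesgue (\<lambda>x. ennreal (1 / (1 + norm x powr (real DIM('a) + 2 * \<alpha>))))"

definition test_space :: "real \<Rightarrow> ('a::euclidean_space \<Rightarrow> real) set" where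
  "test_space \<alpha> = {\<xi>.
     continuous_on UNIV \<xi> \<and>
     compact (closure {x. \<xi> x \<noteq> 0}) \<and>
     (\<forall>x. frac_lap_exists \<alpha> \<xi> x) \<and>
     (\<exists>C>0. \<forall>x. \<bar>frac_lap \<alpha> \<xi> x\<bar> \<le> C / (1 + norm x powr (real DIM('a) + 2 * \<alpha>))) \<and>
     (\<exists>\<phi> \<epsilon>0. integrable lebesgue \<phi> \<and> \<epsilon>0 > 0 \<and>
        (\<forall>\<epsilon>\<in>{0<..\<epsilon>0}. AE x in lebesgue. \<bar>frac_lap_eps \<alpha> \<epsilon> \<xi> x\<bar> \<le> \<phi> x))}"

text \<open>
  Weak solutions of \<open>(-\<Delta>)\<^sup>\<alpha> u + u\<^sup>p = \<delta>\<^sub>0\<close> vanishing at infinity. As an element of \<open>L\<^sup>1(d\<omega>)\<close>, \<open>u\<close> is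
  nonnegative almost everywhere; in particular its value at the origin is irrelevant.
\<close>

definition weak_solution :: "real \<Rightarrow> real \<Rightarrow> ('a::euclidean_space \<Rightarrow> real) \<Rightarrow> bool" where
  "weak_solution \<alpha> p u \<longleftrightarrow>
     (AE x in lebesgue. 0 \<le> u x) \<and>
     integrable (omega \<alpha>) u \<and>
     integrable (omega \<alpha>) (\<lambda>x. u x powr p) \<and>
     (u \<longlongrightarrow> 0) at_infinity \<and>
     (\<forall>\<xi>\<in>test_space \<alpha>. (LINT x|lebesgue. u x * frac_lap \<alpha> \<xi> x + u x powr p * \<xi> x) = \<xi> 0)"

end

theory Submission
  imports Defs "HOL-Real_Asymp.Real_Asymp"
begin

text \<open>
  Write \<open>L\<close> for \<open>-(-\<Delta>)\<^sup>\<alpha>\<close>, \<open>N\<close> for the dimension and \<open>M r\<close> for the integral of the solution \<open>u\<close> over the ball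
  of radius \<open>r\<close> around the origin. Away from the origin \<open>L u = u\<^sup>p\<close>. At a point with norm of order \<open>r\<close>
  the nonlocal operator sees two things: the mass near the origin, which contributes a term of
  order \<open>M r\<close> times \<open>r\<close> to the power \<open>-N - 2\<alpha>\<close>, and the function at scale \<open>r\<close>, which contributes at
  most \<open>u\<close> times \<open>r\<close> to the power \<open>-2\<alpha>\<close>. The maximum principle turns this into two local
  inequalities (\<open>local_upper_bound\<close>, \<open>local_lower_bound\<close>): up to constants, \<open>u\<^sup>p\<close> is at most the sum of
  the two terms, when \<open>u\<close> in the second one is replaced by its supremum outside the ball of radius
  \<open>r\<close>, while \<open>u\<^sup>p\<close> plus the second term is at least the first.

  Together with the trivial fact that the mass in an annulus is \<open>u\<close> times its volume, the two
  inequalities are recursions over the radii \<open>4 ^ k\<close>. The three regimes are those in which the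
  mass stays bounded, grows like a power of the logarithm, or grows like a power of the radius.
  The recursions give all the upper bounds (\<open>upper_profile\<close>) and the lower bounds of the first two
  regimes. In the third regime the linear term of the lower inequality is the larger one when \<open>u\<close> is
  small, and a recursion with unsharp constants no longer suffices. There a subsolution is compared
  directly with \<open>u\<close>: the power of the norm with exponent \<open>-\<tau>\<close>, where \<open>\<tau> = 2\<alpha> / (p - 1)\<close> lies strictly
  between \<open>N - 2\<alpha>\<close> and \<open>N\<close>. It is a convex function of the fundamental solution, the power with
  exponent \<open>-(N - 2\<alpha>)\<close>, and therefore a strict subsolution of the linear equation (\<open>power_barrier\<close>).

  That \<open>L\<close> annihilates the fundamental solution away from the origin (\<open>levy_lim_riesz\<close>) follows from
  symmetry alone. By homogeneity and rotation invariance the result is a multiple of the power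
  \<open>-N\<close> of the norm. The pairing of the fundamental solution with \<open>L\<close> applied to a bump is invariant
  under dilation of the bump, so the multiple integrates to zero against the difference of a bump
  and its dilate, and must vanish.

  Since \<open>u\<close> is only continuous, \<open>L\<close> cannot be evaluated on \<open>u\<close> at a point where it touches a barrier.
  The mollifications of \<open>u\<close> satisfy the mollified equation pointwise (\<open>mollified_equation\<close>), because
  translated mollifiers are test functions. The maximum principle is applied to them, and the
  points of contact are followed to the limit (\<open>comparison_from_below\<close>).
\<close>

section \<open>Lebesgue integrals under affine maps and of powers of the norm\<close>

lemma ball_borel [measurable]:
  fixes a :: "'a::euclidean_space"
  shows "ball a r \<in> sets borel" "cball a r \<in> sets borel"
  by auto

lemma lborel_integral_shift:
  fixes f :: "'a::euclidean_space \<Rightarrow> real"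
  shows "(\<integral>x. f (x + a) \<partial>lborel) = (\<integral>x. f x \<partial>lborel)"
    and "integrable lborel (\<lambda>x. f (x + a)) \<longleftrightarrow> integrable lborel f"
proof -
  have m: "(\<lambda>x. x + a) \<in> lborel \<rightarrow>\<^sub>M borel" by simp
  have d: "distr lborel borel (\<lambda>x. x + a) = lborel"
    using lborel_distr_plus[of a] by (simp only: add.commute[of _ a])
  have d': "distr lborel borel (\<lambda>x. x + (- a)) = lborel"
    using lborel_distr_plus[of "- a"] by (simp only: add.commute[of _ "- a"])
  show i: "integrable lborel (\<lambda>x. f (x + a)) \<longleftrightarrow> integrable lborel f"
  proof
    assume *: "integrable lborel f"
    show "integrable lborel (\<lambda>x. f (x + a))"
      using integrable_distr[OF m, of f] * unfolding d by simp
  next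
    assume *: "integrable lborel (\<lambda>x. f (x + a))"
    have m': "(\<lambda>x. x + (-a)) \<in> lborel \<rightarrow>\<^sub>M borel" by simp
    show "integrable lborel f"
      using integrable_distr[OF m', of "\<lambda>x. f (x + a)"] * unfolding d' by simp
  qed
  show "(\<integral>x. f (x + a) \<partial>lborel) = (\<integral>x. f x \<partial>lborel)"
  proof (cases "integrable lborel f")
    case True
    then have "f \<in> borel_measurable borel" by auto
    from integral_distr[OF m this] show ?thesis unfolding d by simp
  next
    case False
    then show ?thesis using i by (simp add: not_integrable_integral_eq)
  qed
qed

lemma lborel_integral_scale:
  fixes f :: "'a::euclidean_space \<Rightarrow> real"
  assumes c: "c \<noteq> 0"
  shows "(\<integral>x. f (c *\<^sub>R x) \<partial>lborel) = (\<integral>x. f x \<partial>lborel) / \<bar>c\<bar> ^ DIM('a)"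
    and "integrable lborel (\<lambda>x. f (c *\<^sub>R x)) \<longleftrightarrow> integrable lborel f"
proof -
  have imp: "integrable lborel (\<lambda>x. g (c *\<^sub>R x))" if g: "integrable lborel g" and c: "c \<noteq> 0"
    for c :: real and g :: "'a \<Rightarrow> real"
  proof -
    have [measurable]: "g \<in> borel_measurable borel" using g by auto
    have "integrable (density (distr lborel borel (\<lambda>x. 0 + c *\<^sub>R x)) (\<lambda>_. ennreal (\<bar>c\<bar>^DIM('a)))) g"
      using g lborel_affine[OF c, of "0::'a"] by metis
    then have "integrable (distr lborel borel (\<lambda>x. 0 + c *\<^sub>R x)) (\<lambda>x. \<bar>c\<bar>^DIM('a) * g x)"
      by (subst (asm) integrable_density) auto
    then have "integrable lborel (\<lambda>x. \<bar>c\<bar>^DIM('a) * g (c *\<^sub>R x))"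
      by (subst (asm) integrable_distr_eq) auto
    then show ?thesis using c by simp
  qed
  show i: "integrable lborel (\<lambda>x. f (c *\<^sub>R x)) \<longleftrightarrow> integrable lborel f"
    using imp[of f c] imp[of "\<lambda>x. f (c *\<^sub>R x)" "inverse c"] c by auto
  show "(\<integral>x. f (c *\<^sub>R x) \<partial>lborel) = (\<integral>x. f x \<partial>lborel) / \<bar>c\<bar> ^ DIM('a)"
  proof (cases "integrable lborel f")
    case True
    then have [measurable]: "f \<in> borel_measurable borel" by auto
    have "(\<integral>x. f x \<partial>lborel) = (\<integral>x. f x \<partial>density (distr lborel borel (\<lambda>x. 0 + c *\<^sub>R x)) (\<lambda>_. ennreal (\<bar>c\<bar>^DIM('a))))"
      using lborel_affine[OF c, of "0::'a"] by metis
    also have "\<dots> = (\<integral>x. \<bar>c\<bar>^DIM('a) *\<^sub>R f x \<partial>distr lborel borel (\<lambda>x. 0 + c *\<^sub>R x))"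
      by (subst integral_density) auto
    also have "\<dots> = (\<integral>x. \<bar>c\<bar>^DIM('a) *\<^sub>R f (c *\<^sub>R x) \<partial>lborel)"
      by (subst integral_distr) auto
    also have "\<dots> = \<bar>c\<bar>^DIM('a) * (\<integral>x. f (c *\<^sub>R x) \<partial>lborel)"
      by simp
    finally show ?thesis using c by simp
  next
    case False
    then show ?thesis using i by (simp add: not_integrable_integral_eq)
  qed
qed

lemma lborel_integral_minus:
  fixes f :: "'a::euclidean_space \<Rightarrow> real"
  shows "(\<integral>x. f (- x) \<partial>lborel) = (\<integral>x. f x \<partial>lborel)"
    and "integrable lborel (\<lambda>x. f (- x)) \<longleftrightarrow> integrable lborel f"
  using lborel_integral_scale[of "-1" f] by simp_all

text \<open>Cover the space by balls around the origin, with \<open>c k\<close> a bound for \<open>f\<close> on the part charged to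
  the ball of radius \<open>r k\<close>. With dyadic radii this decides the integrability of powers of the norm
  in any dimension, without polar coordinates.\<close>

lemma integrable_by_ball_cover:
  fixes f :: "'a::euclidean_space \<Rightarrow> real"
  assumes [measurable]: "f \<in> borel_measurable borel"
    and nn: "\<And>x. f x \<ge> 0" "\<And>k::nat. c k \<ge> 0" "\<And>k. r k \<ge> 0"
    and cover: "\<And>x. f x = 0 \<or> (\<exists>k. norm x \<le> r k \<and> f x \<le> c k)"
    and sm: "summable (\<lambda>k. c k * r k ^ DIM('a))"
  shows "integrable lborel f"
proof (rule integrableI_nonneg)
  have le: "ennreal (f x) \<le> (\<Sum>k. ennreal (c k) * indicator (cball 0 (r k)) x)" for x
  proof (cases "f x = 0")
    case False
    then obtain k where k: "norm x \<le> r k" "f x \<le> c k" using cover by blast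
    have "ennreal (f x) \<le> ennreal (c k) * indicator (cball 0 (r k)) x"
      using k by (simp add: ennreal_leI)
    also have "\<dots> = (\<Sum>k\<in>{k}. ennreal (c k) * indicator (cball 0 (r k)) x)"
      by (subst sum.insert) auto
    also have "\<dots> \<le> (\<Sum>k. ennreal (c k) * indicator (cball 0 (r k)) x)"
      by (rule sum_le_suminf) auto
    finally show ?thesis .
  qed simp
  have "(\<integral>\<^sup>+x. ennreal (f x) \<partial>lborel) \<le> (\<integral>\<^sup>+x. (\<Sum>k. ennreal (c k) * indicator (cball 0 (r k)) x) \<partial>(lborel::'a measure))"
    by (rule nn_integral_mono) (rule le)
  also have "\<dots> = (\<Sum>k. ennreal (c k) * emeasure lborel (cball (0::'a) (r k)))"
    proof (subst nn_integral_suminf)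
    show "(\<lambda>x. ennreal (c i) * indicator (cball 0 (r i)) x) \<in> borel_measurable (lborel::'a measure)" for i
      by measurable
    show "(\<Sum>i. \<integral>\<^sup>+x. ennreal (c i) * indicator (cball 0 (r i)) x \<partial>(lborel::'a measure)) =
        (\<Sum>k. ennreal (c k) * emeasure lborel (cball (0::'a) (r k)))"
      by (rule arg_cong[where f=suminf], rule ext, rule nn_integral_cmult_indicator) simp
  qed
  also have "\<dots> = (\<Sum>k. ennreal (unit_ball_vol (DIM('a)) * (c k * r k ^ DIM('a))))"
    by (rule arg_cong[where f=suminf], rule ext)
       (simp add: emeasure_cball nn ennreal_mult[symmetric] mult_ac)
  also have "\<dots> < \<infinity>"
    using sm nn by (subst suminf_ennreal2) (auto intro!: summable_mult mult_nonneg_nonneg)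
  finally show "(\<integral>\<^sup>+x. ennreal (f x) \<partial>lborel) < \<infinity>" .
qed (use nn in auto)

lemma integrable_norm_powr_cball:
  assumes q: "q < real DIM('a)"
  shows "integrable lborel (\<lambda>x::'a::euclidean_space. indicator (cball 0 R) x * norm x powr (- q))"
proof -
  define R' where "R' = max R 1"
  have R': "R' > 0" "R \<le> R'" by (auto simp: R'_def)
  have *: "integrable lborel (\<lambda>x::'a. indicator (cball 0 R') x * norm x powr (- q))"
  proof (rule integrable_by_ball_cover[where r="\<lambda>k. R' / 2^k" and
       c="\<lambda>k. 2 powr \<bar>q\<bar> * (R' / 2^k) powr (- q)"])
    fix x :: 'a
    show "indicator (cball 0 R') x * norm x powr (- q) = 0 \<or>
       (\<exists>k. norm x \<le> R'/2^k \<and> indicator (cball 0 R') x * norm x powr (- q) \<le> 2 powr \<bar>q\<bar> * (R' / 2^k) powr (- q))"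
    proof (cases "x = 0 \<or> norm x > R'")
      case True then show ?thesis by (auto simp: indicator_def)
    next
      case False
      then have x: "0 < norm x" "norm x \<le> R'" by auto
      \<comment> \<open>The ball for \<open>x\<close> is the last of the radii \<open>R'/2^k\<close> that still contains it, so that the norm of \<open>x\<close>
        and that radius differ by a factor of at most 2.\<close>
      define P where "P = (\<lambda>k::nat. norm x \<le> R'/2^k)"
      have "\<exists>k. \<not> P k"
      proof -
        obtain k where "R' / norm x < 2^k" using real_arch_pow[of 2 "R'/norm x"] by auto
        then show ?thesis using x by (auto simp: P_def field_simps intro!: exI[of _ k])
      qed
      moreover have "P 0" using x by (simp add: P_def)
      ultimately obtain k where k: "P k" "\<not> P (Suc k)"
        by (metis nat_induct)
      have b: "norm x \<le> R'/2^k" "R'/2^k \<le> 2 * norm x" using k by (auto simp: P_def)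
      have "norm x powr (- q) \<le> 2 powr \<bar>q\<bar> * (R' / 2^k) powr (- q)"
      proof (cases "q \<ge> 0")
        case True
        have "(2 * norm x) powr (- q) \<le> (R'/2^k) powr (- q)"
          using b True R' by (intro powr_mono2') auto
        then have "norm x powr (- q) * 2 powr (- q) \<le> (R'/2^k) powr (- q)"
          by (simp add: powr_mult mult.commute)
        from mult_left_mono[OF this, of "2 powr q"] show ?thesis
          using True by (simp add: powr_minus mult.left_commute[of "2 powr q"])
      next
        case False
        have "norm x powr (- q) \<le> (R'/2^k) powr (- q)"
          using b False R' by (intro powr_mono2) auto
        also have "\<dots> \<le> 2 powr \<bar>q\<bar> * (R'/2^k) powr (- q)"
          using mult_right_mono[of 1 "2 powr \<bar>q\<bar>" "(R'/2^k) powr (- q)"] ge_one_powr_ge_zero[of 2 "\<bar>q\<bar>"] by simp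
        finally show ?thesis .
      qed
      then show ?thesis using b x by auto
    qed
  next
    have "(\<lambda>k. 2 powr \<bar>q\<bar> * (R' / 2^k) powr (- q) * (R'/2^k) ^ DIM('a))
        = (\<lambda>k. (2 powr \<bar>q\<bar> * R' powr (real DIM('a) - q)) * (2 powr (q - real DIM('a))) ^ k)"
    proof
      fix k :: nat
      have p: "(2::real)^k = 2 powr k" by (simp add: powr_realpow)
      have "(R' / 2^k) powr (- q) * (R'/2^k) ^ DIM('a) = (R' / 2^k) powr (real DIM('a) - q)"
        using R' by (simp add: powr_realpow[symmetric] powr_add[symmetric] del: powr_realpow')
      also have "\<dots> = R' powr (real DIM('a) - q) * (2 powr (q - real DIM('a))) ^ k"
        using R' unfolding p by (subst powr_divide) (auto simp: powr_powr powr_realpow[symmetric] powr_minus[symmetric] divide_inverse algebra_simps)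
      finally show "2 powr \<bar>q\<bar> * (R' / 2^k) powr (- q) * (R'/2^k) ^ DIM('a) = (2 powr \<bar>q\<bar> * R' powr (real DIM('a) - q)) * (2 powr (q - real DIM('a))) ^ k"
        by simp
    qed
    moreover have "2 powr (q - real DIM('a)) < 1" using q powr_less_mono[of "q - real DIM('a)" 0 2] by simp
    ultimately show "summable (\<lambda>k. 2 powr \<bar>q\<bar> * (R' / 2^k) powr (- q) * (R'/2^k) ^ DIM('a))"
      by (auto intro!: summable_mult summable_geometric)
  qed (use R' in auto)
  show ?thesis
    by (rule Bochner_Integration.integrable_bound[OF *]) (use R' in \<open>auto simp: indicator_def\<close>)
qed

lemma integrable_norm_powr_outside:
  assumes q: "real DIM('a) < q" and R: "R > 0"
  shows "integrable lborel (\<lambda>x::'a::euclidean_space. indicator (- ball 0 R) x * norm x powr (- q))"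
proof (rule integrable_by_ball_cover[where r="\<lambda>k. 2 * R * 2^k" and c="\<lambda>k. (R * 2^k) powr (- q)"])
  fix x :: 'a
  show "indicator (- ball 0 R) x * norm x powr (- q) = 0 \<or>
     (\<exists>k. norm x \<le> 2 * R * 2^k \<and> indicator (- ball 0 R) x * norm x powr (- q) \<le> (R * 2^k) powr (- q))"
  proof (cases "norm x < R")
    case True then show ?thesis by (auto simp: indicator_def)
  next
    case False
    then have x: "R \<le> norm x" by auto
    define P where "P = (\<lambda>k::nat. R*2^k \<le> norm x)"
    have "\<exists>k. \<not> P k"
    proof -
      obtain k where "norm x / R < 2^k" using real_arch_pow[of 2 "norm x / R"] by auto
      then show ?thesis using R by (auto simp: P_def field_simps intro!: exI[of _ k])
    qed
    moreover have "P 0" using x by (simp add: P_def)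
    ultimately obtain k where k: "P k" "\<not> P (Suc k)"
      by (metis nat_induct)
    have b: "norm x \<le> 2*R*2^k" "R*2^k \<le> norm x" using k by (auto simp: P_def)
    have "norm x powr (- q) \<le> (R * 2^k) powr (- q)"
      using b R q by (intro powr_mono2') auto
    then show ?thesis using b by (auto simp: indicator_def)
  qed
next
  have "(\<lambda>k. (R * 2^k) powr (- q) * (2 * R * 2^k) ^ DIM('a))
      = (\<lambda>k. (2 ^ DIM('a) * R powr (real DIM('a) - q)) * (2 powr (real DIM('a) - q)) ^ k)"
  proof
    fix k :: nat
    have p: "(2::real)^k = 2 powr k" by (simp add: powr_realpow)
    have "(R * 2^k) powr (- q) * (R*2^k) ^ DIM('a) = (R * 2^k) powr (real DIM('a) - q)"
      using R by (simp add: powr_realpow[symmetric] powr_add[symmetric] del: powr_realpow')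
    also have "\<dots> = R powr (real DIM('a) - q) * (2 powr (real DIM('a) - q)) ^ k"
      using R unfolding p by (subst powr_mult) (auto simp: powr_powr powr_realpow[symmetric] algebra_simps)
    finally show "(R * 2^k) powr (- q) * (2 * R * 2^k) ^ DIM('a)
      = (2 ^ DIM('a) * R powr (real DIM('a) - q)) * (2 powr (real DIM('a) - q)) ^ k"
      by (simp add: power_mult_distrib mult_ac)
  qed
  moreover have "2 powr (real DIM('a) - q) < 1" using q powr_less_mono[of "real DIM('a) - q" 0 2] by simp
  ultimately show "summable (\<lambda>k. (R * 2^k) powr (- q) * (2 * R * 2^k) ^ DIM('a))"
    by (auto intro!: summable_mult summable_geometric)
qed (use R in auto)

text \<open>Isometry invariance. Write \<open>\<mu>\<close> for the image of Lebesgue measure under the isometry. It is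
  translation invariant, and gives every unit ball the same mass as Lebesgue measure does.
  Computing the convolution of a set with the indicator of the unit ball in both orders
  identifies the two measures.\<close>

lemma lborel_distr_orthogonal:
  fixes T :: "'a::euclidean_space \<Rightarrow> 'a"
  assumes T: "orthogonal_transformation T"
  shows "distr lborel borel T = lborel"
proof (rule measure_eqI)
  have lin: "linear T" using T by (rule orthogonal_transformation_linear)
  then have contT: "continuous_on UNIV T" by (simp add: linear_continuous_on linear_linear)
  have [measurable]: "T \<in> borel \<rightarrow>\<^sub>M borel" using contT by (rule borel_measurable_continuous_onI)
  have nT: "norm (T x) = norm x" for x using orthogonal_transformation_norm[OF T] .
  have bij: "bij T" using orthogonal_transformation_bij[OF T] .
  define \<mu> where "\<mu> = distr lborel borel T"
  have nn\<mu>: "(\<integral>\<^sup>+x. g x \<partial>\<mu>) = (\<integral>\<^sup>+x. g (T x) \<partial>lborel)" if "g \<in> borel_measurable borel" for g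
    unfolding \<mu>_def using that by (subst nn_integral_distr) auto
  have nnl: "(\<integral>\<^sup>+x. g (x + a) \<partial>lborel) = (\<integral>\<^sup>+x. g x \<partial>lborel)" if [measurable]: "g \<in> borel_measurable borel" for g and a :: 'a
    using lborel_distr_plus[of a] nn_integral_distr[of "(+) a" lborel borel g] by (simp add: add.commute)
  have trans: "(\<integral>\<^sup>+x. g (x + a) \<partial>\<mu>) = (\<integral>\<^sup>+x. g x \<partial>\<mu>)" if [measurable]: "g \<in> borel_measurable borel" for g a
  proof -
    obtain b where b: "T b = a" using bij by (metis bij_pointE)
    have "(\<integral>\<^sup>+x. g (x + a) \<partial>\<mu>) = (\<integral>\<^sup>+x. g (T (x + b)) \<partial>lborel)"
      by (subst nn\<mu>) (auto simp: b linear_add[OF lin])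
    also have "\<dots> = (\<integral>\<^sup>+x. g (T x) \<partial>lborel)" by (rule nnl) simp
    finally show ?thesis by (simp add: nn\<mu>)
  qed
  fix A assume "A \<in> sets (distr lborel borel T)"
  then have [measurable]: "A \<in> sets borel" by simp
  let ?B = "ball (0::'a) 1"
  let ?V = "emeasure lborel ?B"
  have ball: "(\<integral>\<^sup>+x. indicator ?B (y - x) \<partial>\<mu>) = ?V" for y :: 'a
  proof -
    obtain b where b: "T b = y" using bij by (metis bij_pointE)
    have "(\<integral>\<^sup>+x. indicator ?B (y - x) \<partial>\<mu>) = (\<integral>\<^sup>+x. indicator ?B (T b - T x) \<partial>lborel)"
      unfolding b by (rule nn\<mu>) measurable
    also have "\<dots> = (\<integral>\<^sup>+x. indicator ?B (x + (- b)) \<partial>lborel)"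
      by (rule nn_integral_cong) (auto simp: indicator_def linear_diff[OF lin, symmetric] nT norm_minus_commute)
    also have "\<dots> = ?V" by (subst nnl) auto
    finally show ?thesis .
  qed
  have sf: "sigma_finite_measure \<mu>"
  proof
    show "\<exists>S. countable S \<and> S \<subseteq> sets \<mu> \<and> \<Union> S = space \<mu> \<and> (\<forall>a\<in>S. emeasure \<mu> a \<noteq> \<infinity>)"
    proof (intro exI conjI ballI)
      show "countable (range (\<lambda>n::nat. cball (0::'a) n))" by simp
      show "range (\<lambda>n::nat. cball (0::'a) n) \<subseteq> sets \<mu>" by (auto simp: \<mu>_def)
      show "\<Union> (range (\<lambda>n::nat. cball (0::'a) n)) = space \<mu>"
        by (auto simp: \<mu>_def intro: real_arch_simple)
      fix a assume "a \<in> range (\<lambda>n::nat. cball (0::'a) n)"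
      then obtain n :: nat where n: "a = cball 0 n" by auto
      have "T -` a = cball 0 n" unfolding n by (auto simp: nT)
      then show "emeasure \<mu> a \<noteq> \<infinity>" unfolding \<mu>_def
        by (subst emeasure_distr) (auto simp: n emeasure_cball)
    qed
  qed
  interpret p: pair_sigma_finite lborel \<mu>
    by (rule pair_sigma_finite.intro) (use sf lborel.sigma_finite_measure_axioms in auto)
  have s\<mu>[measurable_cong]: "sets \<mu> = sets borel" by (simp add: \<mu>_def)
  have Vpos: "?V \<noteq> 0" "?V \<noteq> \<infinity>"
    using unit_ball_vol_pos[of "real DIM('a)"] by (auto simp: emeasure_ball simp del: unit_ball_vol_pos)
  have "emeasure \<mu> A * ?V = (\<integral>\<^sup>+y. (\<integral>\<^sup>+x. indicator A x * indicator ?B y \<partial>\<mu>) \<partial>lborel)"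
    by (auto simp: nn_integral_multc nn_integral_cmult s\<mu>)
  also have "\<dots> = (\<integral>\<^sup>+y. (\<integral>\<^sup>+x. indicator A (x + y) * indicator ?B y \<partial>\<mu>) \<partial>lborel)"
    by (rule nn_integral_cong, subst trans[symmetric]) (auto)
  also have "\<dots> = (\<integral>\<^sup>+x. (\<integral>\<^sup>+y. indicator A (x + y) * indicator ?B y \<partial>lborel) \<partial>\<mu>)"
    by (rule p.Fubini'[symmetric]) measurable
  also have "\<dots> = (\<integral>\<^sup>+x. (\<integral>\<^sup>+y. indicator A y * indicator ?B (y - x) \<partial>lborel) \<partial>\<mu>)"
  proof (rule nn_integral_cong)
    fix x :: 'a
    show "(\<integral>\<^sup>+y. indicator A (x + y) * indicator ?B y \<partial>lborel) = (\<integral>\<^sup>+y. indicator A y * indicator ?B (y - x) \<partial>lborel)"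
      using nnl[of "\<lambda>y. indicator A y * indicator ?B (y - x)" x] by (simp add: add.commute)
  qed
  also have "\<dots> = (\<integral>\<^sup>+y. (\<integral>\<^sup>+x. indicator A y * indicator ?B (y - x) \<partial>\<mu>) \<partial>lborel)"
    by (rule p.Fubini') measurable
  also have "\<dots> = (\<integral>\<^sup>+y. indicator A y * ?V \<partial>lborel)"
    by (rule nn_integral_cong, subst nn_integral_cmult) (auto simp: ball)
  also have "\<dots> = emeasure lborel A * ?V" by (simp add: nn_integral_multc)
  finally show "emeasure (distr lborel borel T) A = emeasure lborel A"
    using Vpos unfolding \<mu>_def by (simp add: ennreal_mult_cancel_left mult.commute[of _ "emeasure lborel (ball 0 1)"])
qed simp

section \<open>The truncated operator and its kernel\<close>

definition kern :: "real \<Rightarrow> 'a::euclidean_space \<Rightarrow> real" where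
  "kern \<alpha> h = norm h powr (- (real DIM('a) + 2 * \<alpha>))"

definition tkern :: "real \<Rightarrow> real \<Rightarrow> 'a::euclidean_space \<Rightarrow> real" where
  "tkern \<alpha> \<epsilon> h = (if norm h > \<epsilon> then kern \<alpha> h else 0)"

text \<open>The truncation at \<open>\<epsilon>\<close> of the operator \<open>-(-\<Delta>)\<^sup>\<alpha>\<close>, in increment variables.\<close>

definition levy_op :: "real \<Rightarrow> real \<Rightarrow> ('a::euclidean_space \<Rightarrow> real) \<Rightarrow> 'a \<Rightarrow> real" where
  "levy_op \<alpha> \<epsilon> f x = (\<integral>h. (f (x + h) - f x) * tkern \<alpha> \<epsilon> h \<partial>lborel)"

definition sdiff :: "('a::euclidean_space \<Rightarrow> real) \<Rightarrow> 'a \<Rightarrow> 'a \<Rightarrow> real" where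
  "sdiff f x h = f (x + h) + f (x - h) - 2 * f x"

lemma kern_nonneg [simp]: "0 \<le> kern \<alpha> h" and tkern_nonneg [simp]: "0 \<le> tkern \<alpha> \<epsilon> h"
  by (auto simp: kern_def tkern_def)

lemma tkern_le_kern: "tkern \<alpha> \<epsilon> h \<le> kern \<alpha> h"
  by (auto simp: tkern_def)

lemma kern_measurable [measurable]: "(kern \<alpha> :: 'a::euclidean_space \<Rightarrow> real) \<in> borel_measurable borel"
  unfolding kern_def by measurable

lemma tkern_measurable [measurable]: "(tkern \<alpha> \<epsilon> :: 'a::euclidean_space \<Rightarrow> real) \<in> borel_measurable borel"
  unfolding tkern_def by measurable

lemma kern_minus [simp]: "kern \<alpha> (- h) = kern \<alpha> h" and tkern_minus [simp]: "tkern \<alpha> \<epsilon> (- h) = tkern \<alpha> \<epsilon> h"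
  by (auto simp: kern_def tkern_def)

lemma kern_scale:
  fixes h :: "'a::euclidean_space"
  assumes "c > 0"
  shows "kern \<alpha> (c *\<^sub>R h) = c powr (- (real DIM('a) + 2 * \<alpha>)) * kern \<alpha> h"
  using assms by (simp add: kern_def powr_mult)

lemma tkern_scale:
  fixes h :: "'a::euclidean_space"
  assumes c: "c > 0"
  shows "tkern \<alpha> (c * \<epsilon>) (c *\<^sub>R h) = c powr (- (real DIM('a) + 2 * \<alpha>)) * tkern \<alpha> \<epsilon> h"
  using kern_scale[OF c, of \<alpha> h] c by (simp add: tkern_def)

lemma sdiff_scale: "sdiff (\<lambda>x. f (c *\<^sub>R x)) x h = sdiff f (c *\<^sub>R x) (c *\<^sub>R h)"
  by (simp add: sdiff_def scaleR_add_right scaleR_diff_right)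

text \<open>The operator has order \<open>2\<alpha>\<close>; the truncation radius scales along with the argument.\<close>

lemma levy_op_scale:
  fixes f :: "'a::euclidean_space \<Rightarrow> real"
  assumes c: "c > 0"
  shows "levy_op \<alpha> \<epsilon> (\<lambda>x. f (c *\<^sub>R x)) x = c powr (2 * \<alpha>) * levy_op \<alpha> (c * \<epsilon>) f (c *\<^sub>R x)"
proof -
  have t: "tkern \<alpha> \<epsilon> h = c powr (real DIM('a) + 2 * \<alpha>) * tkern \<alpha> (c * \<epsilon>) (c *\<^sub>R h)" for h :: 'a
    using tkern_scale[OF c, of \<alpha> \<epsilon> h] c by (simp add: powr_add[symmetric] mult.assoc[symmetric])
  have "levy_op \<alpha> \<epsilon> (\<lambda>x. f (c *\<^sub>R x)) x =
     (\<integral>h. c powr (real DIM('a) + 2 * \<alpha>) * ((f (c *\<^sub>R x + c *\<^sub>R h) - f (c *\<^sub>R x)) * tkern \<alpha> (c * \<epsilon>) (c *\<^sub>R h)) \<partial>lborel)"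
    unfolding levy_op_def by (subst t) (simp add: scaleR_add_right mult_ac)
  also have "\<dots> = c powr (real DIM('a) + 2 * \<alpha>) * (levy_op \<alpha> (c * \<epsilon>) f (c *\<^sub>R x) / c ^ DIM('a))"
    using lborel_integral_scale(1)[of c "\<lambda>h. (f (c *\<^sub>R x + h) - f (c *\<^sub>R x)) * tkern \<alpha> (c * \<epsilon>) h"] c
    by (simp add: levy_op_def)
  also have "\<dots> = c powr (2 * \<alpha>) * levy_op \<alpha> (c * \<epsilon>) f (c *\<^sub>R x)"
    using c by (simp add: powr_add powr_realpow)
  finally show ?thesis .
qed

lemma integrable_tkern_of_kern:
  assumes "integrable lborel (\<lambda>h. F h * kern \<alpha> h)"
  shows "integrable lborel (\<lambda>h::'a::euclidean_space. F h * tkern \<alpha> \<epsilon> h)"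
proof -
  have "(\<lambda>h. F h * tkern \<alpha> \<epsilon> h) = (\<lambda>h. indicator {h. \<epsilon> < norm h} h *\<^sub>R (F h * kern \<alpha> h))"
    by (auto simp: tkern_def indicator_def)
  moreover have "{h::'a. \<epsilon> < norm h} \<in> sets lborel" by simp
  ultimately show ?thesis using integrable_mult_indicator[OF _ assms] by simp
qed

lemma integral_tkern_bound:
  assumes "integrable lborel (\<lambda>h::'a::euclidean_space. F h * kern \<alpha> h)"
  shows "\<bar>\<integral>h. F h * tkern \<alpha> \<epsilon> h \<partial>lborel\<bar> \<le> (\<integral>h. \<bar>F h\<bar> * kern \<alpha> h \<partial>lborel)"
proof -
  have i: "integrable lborel (\<lambda>h. \<bar>F h\<bar> * kern \<alpha> h)"
    using integrable_abs[OF assms] by (simp add: abs_mult)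
  have "\<bar>\<integral>h. F h * tkern \<alpha> \<epsilon> h \<partial>lborel\<bar> \<le> (\<integral>h. \<bar>F h * tkern \<alpha> \<epsilon> h\<bar> \<partial>lborel)"
    by (rule integral_abs_bound)
  also have "\<dots> \<le> (\<integral>h. \<bar>F h\<bar> * kern \<alpha> h \<partial>lborel)"
    using integrable_abs[OF integrable_tkern_of_kern[OF assms]] i
    by (rule integral_mono) (simp add: abs_mult tkern_le_kern mult_left_mono)
  finally show ?thesis .
qed

lemma integral_tkern_tendsto:
  assumes F: "integrable lborel (\<lambda>h::'a::euclidean_space. F h * kern \<alpha> h)"
  shows "((\<lambda>\<epsilon>. \<integral>h. F h * tkern \<alpha> \<epsilon> h \<partial>lborel) \<longlongrightarrow> (\<integral>h. F h * kern \<alpha> h \<partial>lborel)) (at_right 0)"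
proof -
  have "((\<lambda>t. \<integral>h. F h * tkern \<alpha> (inverse t) h \<partial>lborel) \<longlongrightarrow> (\<integral>h. F h * kern \<alpha> h \<partial>lborel)) at_top"
  proof (rule integral_dominated_convergence_at_top)
    show "integrable lborel (\<lambda>h. \<bar>F h\<bar> * kern \<alpha> h)"
      using integrable_abs[OF F] by (simp add: abs_mult)
    show "\<forall>\<^sub>F t in at_top. AE h in lborel. norm (F h * tkern \<alpha> (inverse t) h) \<le> \<bar>F h\<bar> * kern \<alpha> h"
      by (intro always_eventually allI AE_I2) (simp add: abs_mult tkern_le_kern mult_left_mono)
    show "AE h in lborel. ((\<lambda>t. F h * tkern \<alpha> (inverse t) h) \<longlongrightarrow> F h * kern \<alpha> h) at_top"
    proof (rule AE_I2, rule tendsto_eventually)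
      fix h :: 'a
      show "\<forall>\<^sub>F t in at_top. F h * tkern \<alpha> (inverse t) h = F h * kern \<alpha> h"
      proof (cases "h = 0")
        case True then show ?thesis by (simp add: tkern_def kern_def)
      next
        case False
        show ?thesis using eventually_gt_at_top[of "inverse (norm h)"]
        proof eventually_elim
          case (elim t)
          then have "inverse t < norm h"
            using less_imp_inverse_less[OF elim] False by simp
          then show ?case by (simp add: tkern_def)
        qed
      qed
    qed
  qed (use F integrable_tkern_of_kern[OF F] in \<open>auto dest: borel_measurable_integrable\<close>)
  then show ?thesis by (subst filterlim_at_right_to_top)
qed

locale fractional_order =
  fixes \<alpha> :: real
  assumes alpha: "0 < \<alpha>" "\<alpha> < 1"
begin

lemma integrable_tkern:
  assumes "\<epsilon> > 0"
  shows "integrable lborel (tkern \<alpha> \<epsilon> :: 'a::euclidean_space \<Rightarrow> real)"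
proof (rule Bochner_Integration.integrable_bound)
  show "integrable lborel (\<lambda>x::'a. indicator (- ball 0 \<epsilon>) x * norm x powr (- (real DIM('a) + 2 * \<alpha>)))"
    by (rule integrable_norm_powr_outside) (use alpha assms in auto)
qed (auto simp: tkern_def kern_def indicator_def)

text \<open>The kernel is a Levy kernel: the exponents \<open>2 - 2\<alpha>\<close> at the origin and \<open>-2\<alpha>\<close> at infinity that remain
  after polar integration are positive and negative.\<close>

lemma integrable_min_kern:
  "integrable lborel (\<lambda>h::'a::euclidean_space. min 1 ((norm h)\<^sup>2) * kern \<alpha> h)"
proof (rule Bochner_Integration.integrable_bound)
  show "integrable lborel (\<lambda>x::'a. indicator (cball 0 1) x * norm x powr (- (real DIM('a) + 2 * \<alpha> - 2))
     + indicator (- ball 0 1) x * norm x powr (- (real DIM('a) + 2 * \<alpha>)))"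
    by (intro Bochner_Integration.integrable_add integrable_norm_powr_cball integrable_norm_powr_outside) (use alpha in auto)
  have p: "norm h powr (- (real DIM('a) + 2 * \<alpha> - 2)) = (norm h)\<^sup>2 * kern \<alpha> h" if "h \<noteq> 0" for h :: 'a
  proof -
    have "(norm h)\<^sup>2 = norm h powr 2" using that by (simp add: powr_numeral)
    then show ?thesis unfolding kern_def by (simp only: powr_add[symmetric]) (simp add: algebra_simps)
  qed
  show "AE x in lborel. norm (min 1 ((norm x)\<^sup>2) * kern \<alpha> x)
     \<le> norm (indicator (cball 0 1) x * norm x powr (- (real DIM('a) + 2 * \<alpha> - 2))
     + indicator (- ball 0 1) x * norm (x::'a) powr (- (real DIM('a) + 2 * \<alpha>)))"
  proof (rule AE_I2)
    fix x :: 'a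
    have n: "0 \<le> indicat_real (cball 0 1) x * norm x powr (- (real DIM('a) + 2 * \<alpha> - 2))"
      "0 \<le> indicat_real (- ball 0 1) x * norm (x::'a) powr (- (real DIM('a) + 2 * \<alpha>))"
      by (auto simp: indicator_def)
    show "norm (min 1 ((norm x)\<^sup>2) * kern \<alpha> x)
     \<le> norm (indicator (cball 0 1) x * norm x powr (- (real DIM('a) + 2 * \<alpha> - 2))
     + indicator (- ball 0 1) x * norm (x::'a) powr (- (real DIM('a) + 2 * \<alpha>)))"
    proof (cases "x = 0")
      case False
      have "min 1 ((norm x)\<^sup>2) * kern \<alpha> x \<le> indicator (cball 0 1) x * norm x powr (- (real DIM('a) + 2 * \<alpha> - 2))
         + indicator (- ball 0 1) x * norm (x::'a) powr (- (real DIM('a) + 2 * \<alpha>))"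
      proof (cases "norm x \<le> 1")
        case True
        then show ?thesis unfolding p[OF False] using n(2) False
          by (auto simp: abs_mult intro!: add_increasing2 mult_right_mono)
      next
        case f: False
        have "min 1 ((norm x)\<^sup>2) * kern \<alpha> x \<le> kern \<alpha> x"
          using mult_right_mono[of "min 1 ((norm x)\<^sup>2)" 1 "kern \<alpha> x"] by simp
        then show ?thesis using f by (auto simp: kern_def indicator_def)
      qed
      then show ?thesis using n by (simp add: abs_mult)
    qed (auto simp: kern_def)
  qed
qed measurable

definition levy_mass :: "'a::euclidean_space itself \<Rightarrow> real" where
  "levy_mass _ = (\<integral>h. min 1 ((norm (h::'a))\<^sup>2) * kern \<alpha> h \<partial>lborel)"

lemma levy_mass_nonneg: "0 \<le> levy_mass TYPE('a::euclidean_space)"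
  unfolding levy_mass_def by (intro integral_nonneg_AE) auto

text \<open>The factor \<open>r\<close> to the power \<open>-2\<alpha>\<close> is the size of the operator on a function that varies on the
  length scale \<open>r\<close>.\<close>

lemma min_kern_scaled:
  assumes r: "r > 0"
  shows "integrable lborel (\<lambda>h::'a::euclidean_space. min 1 ((norm h / r)\<^sup>2) * kern \<alpha> h)"
    and "(\<integral>h. min 1 ((norm h / r)\<^sup>2) * kern \<alpha> (h::'a) \<partial>lborel) = r powr (- 2 * \<alpha>) * levy_mass TYPE('a)"
proof -
  have e: "min 1 ((norm (r *\<^sub>R h) / r)\<^sup>2) * kern \<alpha> (r *\<^sub>R h) =
     r powr (- (real DIM('a) + 2 * \<alpha>)) * (min 1 ((norm h)\<^sup>2) * kern \<alpha> h)" for h :: 'a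
    using r by (simp add: kern_scale)
  have "integrable lborel (\<lambda>h::'a. min 1 ((norm (r *\<^sub>R h) / r)\<^sup>2) * kern \<alpha> (r *\<^sub>R h))"
    unfolding e by (simp add: integrable_min_kern)
  then show "integrable lborel (\<lambda>h::'a::euclidean_space. min 1 ((norm h / r)\<^sup>2) * kern \<alpha> h)"
    using r by (subst (asm) lborel_integral_scale(2)) auto
  have "r powr (- (real DIM('a) + 2 * \<alpha>)) * levy_mass TYPE('a) = (\<integral>h. min 1 ((norm h / r)\<^sup>2) * kern \<alpha> (h::'a) \<partial>lborel) / r ^ DIM('a)"
    using lborel_integral_scale(1)[of r "\<lambda>h::'a. min 1 ((norm h / r)\<^sup>2) * kern \<alpha> h"] r
    unfolding e levy_mass_def by simp
  then have "(\<integral>h. min 1 ((norm h / r)\<^sup>2) * kern \<alpha> (h::'a) \<partial>lborel) = r powr real DIM('a) * r powr (- (real DIM('a) + 2 * \<alpha>)) * levy_mass TYPE('a)"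
    using r by (simp add: field_simps powr_realpow)
  then show "(\<integral>h. min 1 ((norm h / r)\<^sup>2) * kern \<alpha> (h::'a) \<partial>lborel) = r powr (- 2 * \<alpha>) * levy_mass TYPE('a)"
    by (simp add: powr_add[symmetric])
qed

lemma integrable_bounded_tkern:
  fixes f :: "'a::euclidean_space \<Rightarrow> real"
  assumes [measurable]: "f \<in> borel_measurable borel" and b: "\<And>x. \<bar>f x\<bar> \<le> B" and e: "\<epsilon> > 0"
  shows "integrable lborel (\<lambda>h. f (x + h) * tkern \<alpha> \<epsilon> h)"
proof (rule Bochner_Integration.integrable_bound)
  show "integrable lborel (\<lambda>h::'a. B * tkern \<alpha> \<epsilon> h)" by (simp add: integrable_tkern e)
  have "0 \<le> B" using b[of 0] by linarith
  then show "AE h in lborel. norm (f (x + h) * tkern \<alpha> \<epsilon> h) \<le> norm (B * tkern \<alpha> \<epsilon> h)"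
    using b by (auto simp: abs_mult intro!: mult_right_mono)
qed simp

lemma integrable_bounded_increment:
  fixes f :: "'a::euclidean_space \<Rightarrow> real"
  assumes f: "f \<in> borel_measurable borel" and b: "\<And>x. \<bar>f x\<bar> \<le> B" and e: "\<epsilon> > 0"
  shows "integrable lborel (\<lambda>h. (f (x + h) - f x) * tkern \<alpha> \<epsilon> h)"
proof -
  have "integrable lborel (\<lambda>h. f x * tkern \<alpha> \<epsilon> h)" by (simp add: integrable_tkern e)
  from Bochner_Integration.integrable_diff[OF integrable_bounded_tkern[OF f b e, where x=x] this]
  show ?thesis by (simp add: left_diff_distrib)
qed

text \<open>Averaging over \<open>h\<close> and \<open>-h\<close> cancels the first-order part, so that the principal value becomes an
  absolutely convergent integral of second differences.\<close>

lemma levy_op_eq_sdiff: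
  fixes f :: "'a::euclidean_space \<Rightarrow> real"
  assumes e: "\<epsilon> > 0" and i: "integrable lborel (\<lambda>h. f (x + h) * tkern \<alpha> \<epsilon> h)"
  shows "levy_op \<alpha> \<epsilon> f x = (\<integral>h. sdiff f x h * tkern \<alpha> \<epsilon> h \<partial>lborel) / 2"
proof -
  have j: "integrable lborel (\<lambda>h. f x * tkern \<alpha> \<epsilon> h)" by (simp add: integrable_tkern e)
  have k: "integrable lborel (\<lambda>h. (f (x + h) - f x) * tkern \<alpha> \<epsilon> h)"
    using Bochner_Integration.integrable_diff[OF i j] by (simp add: left_diff_distrib)
  have m: "(\<integral>h. (f (x - h) - f x) * tkern \<alpha> \<epsilon> h \<partial>lborel) = levy_op \<alpha> \<epsilon> f x"
    using lborel_integral_minus(1)[of "\<lambda>h. (f (x + h) - f x) * tkern \<alpha> \<epsilon> h"] by (simp add: levy_op_def)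
  have k': "integrable lborel (\<lambda>h. (f (x - h) - f x) * tkern \<alpha> \<epsilon> h)"
    using lborel_integral_minus(2)[of "\<lambda>h. (f (x + h) - f x) * tkern \<alpha> \<epsilon> h"] k by simp
  have "(\<integral>h. sdiff f x h * tkern \<alpha> \<epsilon> h \<partial>lborel) =
    (\<integral>h. (f (x + h) - f x) * tkern \<alpha> \<epsilon> h + (f (x - h) - f x) * tkern \<alpha> \<epsilon> h \<partial>lborel)"
    by (simp add: sdiff_def algebra_simps)
  also have "\<dots> = 2 * levy_op \<alpha> \<epsilon> f x"
    by (subst Bochner_Integration.integral_add[OF k k']) (simp add: m, simp add: levy_op_def)
  finally show ?thesis by simp
qed

lemma levy_op_tendsto:
  fixes f :: "'a::euclidean_space \<Rightarrow> real"
  assumes i: "\<And>\<epsilon>. \<epsilon> > 0 \<Longrightarrow> integrable lborel (\<lambda>h. f (x + h) * tkern \<alpha> \<epsilon> h)"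
    and s: "integrable lborel (\<lambda>h. sdiff f x h * kern \<alpha> h)"
  shows "((\<lambda>\<epsilon>. levy_op \<alpha> \<epsilon> f x) \<longlongrightarrow> (\<integral>h. sdiff f x h * kern \<alpha> h \<partial>lborel) / 2) (at_right 0)"
proof -
  have "((\<lambda>\<epsilon>. (\<integral>h. sdiff f x h * tkern \<alpha> \<epsilon> h \<partial>lborel) / 2) \<longlongrightarrow> (\<integral>h. sdiff f x h * kern \<alpha> h \<partial>lborel) / 2) (at_right 0)"
    by (intro tendsto_divide integral_tkern_tendsto s) auto
  moreover have "\<forall>\<^sub>F \<epsilon> in at_right 0. levy_op \<alpha> \<epsilon> f x = (\<integral>h. sdiff f x h * tkern \<alpha> \<epsilon> h \<partial>lborel) / 2"
    using eventually_at_right_less[of "0::real"]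
    by eventually_elim (rule levy_op_eq_sdiff[OF _ i])
  ultimately show ?thesis by (subst tendsto_cong)
qed

text \<open>The estimate by which bumps enter, both as barriers and as test functions: the operator on a
  function that varies on the scale \<open>r\<close>, uniformly in the truncation.\<close>

lemma levy_op_bound:
  fixes f :: "'a::euclidean_space \<Rightarrow> real"
  assumes [measurable]: "f \<in> borel_measurable borel" and b: "\<And>x. \<bar>f x\<bar> \<le> B" and r: "r > 0"
    and s: "\<And>h. \<bar>sdiff f x h\<bar> \<le> D * min 1 ((norm h / r)\<^sup>2)"
  shows "integrable lborel (\<lambda>h. sdiff f x h * kern \<alpha> h)"
    and "\<epsilon> > 0 \<Longrightarrow> \<bar>levy_op \<alpha> \<epsilon> f x\<bar> \<le> D * r powr (- 2 * \<alpha>) * levy_mass TYPE('a)"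
proof -
  have D: "0 \<le> D"
  proof (rule ccontr)
    obtain h :: 'a where h: "h \<noteq> 0" by (metis nonzero_Basis SOME_Basis)
    assume "\<not> 0 \<le> D"
    then have "D * min 1 ((norm h / r)\<^sup>2) < 0" using h r by (intro mult_neg_pos) auto
    then show False using s[of h] by linarith
  qed
  have i: "integrable lborel (\<lambda>h::'a. D * (min 1 ((norm h / r)\<^sup>2) * kern \<alpha> h))"
    by (simp add: min_kern_scaled(1)[OF r])
  have le: "\<bar>sdiff f x h\<bar> * kern \<alpha> h \<le> D * (min 1 ((norm h / r)\<^sup>2) * kern \<alpha> h)" for h
    using mult_right_mono[OF s[of h], of "kern \<alpha> h"] by (simp add: mult.assoc)
  show S: "integrable lborel (\<lambda>h. sdiff f x h * kern \<alpha> h)"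
  proof (rule Bochner_Integration.integrable_bound[OF i])
    show "(\<lambda>h. sdiff f x h * kern \<alpha> h) \<in> borel_measurable lborel" unfolding sdiff_def by measurable
  qed (use le D in \<open>auto simp: abs_mult\<close>)
  assume e: "\<epsilon> > 0"
  have "(\<integral>h. \<bar>sdiff f x h\<bar> * kern \<alpha> h \<partial>lborel) \<le> (\<integral>h. D * (min 1 ((norm (h::'a) / r)\<^sup>2) * kern \<alpha> h) \<partial>lborel)"
    using integrable_abs[OF S] by (intro integral_mono i le) (simp add: abs_mult)
  also have "\<dots> = D * r powr (- 2 * \<alpha>) * levy_mass TYPE('a)"
    using min_kern_scaled(2)[OF r, where 'a='a] by simp
  finally have "\<bar>\<integral>h. sdiff f x h * tkern \<alpha> \<epsilon> h \<partial>lborel\<bar> \<le> D * r powr (- 2 * \<alpha>) * levy_mass TYPE('a)"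
    using integral_tkern_bound[OF S, of \<epsilon>] by linarith
  then show "\<bar>levy_op \<alpha> \<epsilon> f x\<bar> \<le> D * r powr (- 2 * \<alpha>) * levy_mass TYPE('a)"
    unfolding levy_op_eq_sdiff[OF e integrable_bounded_tkern[OF assms(1) b e], of x] by linarith
qed

end

section \<open>Radial functions and the bump\<close>

text \<open>In terms of the squared norm the two increments are \<open>\<plusminus>2 x\<cdot>h + |h|\<^sup>2\<close>, so the first-order
  terms of a radial function combine to order \<open>|h|\<^sup>2\<close>.\<close>

lemma sdiff_radial:
  fixes x h :: "'a::euclidean_space"
  assumes tay: "\<And>\<delta>. \<bar>\<delta>\<bar> \<le> 2 * norm x * norm h + (norm h)\<^sup>2 \<Longrightarrow> - (norm x)\<^sup>2 + m \<le> \<delta> \<Longrightarrow>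
       \<bar>\<phi> ((norm x)\<^sup>2 + \<delta>) - \<phi> ((norm x)\<^sup>2) - d * \<delta>\<bar> \<le> A * \<delta>\<^sup>2"
    and m: "m \<le> (norm (x + h))\<^sup>2" "m \<le> (norm (x - h))\<^sup>2" and A: "0 \<le> A"
  shows "\<bar>sdiff (\<lambda>x. \<phi> ((norm x)\<^sup>2)) x h\<bar> \<le> 2 * \<bar>d\<bar> * (norm h)\<^sup>2 + 2 * A * (2 * norm x * norm h + (norm h)\<^sup>2)\<^sup>2"
proof -
  define \<delta>1 where "\<delta>1 = 2 * (x \<bullet> h) + (norm h)\<^sup>2"
  define \<delta>2 where "\<delta>2 = - 2 * (x \<bullet> h) + (norm h)\<^sup>2"
  let ?e = "2 * norm x * norm h + (norm h)\<^sup>2"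
  have e1: "(norm (x + h))\<^sup>2 = (norm x)\<^sup>2 + \<delta>1" by (simp add: \<delta>1_def power2_norm_eq_inner algebra_simps inner_commute)
  have e2: "(norm (x - h))\<^sup>2 = (norm x)\<^sup>2 + \<delta>2" by (simp add: \<delta>2_def power2_norm_eq_inner algebra_simps inner_commute)
  have cs: "\<bar>x \<bullet> h\<bar> \<le> norm x * norm h" by (rule Cauchy_Schwarz_ineq2)
  have ab: "\<bar>2 * t + n\<bar> \<le> 2 * m + n" "\<bar>- 2 * t + n\<bar> \<le> 2 * m + n" if "\<bar>t\<bar> \<le> m" "0 \<le> n" for t m n :: real
    using that by linarith+
  have b: "\<bar>\<delta>1\<bar> \<le> ?e" "\<bar>\<delta>2\<bar> \<le> ?e"
    using ab[OF cs, of "(norm h)\<^sup>2"] by (auto simp: \<delta>1_def \<delta>2_def mult.assoc)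
  have t1: "\<bar>\<phi> ((norm x)\<^sup>2 + \<delta>1) - \<phi> ((norm x)\<^sup>2) - d * \<delta>1\<bar> \<le> A * \<delta>1\<^sup>2"
    by (rule tay) (use b m e1 in auto)
  have t2: "\<bar>\<phi> ((norm x)\<^sup>2 + \<delta>2) - \<phi> ((norm x)\<^sup>2) - d * \<delta>2\<bar> \<le> A * \<delta>2\<^sup>2"
    by (rule tay) (use b m e2 in auto)
  have q: "\<delta>1\<^sup>2 \<le> ?e\<^sup>2" "\<delta>2\<^sup>2 \<le> ?e\<^sup>2" using b by (auto simp: abs_le_square_iff[symmetric])
  have q': "A * \<delta>1\<^sup>2 \<le> A * ?e\<^sup>2" "A * \<delta>2\<^sup>2 \<le> A * ?e\<^sup>2" using q A by (auto intro: mult_left_mono)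
  have s: "d * \<delta>1 + d * \<delta>2 = 2 * d * (norm h)\<^sup>2" by (simp add: \<delta>1_def \<delta>2_def algebra_simps)
  have "\<bar>2 * d * (norm h)\<^sup>2\<bar> = 2 * \<bar>d\<bar> * (norm h)\<^sup>2" by (simp add: abs_mult)
  then show ?thesis unfolding sdiff_def e1 e2 using t1 t2 q' s by linarith
qed

text \<open>This power of the positive part is only of class \<open>C\<^sup>1\<close> with Lipschitz gradient, which is the
  smoothness that second differences see, and it is elementary to estimate.\<close>

definition bump :: "'a::euclidean_space \<Rightarrow> real" where
  "bump x = (max 0 (1 - (norm x)\<^sup>2))\<^sup>2"

lemma bump_simps [simp]: "bump 0 = 1" "0 \<le> bump x" "bump x \<le> 1" "bump (- x) = bump x"
  by (auto simp: bump_def max_def power_le_one)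

lemma bump_eq_0: "1 \<le> norm x \<Longrightarrow> bump x = 0"
  using power_mono[of 1 "norm x" 2] by (simp add: bump_def max_absorb1)

lemma continuous_bump: "continuous_on S bump"
  unfolding bump_def by (intro continuous_intros)

lemma bump_measurable [measurable]: "(bump :: 'a::euclidean_space \<Rightarrow> real) \<in> borel_measurable borel"
  by (rule borel_measurable_continuous_onI[OF continuous_bump])

lemma bump_sdiff:
  fixes x h :: "'a::euclidean_space"
  shows "\<bar>sdiff bump x h\<bar> \<le> 54 * min 1 ((norm h)\<^sup>2)"
proof -
  have b4: "\<bar>sdiff bump x h\<bar> \<le> 4"
    using bump_simps(2,3)[of "x+h"] bump_simps(2,3)[of "x-h"] bump_simps(2,3)[of "x"]
    unfolding sdiff_def by linarith
  consider "norm h \<ge> 1" | "norm h < 1" "norm x > 2" | "norm h < 1" "norm x \<le> 2" by linarith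
  then show ?thesis
  proof cases
    case 1
    then have "min 1 ((norm h)\<^sup>2) = 1" using power_mono[of 1 "norm h" 2] by simp
    then show ?thesis using b4 by simp
  next
    case 2
    have "norm (x + h) \<ge> 1" "norm (x - h) \<ge> 1" using 2 norm_triangle_ineq2[of x h] norm_triangle_ineq2[of x "-h"] by auto
    then show ?thesis using 2 by (simp add: sdiff_def bump_eq_0)
  next
    case 3
    define \<phi> :: "real \<Rightarrow> real" where "\<phi> = (\<lambda>s. (max 0 (1 - s))\<^sup>2)"
    define a where "a = 1 - (norm x)\<^sup>2"
    \<comment> \<open>The square of the positive part deviates from its tangent by at most the square of the increment.\<close>
    have tay: "\<bar>(max 0 (a - \<delta>))\<^sup>2 - (max 0 a)\<^sup>2 - (-2 * max 0 a) * \<delta>\<bar> \<le> 1 * \<delta>\<^sup>2" for \<delta>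
    proof -
      consider "a \<ge> 0" "a - \<delta> \<ge> 0" | "a \<ge> 0" "a - \<delta> < 0" | "a < 0" "a - \<delta> \<ge> 0" | "a < 0" "a - \<delta> < 0" by linarith
      then show ?thesis
      proof cases
        case 1 then show ?thesis by (simp add: power2_eq_square algebra_simps)
      next
        case 2
        have "0 \<le> a * (\<delta> - a)" "a * \<delta> \<ge> 0" "0 \<le> (\<delta> - a)\<^sup>2" "0 \<le> \<delta> * \<delta>" using 2 by auto
        then have "\<bar>0 - a\<^sup>2 + 2 * (a * \<delta>)\<bar> \<le> \<delta>\<^sup>2"
          unfolding power2_diff by (simp only: power2_eq_square right_diff_distrib mult.commute[of \<delta> a] mult.assoc)
        then show ?thesis using 2 by simp
      next
        case 3
        then have "(a - \<delta>)\<^sup>2 \<le> (-\<delta>)\<^sup>2" by (intro power_mono) auto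
        then show ?thesis using 3 by simp
      next
        case 4 then show ?thesis by simp
      qed
    qed
    have nn: "norm h * norm h \<le> norm h" using 3 mult_left_le[of "norm h" "norm h"] by auto
    have "\<bar>sdiff (\<lambda>x. \<phi> ((norm x)\<^sup>2)) x h\<bar> \<le> 2 * \<bar>-2 * max 0 a\<bar> * (norm h)\<^sup>2 + 2 * 1 * (2 * norm x * norm h + (norm h)\<^sup>2)\<^sup>2"
    proof (rule sdiff_radial[where m=0])
      fix \<delta> :: real
      show "\<bar>\<phi> ((norm x)\<^sup>2 + \<delta>) - \<phi> ((norm x)\<^sup>2) - (- 2 * max 0 a) * \<delta>\<bar> \<le> 1 * \<delta>\<^sup>2"
        using tay[of \<delta>] by (simp add: \<phi>_def a_def diff_diff_eq)
    qed auto
    \<comment> \<open>For \<open>x\<close> of norm at most 2 and \<open>h\<close> of norm below 1 the increments of the squared norm are at most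
      five times the norm of \<open>h\<close>; this is where the constant \<open>54 = 4 + 50\<close> comes from.\<close>
    also have "\<dots> \<le> 2 * 2 * (norm h)\<^sup>2 + 2 * 1 * (5 * norm h)\<^sup>2"
    proof (intro add_mono mult_left_mono mult_right_mono power_mono)
      show "\<bar>- 2 * max 0 a\<bar> \<le> 2" by (auto simp: a_def abs_mult)
      have "2 * norm x * norm h \<le> 4 * norm h" using 3 by (intro mult_right_mono) auto
      then show "2 * norm x * norm h + (norm h)\<^sup>2 \<le> 5 * norm h" using nn unfolding power2_eq_square by linarith
    qed auto
    also have "\<dots> = 54 * (norm h)\<^sup>2" by (simp add: power2_eq_square)
    also have "\<dots> = 54 * min 1 ((norm h)\<^sup>2)" using 3 by (simp add: power_le_one)
    finally show ?thesis by (simp add: \<phi>_def bump_def[abs_def])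
  qed
qed

section \<open>Test functions\<close>

lemma frac_lap_eps_eq_levy_op:
  fixes f :: "'a::euclidean_space \<Rightarrow> real"
  assumes [measurable]: "f \<in> borel_measurable borel"
  shows "frac_lap_eps \<alpha> \<epsilon> f x = - levy_op \<alpha> \<epsilon> f x"
proof -
  let ?g = "\<lambda>z. indicator {z. norm (z - x) > \<epsilon>} z * ((f z - f x) / norm (z - x) powr (real DIM('a) + 2 * \<alpha>))"
  have "frac_lap_eps \<alpha> \<epsilon> f x = - (\<integral>z. ?g z \<partial>lebesgue)"
    by (simp add: frac_lap_eps_def set_lebesgue_integral_def)
  also have "(\<integral>z. ?g z \<partial>lebesgue) = (\<integral>z. ?g z \<partial>lborel)"
    by (rule integral_completion) measurable
  also have "\<dots> = (\<integral>h. ?g (h + x) \<partial>lborel)" by (rule lborel_integral_shift(1)[symmetric])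
  also have "\<dots> = levy_op \<alpha> \<epsilon> f x"
    unfolding levy_op_def
  proof (rule Bochner_Integration.integral_cong)
    fix h :: 'a
    show "?g (h + x) = (f (x + h) - f x) * tkern \<alpha> \<epsilon> h"
      unfolding tkern_def kern_def powr_minus_divide
      by (simp add: add.commute[of h x] indicator_def)
  qed simp
  finally show ?thesis .
qed

lemma integral_dominated_convergence_at_right_0:
  fixes s :: "real \<Rightarrow> 'a \<Rightarrow> real"
  assumes "f \<in> borel_measurable M" "\<And>t. s t \<in> borel_measurable M" "integrable M w"
    and lim: "\<And>x. ((\<lambda>t. s t x) \<longlongrightarrow> f x) (at_right 0)"
    and bound: "\<And>t x. t > 0 \<Longrightarrow> \<bar>s t x\<bar> \<le> w x"
  shows "((\<lambda>t. integral\<^sup>L M (s t)) \<longlongrightarrow> integral\<^sup>L M f) (at_right 0)" "integrable M f"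
proof -
  have l: "((\<lambda>t. s (inverse t) x) \<longlongrightarrow> f x) at_top" for x
    using lim[of x] by (subst (asm) filterlim_at_right_to_top)
  have b: "\<forall>\<^sub>F t in at_top. AE x in M. norm (s (inverse t) x) \<le> w x"
    using eventually_gt_at_top[of 0] by eventually_elim (simp add: bound)
  have "((\<lambda>t. integral\<^sup>L M (s (inverse t))) \<longlongrightarrow> integral\<^sup>L M f) at_top"
    by (rule integral_dominated_convergence_at_top[where w=w]) (use assms l b in auto)
  then show "((\<lambda>t. integral\<^sup>L M (s t)) \<longlongrightarrow> integral\<^sup>L M f) (at_right 0)"
    by (subst filterlim_at_right_to_top)
  have "\<bar>f x\<bar> \<le> w x" for x
  proof (rule tendsto_upperbound[OF tendsto_rabs[OF lim[of x]]])
    show "\<forall>\<^sub>F t in at_right 0. \<bar>s t x\<bar> \<le> w x"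
      using eventually_at_right_less[of "0::real"] by eventually_elim (simp add: bound)
  qed simp
  then show "integrable M f"
    using assms(1,3) by (intro Bochner_Integration.integrable_bound[of M w f]) (auto intro: order_trans[OF _ abs_ge_self])
qed

definition wgt :: "real \<Rightarrow> 'a::euclidean_space \<Rightarrow> real" where
  "wgt \<alpha> x = 1 / (1 + norm x powr (real DIM('a) + 2 * \<alpha>))"

lemma wgt_pos: "0 < wgt \<alpha> x" and wgt_le_1: "wgt \<alpha> x \<le> 1"
  by (auto simp: wgt_def add_pos_nonneg divide_simps)

lemma wgt_measurable [measurable]: "(wgt \<alpha> :: 'a::euclidean_space \<Rightarrow> real) \<in> borel_measurable borel"
  unfolding wgt_def by measurable

text \<open>A substitute for smooth compactly supported functions that the radial bump satisfies: second
  differences are controlled by the function that the kernel integrates.\<close>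

definition c11_supported :: "('a::euclidean_space \<Rightarrow> real) \<Rightarrow> bool" where
  "c11_supported f \<longleftrightarrow> continuous_on UNIV f \<and> (\<exists>\<rho>. \<forall>x. norm x \<ge> \<rho> \<longrightarrow> f x = 0) \<and>
     (\<exists>D. \<forall>x h. \<bar>sdiff f x h\<bar> \<le> D * min 1 ((norm h)\<^sup>2))"

lemma c11_supportedD:
  fixes f :: "'a::euclidean_space \<Rightarrow> real"
  assumes "c11_supported f"
  obtains \<rho> B D where "\<rho> > 0" "B > 0" "D > 0" "\<And>x. norm x \<ge> \<rho> \<Longrightarrow> f x = 0" "\<And>x. \<bar>f x\<bar> \<le> B"
    "\<And>x h. \<bar>sdiff f x h\<bar> \<le> D * min 1 ((norm h)\<^sup>2)" "f \<in> borel_measurable borel"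
proof -
  have c: "continuous_on UNIV f" using assms by (simp add: c11_supported_def)
  obtain \<rho> where \<rho>: "\<And>x. norm x \<ge> \<rho> \<Longrightarrow> f x = 0" using assms by (auto simp: c11_supported_def)
  obtain D where D: "\<And>x h. \<bar>sdiff f x h\<bar> \<le> D * min 1 ((norm h)\<^sup>2)" using assms by (auto simp: c11_supported_def)
  have "compact (f ` cball 0 \<rho>)" by (rule compact_continuous_image) (auto intro: continuous_on_subset[OF c])
  then obtain B where B: "\<forall>y\<in>f ` cball 0 \<rho>. norm y \<le> B" using compact_imp_bounded bounded_iff by metis
  show ?thesis
  proof
    show "\<bar>f x\<bar> \<le> max B 1" for x
      using B \<rho>[of x] by (cases "norm x \<le> \<rho>") (auto simp: le_max_iff_disj)
    show "\<bar>sdiff f x h\<bar> \<le> max D 1 * min 1 ((norm h)\<^sup>2)" for x h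
      using D[of x h] mult_right_mono[of D "max D 1" "min 1 ((norm h)\<^sup>2)"] by simp
    show "f \<in> borel_measurable borel" by (rule borel_measurable_continuous_onI[OF c])
    show "norm x \<ge> max \<rho> 1 \<Longrightarrow> f x = 0" for x using \<rho>[of x] by simp
  qed auto
qed

lemma c11_supported_diff:
  assumes "c11_supported f" "c11_supported g"
  shows "c11_supported (\<lambda>x. f x - g x)"
proof -
  obtain r1 D1 where 1: "\<And>x. norm x \<ge> r1 \<Longrightarrow> f x = 0" "\<And>x h. \<bar>sdiff f x h\<bar> \<le> D1 * min 1 ((norm h)\<^sup>2)"
    using assms(1) by (auto simp: c11_supported_def)
  obtain r2 D2 where 2: "\<And>x. norm x \<ge> r2 \<Longrightarrow> g x = 0" "\<And>x h. \<bar>sdiff g x h\<bar> \<le> D2 * min 1 ((norm h)\<^sup>2)"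
    using assms(2) by (auto simp: c11_supported_def)
  have "\<bar>sdiff (\<lambda>x. f x - g x) x h\<bar> \<le> (D1 + D2) * min 1 ((norm h)\<^sup>2)" for x h
  proof -
    have "sdiff (\<lambda>x. f x - g x) x h = sdiff f x h - sdiff g x h" by (simp add: sdiff_def)
    then show ?thesis using 1(2)[of x h] 2(2)[of x h] unfolding distrib_right by linarith
  qed
  moreover have "\<forall>x. norm x \<ge> max r1 r2 \<longrightarrow> f x - g x = 0" using 1(1) 2(1) by simp
  ultimately show ?thesis using assms unfolding c11_supported_def by (blast intro: continuous_on_diff)
qed

lemma c11_supported_cmult:
  assumes "c11_supported f" shows "c11_supported (\<lambda>x. c * f x)"
proof -
  obtain r1 D1 where 1: "\<And>x. norm x \<ge> r1 \<Longrightarrow> f x = 0" "\<And>x h. \<bar>sdiff f x h\<bar> \<le> D1 * min 1 ((norm h)\<^sup>2)"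
    using assms(1) by (auto simp: c11_supported_def)
  have "\<bar>sdiff (\<lambda>x. c * f x) x h\<bar> \<le> (\<bar>c\<bar> * D1) * min 1 ((norm h)\<^sup>2)" for x h
  proof -
    have "sdiff (\<lambda>x. c * f x) x h = c * sdiff f x h" by (simp add: sdiff_def algebra_simps)
    then show ?thesis using mult_left_mono[OF 1(2)[of x h], of "\<bar>c\<bar>"] by (simp add: abs_mult mult_ac)
  qed
  moreover have "\<forall>x. norm x \<ge> r1 \<longrightarrow> c * f x = 0" using 1(1) by simp
  ultimately show ?thesis using assms unfolding c11_supported_def by (blast intro: continuous_on_mult_left)
qed

lemma bump_affine_sdiff:
  assumes "r > 0"
  shows "\<bar>sdiff (\<lambda>y. bump ((y - a) /\<^sub>R r)) x h\<bar> \<le> 54 * min 1 ((norm h / r)\<^sup>2)"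
proof -
  have "sdiff (\<lambda>y. bump ((y - a) /\<^sub>R r)) x h = sdiff bump ((x - a) /\<^sub>R r) (h /\<^sub>R r)"
    by (simp add: sdiff_def scaleR_right_distrib[symmetric] scaleR_right_diff_distrib[symmetric] algebra_simps del: scaleR_right_distrib scaleR_right_diff_distrib)
  then show ?thesis using bump_sdiff[of "(x - a) /\<^sub>R r" "h /\<^sub>R r"] assms by (simp add: divide_inverse_commute)
qed

lemma bump_affine_eq_0: "r > 0 \<Longrightarrow> norm (y - a) \<ge> r \<Longrightarrow> bump ((y - a) /\<^sub>R r) = 0"
  by (rule bump_eq_0) (simp add: divide_simps)

lemma c11_supported_bump:
  assumes r: "r > 0"
  shows "c11_supported (\<lambda>y::'a::euclidean_space. bump ((y - a) /\<^sub>R r))"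
proof -
  have "continuous_on UNIV (\<lambda>y::'a. bump ((y - a) /\<^sub>R r))"
    unfolding bump_def by (intro continuous_intros)
  moreover have "bump ((y - a) /\<^sub>R r) = 0" if "norm y \<ge> r + norm a" for y :: 'a
    using that norm_triangle_ineq2[of y a] by (intro bump_affine_eq_0 r) auto
  moreover have "\<bar>sdiff (\<lambda>y::'a. bump ((y - a) /\<^sub>R r)) x h\<bar> \<le> (54 * max 1 (1 / r\<^sup>2)) * min 1 ((norm h)\<^sup>2)" for x h
  proof -
    have "min 1 ((norm h / r)\<^sup>2) \<le> max 1 (1 / r\<^sup>2) * min 1 ((norm h)\<^sup>2)"
    proof (cases "(norm h)\<^sup>2 \<le> 1")
      case True
      have "min 1 ((norm h / r)\<^sup>2) \<le> (1 / r\<^sup>2) * (norm h)\<^sup>2" by (simp add: power_divide)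
      also have "\<dots> \<le> max 1 (1 / r\<^sup>2) * (norm h)\<^sup>2" by (intro mult_right_mono) auto
      finally show ?thesis using True by simp
    qed auto
    then show ?thesis using bump_affine_sdiff[OF r, of a x h] by linarith
  qed
  ultimately show ?thesis unfolding c11_supported_def by blast
qed

lemma integral_indicator_cball_shift:
  fixes y :: "'a::euclidean_space"
  assumes "\<rho> \<ge> 0"
  shows "integrable lborel (\<lambda>h::'a. indicator (cball 0 \<rho>) (y + h) :: real)"
    and "(\<integral>h. indicator (cball (0::'a) \<rho>) (y + h) \<partial>lborel) = unit_ball_vol (real DIM('a)) * \<rho> ^ DIM('a)"
proof -
  have "integrable lborel (indicator (cball (0::'a) \<rho>) :: _ \<Rightarrow> real)"
    using assms by (auto simp: emeasure_cball)
  then show "integrable lborel (\<lambda>h::'a. indicator (cball 0 \<rho>) (y + h) :: real)"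
    using lborel_integral_shift(2)[of "indicator (cball (0::'a) \<rho>)" y] by (simp add: add.commute)
  show "(\<integral>h. indicator (cball (0::'a) \<rho>) (y + h) \<partial>lborel) = unit_ball_vol (real DIM('a)) * \<rho> ^ DIM('a)"
    using lborel_integral_shift(1)[of "indicator (cball (0::'a) \<rho>)" y] assms
    by (simp add: add.commute content_cball)
qed

lemma powr_half_le_wgt:
  fixes y :: "'a::euclidean_space" and q \<rho> :: real
  assumes "q = real DIM('a) + 2 * \<alpha>" "q > 0" "0 < \<rho>" "2 * \<rho> \<le> norm y"
  shows "(norm y / 2) powr (- q) \<le> (2 powr q + \<rho> powr (- q)) * wgt \<alpha> y"
proof -
  have y: "norm y > 0" using assms by linarith
  have "\<rho> powr q \<le> (norm y / 2) powr q" using assms by (intro powr_mono2) auto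
  then have "1 \<le> \<rho> powr (- q) * (norm y / 2) powr q"
    using assms(2-4) by (simp add: powr_minus field_simps del: minus_add_distrib)
  moreover have "norm y powr q = 2 powr q * (norm y / 2) powr q"
    using y by (simp add: powr_mult[symmetric])
  ultimately have "1 + norm y powr q \<le> (2 powr q + \<rho> powr (- q)) * (norm y / 2) powr q"
    by (simp add: distrib_right)
  moreover have "1 + norm y powr q > 0" "(norm y / 2) powr q > 0" using y by (auto simp: add_pos_nonneg)
  ultimately show ?thesis unfolding wgt_def assms(1)[symmetric] powr_minus
    by (simp add: field_simps)
qed

context fractional_order
begin

lemma frac_order_dim_pos: "0 < real DIM('a::euclidean_space) + 2 * \<alpha>"
  using alpha by (intro add_nonneg_pos) auto

lemma integrable_wgt: "integrable lborel (wgt \<alpha> :: 'a::euclidean_space \<Rightarrow> real)"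
proof (rule Bochner_Integration.integrable_bound)
  let ?q = "real DIM('a) + 2 * \<alpha>"
  show "integrable lborel (\<lambda>x::'a. indicator (cball 0 1) x + indicator (- ball 0 1) x * norm x powr (- ?q))"
    using alpha by (intro Bochner_Integration.integrable_add integrable_norm_powr_outside) (auto simp: emeasure_cball)
  show "AE x in lborel. norm (wgt \<alpha> x) \<le> norm (indicat_real (cball 0 1) x + indicator (- ball 0 1) x * norm (x::'a) powr (- ?q))"
  proof (rule AE_I2)
    fix x :: 'a
    show "norm (wgt \<alpha> x) \<le> norm (indicat_real (cball 0 1) x + indicator (- ball 0 1) x * norm (x::'a) powr (- ?q))"
    proof (cases "norm x \<le> 1")
      case True
      have "0 \<le> indicator (- ball 0 1) x * norm (x::'a) powr (- ?q)" by (auto simp: indicator_def)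
      moreover have "wgt \<alpha> x \<le> 1" "0 < wgt \<alpha> x" by (rule wgt_le_1 wgt_pos)+
      ultimately have "\<bar>wgt \<alpha> x\<bar> \<le> \<bar>1 + indicator (- ball 0 1) x * norm (x::'a) powr (- ?q)\<bar>" by linarith
      then show ?thesis using True by simp
    next
      case False
      have "1 / (1 + norm x powr ?q) \<le> 1 / norm x powr ?q"
        using False by (intro divide_left_mono mult_pos_pos add_pos_nonneg) auto
      then show ?thesis using False wgt_pos[of \<alpha> x] by (simp add: wgt_def powr_minus_divide del: minus_add_distrib)
    qed
  qed
qed simp

text \<open>Far from the support of \<open>f\<close> every increment that reaches the support has length comparable to the
  norm of \<open>y\<close>, and the support has finite volume.\<close>

lemma increment_integral_decay:
  fixes f :: "'a::euclidean_space \<Rightarrow> real"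
  assumes [measurable]: "f \<in> borel_measurable borel" and \<rho>: "0 < \<rho>"
    and B: "\<And>x. \<bar>f x\<bar> \<le> B" and z: "\<And>x. norm x \<ge> \<rho> \<Longrightarrow> f x = 0"
    and y: "2 * \<rho> \<le> norm y"
  shows "(\<integral>h. \<bar>f (y + h) - f y\<bar> * tkern \<alpha> \<epsilon> h \<partial>lborel) \<le>
       B * unit_ball_vol (real DIM('a)) * \<rho> ^ DIM('a) * (2 powr (real DIM('a) + 2 * \<alpha>) + \<rho> powr (- (real DIM('a) + 2 * \<alpha>))) * wgt \<alpha> y"
proof -
  let ?q = "real DIM('a) + 2 * \<alpha>"
  have B0: "0 \<le> B" using B[of 0] by linarith
  have le: "\<bar>f (y + h) - f y\<bar> * tkern \<alpha> \<epsilon> h \<le> B * (norm y / 2) powr (- ?q) * indicator (cball 0 \<rho>) (y + h)" for h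
  proof (cases "norm (y + h) < \<rho>")
    case True
    have "norm y / 2 \<le> norm h" using y True norm_triangle_ineq4[of "y + h" h] by simp
    then have "kern \<alpha> h \<le> (norm y / 2) powr (- ?q)"
      unfolding kern_def using y \<rho> frac_order_dim_pos[where 'a='a] by (intro powr_mono2') auto
    then have "tkern \<alpha> \<epsilon> h \<le> (norm y / 2) powr (- ?q)" using tkern_le_kern order_trans by blast
    then have "\<bar>f (y + h) - f y\<bar> * tkern \<alpha> \<epsilon> h \<le> B * (norm y / 2) powr (- ?q)"
      using B[of "y + h"] z[of y] y \<rho> B0 by (intro mult_mono) auto
    then show ?thesis using True by simp
  next
    case False
    then show ?thesis using z[of "y + h"] z[of y] y \<rho> B0 by simp
  qed
  have i: "integrable lborel (\<lambda>h. B * (norm y / 2) powr (- ?q) * indicator (cball 0 \<rho>) (y + h) :: real)"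
    using integral_indicator_cball_shift(1)[of \<rho> y] \<rho> by simp
  have j: "integrable lborel (\<lambda>h. \<bar>f (y + h) - f y\<bar> * tkern \<alpha> \<epsilon> h)"
    by (rule Bochner_Integration.integrable_bound[OF i]) (use le in \<open>auto simp: abs_mult B0 abs_of_nonneg\<close>)
  have "(\<integral>h. \<bar>f (y + h) - f y\<bar> * tkern \<alpha> \<epsilon> h \<partial>lborel) \<le> (\<integral>h. B * (norm y / 2) powr (- ?q) * indicator (cball 0 \<rho>) (y + h) \<partial>lborel)"
    by (rule integral_mono[OF j i le])
  also have "\<dots> = B * unit_ball_vol (real DIM('a)) * \<rho> ^ DIM('a) * (norm y / 2) powr (- ?q)"
    using integral_indicator_cball_shift(2)[of \<rho> y] \<rho> by simp
  also have "\<dots> \<le> B * unit_ball_vol (real DIM('a)) * \<rho> ^ DIM('a) * ((2 powr ?q + \<rho> powr (- ?q)) * wgt \<alpha> y)"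
    using powr_half_le_wgt[OF refl frac_order_dim_pos \<rho> y] B0 \<rho> by (intro mult_left_mono) auto
  finally show ?thesis by (simp add: mult.assoc)
qed

lemma levy_op_abs_le:
  "\<bar>levy_op \<alpha> \<epsilon> f x\<bar> \<le> (\<integral>h. \<bar>f (x + h) - f x\<bar> * tkern \<alpha> \<epsilon> h \<partial>lborel)"
  unfolding levy_op_def
  by (rule order_trans[OF integral_abs_bound]) (simp add: abs_mult)

lemma wgt_bounded_below:
  fixes y :: "'a::euclidean_space"
  assumes "norm y \<le> R"
  shows "1 \<le> (1 + R powr (real DIM('a) + 2 * \<alpha>)) * wgt \<alpha> y"
proof -
  have "norm y powr (real DIM('a) + 2 * \<alpha>) \<le> R powr (real DIM('a) + 2 * \<alpha>)"
    using assms frac_order_dim_pos[where 'a='a] by (intro powr_mono2) auto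
  then show ?thesis unfolding wgt_def by (simp add: divide_simps add_pos_nonneg)
qed

text \<open>Uniformity in the truncation gives at once the decay of the fractional Laplacian of a test
  function and the integrable majorant of its truncations.\<close>

lemma levy_op_decay:
  fixes f :: "'a::euclidean_space \<Rightarrow> real"
  assumes "c11_supported f"
  shows "\<exists>C>0. \<forall>\<epsilon>>0. \<forall>x. \<bar>levy_op \<alpha> \<epsilon> f x\<bar> \<le> C * wgt \<alpha> x"
proof -
  obtain \<rho> B D where *: "\<rho> > 0" "B > 0" "D > 0" "\<And>x. norm x \<ge> \<rho> \<Longrightarrow> f x = 0" "\<And>x. \<bar>f x\<bar> \<le> B"
    "\<And>x h. \<bar>sdiff f x h\<bar> \<le> D * min 1 ((norm h)\<^sup>2)" "f \<in> borel_measurable borel"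
    using c11_supportedD[OF assms] by metis
  let ?q = "real DIM('a) + 2 * \<alpha>"
  define C1 where "C1 = B * unit_ball_vol (real DIM('a)) * \<rho> ^ DIM('a) * (2 powr ?q + \<rho> powr (- ?q))"
  define C2 where "C2 = (D * levy_mass TYPE('a)) * (1 + (2 * \<rho>) powr ?q)"
  have C: "C1 \<ge> 0" "C2 \<ge> 0" using * levy_mass_nonneg[where 'a='a] by (auto simp: C1_def C2_def)
  have "\<bar>levy_op \<alpha> \<epsilon> f x\<bar> \<le> (C1 + C2 + 1) * wgt \<alpha> x" if e: "\<epsilon> > 0" for \<epsilon> x
  proof -
    have w: "0 < wgt \<alpha> x" by (rule wgt_pos)
    have "\<bar>levy_op \<alpha> \<epsilon> f x\<bar> \<le> C1 * wgt \<alpha> x \<or> \<bar>levy_op \<alpha> \<epsilon> f x\<bar> \<le> C2 * wgt \<alpha> x"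
    proof (cases "2 * \<rho> \<le> norm x")
      case True
      from increment_integral_decay[OF *(7,1,5,4) True, of \<epsilon>] levy_op_abs_le[of \<epsilon> f x]
      show ?thesis unfolding C1_def by linarith
    next
      case False
      have "\<bar>levy_op \<alpha> \<epsilon> f x\<bar> \<le> D * levy_mass TYPE('a)"
        using levy_op_bound(2)[OF *(7,5), of 1 x D \<epsilon>] *(6) e by simp
      also have "\<dots> \<le> (D * levy_mass TYPE('a)) * ((1 + (2 * \<rho>) powr ?q) * wgt \<alpha> x)"
        using mult_left_mono[OF wgt_bounded_below[of x "2 * \<rho>"], of "D * levy_mass TYPE('a)"] False *(3) levy_mass_nonneg[where 'a='a] by simp
      finally show ?thesis by (simp add: C2_def mult_ac)
    qed
    moreover have "C1 * wgt \<alpha> x \<le> (C1 + C2 + 1) * wgt \<alpha> x" "C2 * wgt \<alpha> x \<le> (C1 + C2 + 1) * wgt \<alpha> x"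
      using C w by (auto intro!: mult_right_mono)
    ultimately show ?thesis by linarith
  qed
  then show ?thesis using C by (intro exI[of _ "C1 + C2 + 1"]) auto
qed

definition levy_lim :: "('a::euclidean_space \<Rightarrow> real) \<Rightarrow> 'a \<Rightarrow> real" where
  "levy_lim f x = (\<integral>h. sdiff f x h * kern \<alpha> h \<partial>lborel) / 2"

lemma levy_op_tendsto_levy_lim:
  assumes "c11_supported f"
  shows "((\<lambda>\<epsilon>. levy_op \<alpha> \<epsilon> f x) \<longlongrightarrow> levy_lim f x) (at_right 0)"
proof -
  obtain \<rho> B D where *: "\<rho> > 0" "B > 0" "D > 0" "\<And>x. norm x \<ge> \<rho> \<Longrightarrow> f x = 0" "\<And>x. \<bar>f x\<bar> \<le> B"
    "\<And>x h. \<bar>sdiff f x h\<bar> \<le> D * min 1 ((norm h)\<^sup>2)" "f \<in> borel_measurable borel"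
    using c11_supportedD[OF assms] by metis
  show ?thesis unfolding levy_lim_def
    by (rule levy_op_tendsto[OF integrable_bounded_tkern[OF *(7,5)] levy_op_bound(1)[OF *(7,5), of 1 x D]]) (use *(6) in auto)
qed

lemma levy_lim_decay:
  fixes f :: "'a::euclidean_space \<Rightarrow> real"
  assumes "\<And>\<epsilon> x. \<epsilon> > 0 \<Longrightarrow> \<bar>levy_op \<alpha> \<epsilon> f x\<bar> \<le> C * wgt \<alpha> x" "c11_supported f"
  shows "\<bar>levy_lim f x\<bar> \<le> C * wgt \<alpha> x"
proof (rule tendsto_upperbound[OF tendsto_rabs[OF levy_op_tendsto_levy_lim[OF assms(2)]]])
  show "\<forall>\<^sub>F \<epsilon> in at_right 0. \<bar>levy_op \<alpha> \<epsilon> f x\<bar> \<le> C * wgt \<alpha> x"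
    using eventually_at_right_less[of "0::real"] by eventually_elim (simp add: assms)
qed simp

lemma frac_lap_eq_levy_lim:
  fixes f :: "'a::euclidean_space \<Rightarrow> real"
  assumes f: "c11_supported f"
  shows "frac_lap_exists \<alpha> f x" "frac_lap \<alpha> f x = - levy_lim f x"
proof -
  have m: "f \<in> borel_measurable borel" using c11_supportedD[OF f] by metis
  have t: "((\<lambda>\<epsilon>. frac_lap_eps \<alpha> \<epsilon> f x) \<longlongrightarrow> - levy_lim f x) (at_right 0)"
    unfolding frac_lap_eps_eq_levy_op[OF m] by (intro tendsto_minus levy_op_tendsto_levy_lim f)
  then show "frac_lap_exists \<alpha> f x" unfolding frac_lap_exists_def by blast
  show "frac_lap \<alpha> f x = - levy_lim f x"
    unfolding frac_lap_def by (rule tendsto_Lim[OF _ t]) simp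
qed

lemma c11_supported_in_test_space:
  fixes f :: "'a::euclidean_space \<Rightarrow> real"
  assumes f: "c11_supported f"
  shows "f \<in> test_space \<alpha>"
proof -
  obtain \<rho> B D where *: "\<rho> > 0" "\<And>x. norm x \<ge> \<rho> \<Longrightarrow> f x = 0" "f \<in> borel_measurable borel"
    using c11_supportedD[OF f] by metis
  obtain C where C: "C > 0" "\<And>\<epsilon> x. \<epsilon> > 0 \<Longrightarrow> \<bar>levy_op \<alpha> \<epsilon> f x\<bar> \<le> C * wgt \<alpha> x"
    using levy_op_decay[OF f] by metis
  have "bounded {x. f x \<noteq> 0}"
    by (rule bounded_subset[of "cball 0 \<rho>"]) (use *(2) in \<open>auto simp: not_le intro: ccontr\<close>)
  then have "compact (closure {x. f x \<noteq> 0})" by (simp add: compact_closure)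
  moreover have "\<exists>C>0. \<forall>x. \<bar>frac_lap \<alpha> f x\<bar> \<le> C / (1 + norm x powr (real DIM('a) + 2 * \<alpha>))"
    using C levy_lim_decay[OF C(2) f] frac_lap_eq_levy_lim(2)[OF f] by (auto simp: wgt_def intro!: exI[of _ C])
  moreover have "\<exists>\<phi> \<epsilon>0. integrable lebesgue \<phi> \<and> \<epsilon>0 > 0 \<and>
        (\<forall>\<epsilon>\<in>{0<..\<epsilon>0}. AE x in lebesgue. \<bar>frac_lap_eps \<alpha> \<epsilon> f x\<bar> \<le> \<phi> x)"
  proof (intro exI[of _ "\<lambda>x. C * wgt \<alpha> x"] exI[of _ "1::real"] conjI ballI)
    have "integrable lborel (\<lambda>x::'a. C * wgt \<alpha> x)" by (simp add: integrable_wgt)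
    then show "integrable lebesgue (\<lambda>x::'a. C * wgt \<alpha> x)" by (subst integrable_completion) auto
  qed (use C *(3) in \<open>auto simp: frac_lap_eps_eq_levy_op\<close>)
  ultimately show ?thesis
    using f frac_lap_eq_levy_lim(1)[OF f] unfolding test_space_def c11_supported_def by blast
qed

section \<open>Duality and mollification\<close>

lemma integrable_weighted_mult:
  fixes f g :: "'a::euclidean_space \<Rightarrow> real"
  assumes w: "integrable lborel (\<lambda>x. f x * wgt \<alpha> x)" and [measurable]: "f \<in> borel_measurable borel" "g \<in> borel_measurable borel"
    and b: "\<And>x. \<bar>g x\<bar> \<le> C * wgt \<alpha> x"
  shows "integrable lborel (\<lambda>x. f x * g x)"
proof (rule Bochner_Integration.integrable_bound)
  show "integrable lborel (\<lambda>x. C * (f x * wgt \<alpha> x))" using w by simp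
  show "AE x in lborel. norm (f x * g x) \<le> norm (C * (f x * wgt \<alpha> x))"
  proof (rule AE_I2)
    fix x
    have "\<bar>f x\<bar> * \<bar>g x\<bar> \<le> \<bar>f x\<bar> * (C * wgt \<alpha> x)" using b by (intro mult_left_mono) auto
    also have "\<dots> \<le> \<bar>C * (f x * wgt \<alpha> x)\<bar>" using abs_ge_self[of C] wgt_pos[of \<alpha> x] by (simp add: abs_mult mult_ac mult_left_mono mult_right_mono)
    finally show "norm (f x * g x) \<le> norm (C * (f x * wgt \<alpha> x))" by (simp add: abs_mult)
  qed
qed simp

lemma bounded_support_le_wgt:
  fixes g :: "'a::euclidean_space \<Rightarrow> real"
  assumes "\<And>x. \<bar>g x\<bar> \<le> B" "\<And>x. norm x \<ge> \<rho> \<Longrightarrow> g x = 0"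
  shows "\<bar>g x\<bar> \<le> B * (1 + \<rho> powr (real DIM('a) + 2 * \<alpha>)) * wgt \<alpha> x"
proof -
  have B: "0 \<le> B" using assms(1)[of 0] by linarith
  show ?thesis
  proof (cases "norm x \<ge> \<rho>")
    case True
    then show ?thesis using B assms(2)[OF True] wgt_pos[of \<alpha> x] by (auto intro!: mult_nonneg_nonneg add_nonneg_nonneg)
  next
    case False
    have "\<bar>g x\<bar> \<le> B * 1" using assms by simp
    also have "\<dots> \<le> B * ((1 + \<rho> powr (real DIM('a) + 2 * \<alpha>)) * wgt \<alpha> x)"
      using False by (intro mult_left_mono wgt_bounded_below B) auto
    finally show ?thesis by (simp add: mult.assoc)
  qed
qed

text \<open>Fubini in increment variables. The right-hand side sees \<open>\<phi>\<close> only through its translates paired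
  with \<open>f\<close>, which for a mollifier are the values of the mollification of \<open>f\<close>.\<close>

lemma integral_levy_op_swap:
  fixes f \<phi> :: "'a::euclidean_space \<Rightarrow> real"
  assumes w: "integrable lborel (\<lambda>x. f x * wgt \<alpha> x)" and [measurable]: "f \<in> borel_measurable borel"
    and \<phi>: "c11_supported \<phi>" and e: "\<epsilon> > 0"
  shows "(\<integral>y. f y * levy_op \<alpha> \<epsilon> \<phi> y \<partial>lborel) =
    (\<integral>h. ((\<integral>y. f y * \<phi> (y + h) \<partial>lborel) - (\<integral>y. f y * \<phi> y \<partial>lborel)) * tkern \<alpha> \<epsilon> h \<partial>lborel)"
proof -
  obtain \<rho> B D where *: "\<rho> > 0" "B > 0" "D > 0" "\<And>x. norm x \<ge> \<rho> \<Longrightarrow> \<phi> x = 0" "\<And>x. \<bar>\<phi> x\<bar> \<le> B"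
    "\<And>x h. \<bar>sdiff \<phi> x h\<bar> \<le> D * min 1 ((norm h)\<^sup>2)" and m[measurable]: "\<phi> \<in> borel_measurable borel"
    using c11_supportedD[OF \<phi>] by metis
  let ?q = "real DIM('a) + 2 * \<alpha>"
  let ?J = "\<lambda>y. \<integral>h. \<bar>\<phi> (y + h) - \<phi> y\<bar> * tkern \<alpha> \<epsilon> h \<partial>lborel"
  have i: "integrable lborel (\<lambda>h. (\<phi> (y + h) - \<phi> y) * tkern \<alpha> \<epsilon> h)" for y
    by (rule integrable_bounded_increment[OF m *(5) e])
  have ia: "integrable lborel (\<lambda>h. \<bar>\<phi> (y + h) - \<phi> y\<bar> * tkern \<alpha> \<epsilon> h)" for y
    using integrable_abs[OF i[of y]] by (simp add: abs_mult)
  have Jnn: "0 \<le> ?J y" for y by (intro integral_nonneg_AE) auto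
  define T where "T = (\<integral>h. tkern \<alpha> \<epsilon> (h::'a) \<partial>lborel)"
  have T: "0 \<le> T" unfolding T_def by (intro integral_nonneg_AE) auto
  define C1 where "C1 = B * unit_ball_vol (real DIM('a)) * \<rho> ^ DIM('a) * (2 powr ?q + \<rho> powr (- ?q))"
  define C2 where "C2 = (2 * B * T) * (1 + (2 * \<rho>) powr ?q)"
  have Jb: "?J y \<le> max C1 C2 * wgt \<alpha> y" for y
  proof -
    have w: "0 < wgt \<alpha> y" by (rule wgt_pos)
    have "?J y \<le> C1 * wgt \<alpha> y \<or> ?J y \<le> C2 * wgt \<alpha> y"
    proof (cases "2 * \<rho> \<le> norm y")
      case True
      from increment_integral_decay[OF m *(1,5,4) True, of \<epsilon>]
      show ?thesis unfolding C1_def by simp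
    next
      case False
      have "?J y \<le> (\<integral>h. 2 * B * tkern \<alpha> \<epsilon> (h::'a) \<partial>lborel)"
      proof (rule integral_mono[OF ia])
        show "\<bar>\<phi> (y + h) - \<phi> y\<bar> * tkern \<alpha> \<epsilon> h \<le> 2 * B * tkern \<alpha> \<epsilon> h" for h
          using *(5)[of "y + h"] *(5)[of y] by (intro mult_right_mono) auto
      qed (simp add: integrable_tkern e)
      also have "\<dots> = 2 * B * T" by (simp add: T_def)
      also have "\<dots> \<le> (2 * B * T) * ((1 + (2 * \<rho>) powr ?q) * wgt \<alpha> y)"
        using mult_left_mono[OF wgt_bounded_below[of y "2 * \<rho>"], of "2 * B * T"] False *(2) T by simp
      finally show ?thesis by (simp add: C2_def mult_ac)
    qed
    moreover have "C1 * wgt \<alpha> y \<le> max C1 C2 * wgt \<alpha> y" "C2 * wgt \<alpha> y \<le> max C1 C2 * wgt \<alpha> y"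
      using w by (auto intro!: mult_right_mono)
    ultimately show ?thesis by linarith
  qed
  have int: "integrable (lborel \<Otimes>\<^sub>M lborel) (\<lambda>(y, h). f y * ((\<phi> (y + h) - \<phi> y) * tkern \<alpha> \<epsilon> h))"
  proof (rule lborel_pair.Fubini_integrable)
    show "(\<lambda>(y, h). f y * ((\<phi> (y + h) - \<phi> y) * tkern \<alpha> \<epsilon> h)) \<in> borel_measurable (lborel \<Otimes>\<^sub>M lborel)"
      by measurable
    have "integrable lborel (\<lambda>y. \<bar>f y\<bar> * wgt \<alpha> y)"
      using integrable_abs[OF w] by (simp add: abs_mult abs_of_pos[OF wgt_pos])
    then have "integrable lborel (\<lambda>y. \<bar>f y\<bar> * ?J y)"
      by (rule integrable_weighted_mult[where C="max C1 C2"]) (use Jb Jnn in auto)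
    then show "integrable lborel (\<lambda>x. \<integral>y. norm (case (x, y) of (y, h) \<Rightarrow> f y * ((\<phi> (y + h) - \<phi> y) * tkern \<alpha> \<epsilon> h)) \<partial>lborel)"
      by (simp add: abs_mult)
    show "AE x in lborel. integrable lborel (\<lambda>y. case (x, y) of (y, h) \<Rightarrow> f y * ((\<phi> (y + h) - \<phi> y) * tkern \<alpha> \<epsilon> h))"
      by (simp add: i)
  qed
  have loc: "integrable lborel (\<lambda>y. f y * \<phi> (y + h))" for h
  proof (rule integrable_weighted_mult[OF w])
    show "\<bar>\<phi> (y + h)\<bar> \<le> (B * (1 + (\<rho> + norm h) powr ?q)) * wgt \<alpha> y" for y
    proof (rule bounded_support_le_wgt[of "\<lambda>y. \<phi> (y + h)"])
      show "\<bar>\<phi> (x + h)\<bar> \<le> B" for x by (rule *(5))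
      show "\<phi> (x + h) = 0" if "\<rho> + norm h \<le> norm x" for x
        using that norm_diff_ineq[of x h] by (intro *(4)) linarith
    qed
  qed auto
  have "(\<integral>y. f y * levy_op \<alpha> \<epsilon> \<phi> y \<partial>lborel) = (\<integral>y. (\<integral>h. f y * ((\<phi> (y + h) - \<phi> y) * tkern \<alpha> \<epsilon> h) \<partial>lborel) \<partial>lborel)"
    unfolding levy_op_def by simp
  also have "\<dots> = (\<integral>h. (\<integral>y. f y * ((\<phi> (y + h) - \<phi> y) * tkern \<alpha> \<epsilon> h) \<partial>lborel) \<partial>lborel)"
    by (rule lborel_pair.Fubini_integral[symmetric, OF int])
  also have "\<dots> = (\<integral>h. ((\<integral>y. f y * \<phi> (y + h) \<partial>lborel) - (\<integral>y. f y * \<phi> y \<partial>lborel)) * tkern \<alpha> \<epsilon> h \<partial>lborel)"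
  proof (rule Bochner_Integration.integral_cong)
    fix h :: 'a
    have "(\<integral>y. f y * ((\<phi> (y + h) - \<phi> y) * tkern \<alpha> \<epsilon> h) \<partial>lborel) = (\<integral>y. (f y * \<phi> (y + h) - f y * \<phi> y) * tkern \<alpha> \<epsilon> h \<partial>lborel)"
      by (simp add: algebra_simps)
    also have "\<dots> = (\<integral>y. f y * \<phi> (y + h) - f y * \<phi> y \<partial>lborel) * tkern \<alpha> \<epsilon> h" by simp
    also have "(\<integral>y. f y * \<phi> (y + h) - f y * \<phi> y \<partial>lborel) = (\<integral>y. f y * \<phi> (y + h) \<partial>lborel) - (\<integral>y. f y * \<phi> y \<partial>lborel)"
      using loc[of h] loc[of 0] by (intro Bochner_Integration.integral_diff) auto
    finally show "(\<integral>y. f y * ((\<phi> (y + h) - \<phi> y) * tkern \<alpha> \<epsilon> h) \<partial>lborel) =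
      ((\<integral>y. f y * \<phi> (y + h) \<partial>lborel) - (\<integral>y. f y * \<phi> y \<partial>lborel)) * tkern \<alpha> \<epsilon> h" .
  qed simp
  finally show ?thesis .
qed

end

definition moll :: "real \<Rightarrow> 'a::euclidean_space \<Rightarrow> real" where
  "moll \<epsilon> x = bump (x /\<^sub>R \<epsilon>) / (\<epsilon> ^ DIM('a) * (\<integral>z. bump (z::'a) \<partial>lborel))"

definition mollify :: "real \<Rightarrow> ('a::euclidean_space \<Rightarrow> real) \<Rightarrow> 'a \<Rightarrow> real" where
  "mollify \<epsilon> f x = (\<integral>y. f y * moll \<epsilon> (y - x) \<partial>lborel)"

lemma integrable_bump: "integrable lborel (bump :: 'a::euclidean_space \<Rightarrow> real)"
proof (rule Bochner_Integration.integrable_bound)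
  show "integrable lborel (indicator (cball 0 1) :: 'a \<Rightarrow> real)" by (simp add: emeasure_cball)
  show "AE x in lborel. norm (bump x) \<le> norm (indicator (cball 0 1) (x::'a) :: real)"
    by (auto simp: indicator_def bump_eq_0)
qed simp

lemma integral_bump_pos: "0 < (\<integral>z. bump (z::'a::euclidean_space) \<partial>lborel)"
proof -
  have "0 < (9/16) * (unit_ball_vol (real DIM('a)) * (1/2) ^ DIM('a))" by simp
  also have "\<dots> = (\<integral>z. (9/16) * indicator (cball 0 (1/2)) (z::'a) \<partial>lborel)"
    by (simp add: content_cball)
  also have "\<dots> \<le> (\<integral>z. bump (z::'a) \<partial>lborel)"
  proof (rule integral_mono[OF _ integrable_bump])
    fix z :: 'a
    show "(9/16) * indicator (cball 0 (1/2)) z \<le> bump z"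
    proof (cases "norm z \<le> 1/2")
      case True
      have "(norm z)\<^sup>2 \<le> (1/2)\<^sup>2" using True by (intro power_mono) auto
      then have "(3/4)\<^sup>2 \<le> (max 0 (1 - (norm z)\<^sup>2))\<^sup>2" by (intro power_mono) (auto simp: power2_eq_square)
      then show ?thesis using True by (simp add: bump_def power2_eq_square)
    qed simp
  qed (simp add: emeasure_cball)
  finally show ?thesis .
qed

lemma moll_measurable [measurable]: "(moll \<epsilon> :: 'a::euclidean_space \<Rightarrow> real) \<in> borel_measurable borel"
  unfolding moll_def by measurable

lemma moll_nonneg [simp]: "\<epsilon> > 0 \<Longrightarrow> 0 \<le> moll \<epsilon> x"
  unfolding moll_def by (intro divide_nonneg_nonneg mult_nonneg_nonneg) (auto intro: less_imp_le[OF integral_bump_pos])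

lemma moll_eq_0: "\<epsilon> > 0 \<Longrightarrow> \<epsilon> \<le> norm x \<Longrightarrow> moll \<epsilon> x = 0"
  unfolding moll_def by (subst bump_eq_0) (auto simp: divide_simps)

lemma moll_minus: "moll \<epsilon> (- x) = moll \<epsilon> x"
  unfolding moll_def by (simp add: scaleR_minus_right)

lemma continuous_moll: "continuous_on UNIV (moll \<epsilon>)"
  unfolding moll_def bump_def divide_inverse by (intro continuous_intros)

lemma c11_supported_moll:
  assumes "\<epsilon> > 0"
  shows "c11_supported (\<lambda>y. moll \<epsilon> (y - x))"
  using c11_supported_cmult[OF c11_supported_bump[OF assms, of x], of "inverse (\<epsilon> ^ DIM('a) * (\<integral>z. bump (z::'a::euclidean_space) \<partial>lborel))"]
  by (simp add: moll_def divide_inverse mult.commute)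

lemma integral_moll:
  fixes x :: "'a::euclidean_space"
  assumes e: "\<epsilon> > 0"
  shows "integrable lborel (\<lambda>y. moll \<epsilon> (y - x))" "(\<integral>y. moll \<epsilon> (y - x) \<partial>lborel) = 1"
proof -
  have "integrable lborel (\<lambda>y::'a. bump (inverse \<epsilon> *\<^sub>R y))"
    using e by (subst lborel_integral_scale(2)) (auto simp: integrable_bump)
  then have i: "integrable lborel (moll \<epsilon> :: 'a \<Rightarrow> real)" by (simp add: moll_def[abs_def])
  then show "integrable lborel (\<lambda>y. moll \<epsilon> (y - x))" using lborel_integral_shift(2)[of "moll \<epsilon>" "- x"] by simp
  have "(\<integral>y. moll \<epsilon> (y - x) \<partial>lborel) = (\<integral>y. moll \<epsilon> (y::'a) \<partial>lborel)"
    using lborel_integral_shift(1)[of "moll \<epsilon>" "- x"] by simp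
  also have "\<dots> = (\<integral>y. bump (inverse \<epsilon> *\<^sub>R (y::'a)) \<partial>lborel) / (\<epsilon> ^ DIM('a) * (\<integral>z. bump (z::'a) \<partial>lborel))"
    by (simp add: moll_def)
  also have "\<dots> = 1"
  proof -
    have "(\<integral>y. bump (inverse \<epsilon> *\<^sub>R (y::'a)) \<partial>lborel) = \<epsilon> ^ DIM('a) * (\<integral>z. bump (z::'a) \<partial>lborel)"
      using e lborel_integral_scale(1)[of "inverse \<epsilon>" "bump :: 'a \<Rightarrow> real"]
      by (simp add: power_inverse divide_inverse mult.commute)
    then show ?thesis using e integral_bump_pos[where 'a='a] by simp
  qed
  finally show "(\<integral>y. moll \<epsilon> (y - x) \<partial>lborel) = 1" .
qed

lemma mollify_between:
  fixes f :: "'a::euclidean_space \<Rightarrow> real"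
  assumes i: "integrable lborel (\<lambda>y. f y * moll \<epsilon> (y - x))" and e: "\<epsilon> > 0"
  shows "(\<And>y. norm (y - x) < \<epsilon> \<Longrightarrow> f y \<le> b) \<Longrightarrow> mollify \<epsilon> f x \<le> b"
    and "(\<And>y. norm (y - x) < \<epsilon> \<Longrightarrow> b \<le> f y) \<Longrightarrow> b \<le> mollify \<epsilon> f x"
proof -
  have j: "integrable lborel (\<lambda>y. b * moll \<epsilon> (y - x))" "(\<integral>y. b * moll \<epsilon> (y - x) \<partial>lborel) = b"
    using integral_moll[OF e, of x] by auto
  { assume b: "\<And>y. norm (y - x) < \<epsilon> \<Longrightarrow> f y \<le> b"
    have "f y * moll \<epsilon> (y - x) \<le> b * moll \<epsilon> (y - x)" for y
      using b[of y] e moll_eq_0[OF e, of "y - x"] by (cases "norm (y - x) < \<epsilon>") (auto intro!: mult_right_mono)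
    from integral_mono[OF i j(1) this] j(2) show "mollify \<epsilon> f x \<le> b"
      unfolding mollify_def by linarith }
  { assume b: "\<And>y. norm (y - x) < \<epsilon> \<Longrightarrow> b \<le> f y"
    have "b * moll \<epsilon> (y - x) \<le> f y * moll \<epsilon> (y - x)" for y
      using b[of y] e moll_eq_0[OF e, of "y - x"] by (cases "norm (y - x) < \<epsilon>") (auto intro!: mult_right_mono)
    from integral_mono[OF j(1) i this] j(2) show "b \<le> mollify \<epsilon> f x"
      unfolding mollify_def by linarith }
qed

context fractional_order
begin

text \<open>The functions for which pairing with the operator applied to a test function makes sense: the
  weight is the common majorant of such operators.\<close>

definition weighted :: "('a::euclidean_space \<Rightarrow> real) \<Rightarrow> bool" where
  "weighted f \<longleftrightarrow> f \<in> borel_measurable borel \<and> integrable lborel (\<lambda>x. f x * wgt \<alpha> x)"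

lemma weighted_measurable [measurable_dest]: "weighted f \<Longrightarrow> f \<in> borel_measurable borel"
  by (simp add: weighted_def)

lemma weighted_integrable_supported:
  fixes f g :: "'a::euclidean_space \<Rightarrow> real"
  assumes f: "weighted f" and g: "g \<in> borel_measurable borel" "\<And>x. \<bar>g x\<bar> \<le> B" "\<And>x. norm x > \<rho> \<Longrightarrow> g x = 0"
  shows "integrable lborel (\<lambda>x. f x * g x)"
proof (rule integrable_weighted_mult)
  show "\<bar>g x\<bar> \<le> B * (1 + (\<rho> + 1) powr (real DIM('a) + 2 * \<alpha>)) * wgt \<alpha> x" for x
    using g(2) by (rule bounded_support_le_wgt) (use g(3) in auto)
qed (use f g in \<open>auto simp: weighted_def\<close>)

lemma weighted_integrable_moll:
  fixes f :: "'a::euclidean_space \<Rightarrow> real"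
  assumes f: "weighted f" and e: "\<epsilon> > 0"
  shows "integrable lborel (\<lambda>y. f y * moll \<epsilon> (y - x))"
proof -
  obtain \<rho> B D where *: "\<And>y. norm y \<ge> \<rho> \<Longrightarrow> moll \<epsilon> (y - x) = 0" "\<And>y. \<bar>moll \<epsilon> (y - x)\<bar> \<le> B"
    using c11_supportedD[OF c11_supported_moll[OF e, of x]] by metis
  show ?thesis by (rule weighted_integrable_supported[OF f _ *(2), where \<rho>=\<rho>]) (use *(1) in auto)
qed

lemma levy_op_pairing_tendsto:
  fixes f \<phi> :: "'a::euclidean_space \<Rightarrow> real"
  assumes f: "weighted f" and \<phi>: "c11_supported \<phi>"
  shows "((\<lambda>t. \<integral>y. f y * levy_op \<alpha> t \<phi> y \<partial>lborel) \<longlongrightarrow> (\<integral>y. f y * levy_lim \<phi> y \<partial>lborel)) (at_right 0)"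
    and "integrable lborel (\<lambda>y. f y * levy_lim \<phi> y)"
proof -
  have [measurable]: "\<phi> \<in> borel_measurable borel" using c11_supportedD[OF \<phi>] by metis
  have [measurable]: "f \<in> borel_measurable borel" using f by (rule weighted_measurable)
  obtain C where C: "C > 0" "\<And>\<epsilon> x. \<epsilon> > 0 \<Longrightarrow> \<bar>levy_op \<alpha> \<epsilon> \<phi> x\<bar> \<le> C * wgt \<alpha> x"
    using levy_op_decay[OF \<phi>] by metis
  have "integrable lborel (\<lambda>y. \<bar>f y * wgt \<alpha> y\<bar>)" using f by (auto simp: weighted_def)
  then have iw: "integrable lborel (\<lambda>y. C * \<bar>f y * wgt \<alpha> y\<bar>)" by (rule integrable_mult_right)
  have m1: "(\<lambda>y. f y * levy_op \<alpha> t \<phi> y) \<in> borel_measurable lborel" for t unfolding levy_op_def by measurable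
  have m2: "(\<lambda>y. f y * levy_lim \<phi> y) \<in> borel_measurable lborel" unfolding levy_lim_def sdiff_def by measurable
  note D = integral_dominated_convergence_at_right_0[OF m2 m1 iw]
  have l: "((\<lambda>t. f y * levy_op \<alpha> t \<phi> y) \<longlongrightarrow> f y * levy_lim \<phi> y) (at_right 0)" for y
    by (intro tendsto_intros levy_op_tendsto_levy_lim \<phi>)
  have b: "\<bar>f y * levy_op \<alpha> t \<phi> y\<bar> \<le> C * \<bar>f y * wgt \<alpha> y\<bar>" if t: "t > 0" for t y
  proof -
    have "\<bar>f y\<bar> * \<bar>levy_op \<alpha> t \<phi> y\<bar> \<le> \<bar>f y\<bar> * (C * wgt \<alpha> y)" by (rule mult_left_mono[OF C(2)[OF t]]) simp
    then show ?thesis by (simp add: abs_mult abs_of_pos[OF wgt_pos] mult.left_commute)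
  qed
  show "((\<lambda>t. \<integral>y. f y * levy_op \<alpha> t \<phi> y \<partial>lborel) \<longlongrightarrow> (\<integral>y. f y * levy_lim \<phi> y \<partial>lborel)) (at_right 0)"
    by (rule D(1)[OF l b])
  show "integrable lborel (\<lambda>y. f y * levy_lim \<phi> y)" by (rule D(2)[OF l b])
qed

lemma levy_op_mollify:
  fixes f :: "'a::euclidean_space \<Rightarrow> real"
  assumes f: "weighted f" and e: "\<epsilon> > 0" and e': "\<epsilon>' > 0"
  shows "(\<integral>y. f y * levy_op \<alpha> \<epsilon>' (\<lambda>y. moll \<epsilon> (y - x)) y \<partial>lborel) = levy_op \<alpha> \<epsilon>' (mollify \<epsilon> f) x"
proof -
  have "(\<integral>y. f y * levy_op \<alpha> \<epsilon>' (\<lambda>y. moll \<epsilon> (y - x)) y \<partial>lborel) =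
    (\<integral>h. ((\<integral>y. f y * moll \<epsilon> (y + h - x) \<partial>lborel) - (\<integral>y. f y * moll \<epsilon> (y - x) \<partial>lborel)) * tkern \<alpha> \<epsilon>' h \<partial>lborel)"
    using f by (intro integral_levy_op_swap c11_supported_moll e e') (auto simp: weighted_def)
  also have "\<dots> = (\<integral>h. (mollify \<epsilon> f (x + (- h)) - mollify \<epsilon> f x) * tkern \<alpha> \<epsilon>' (- h) \<partial>lborel)"
    by (simp add: mollify_def algebra_simps)
  also have "\<dots> = levy_op \<alpha> \<epsilon>' (mollify \<epsilon> f) x"
    unfolding levy_op_def by (rule lborel_integral_minus(1))
  finally show ?thesis .
qed

lemma continuous_mollify:
  fixes f :: "'a::euclidean_space \<Rightarrow> real"
  assumes f: "weighted f" and e: "\<epsilon> > 0"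
  shows "continuous_on UNIV (mollify \<epsilon> f)"
proof (subst continuous_on_sequentially, intro ballI allI impI)
  fix xs and x :: 'a assume "(\<forall>n. xs n \<in> UNIV) \<and> xs \<longlonglongrightarrow> x"
  then have xs: "xs \<longlonglongrightarrow> x" by simp
  have [measurable]: "f \<in> borel_measurable borel" using f by (rule weighted_measurable)
  obtain R where R: "\<And>n. norm (xs n) \<le> R"
    using convergent_imp_bounded[OF xs] by (auto simp: bounded_iff)
  obtain B where B: "\<And>z::'a. \<bar>moll \<epsilon> z\<bar> \<le> B"
    using c11_supportedD[OF c11_supported_moll[OF e, of 0]] by (metis diff_zero)
  have B0: "0 \<le> B" using B[of 0] by linarith
  let ?g = "\<lambda>y::'a. B * indicator (cball 0 (R + \<epsilon>)) y"
  have "integrable lborel (\<lambda>y. f y * ?g y)"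
    by (rule weighted_integrable_supported[OF f, where B=B and \<rho>="R + \<epsilon>"]) (use B0 in \<open>auto simp: indicator_def\<close>)
  then have i: "integrable lborel (\<lambda>y. \<bar>f y * ?g y\<bar>)" by (rule integrable_abs)
  show "((mollify \<epsilon> f) \<circ> xs) \<longlonglongrightarrow> mollify \<epsilon> f x"
    unfolding mollify_def comp_def
  proof (rule integral_dominated_convergence[OF _ _ i])
    show "AE y in lborel. (\<lambda>n. f y * moll \<epsilon> (y - xs n)) \<longlonglongrightarrow> f y * moll \<epsilon> (y - x)"
      by (intro AE_I2 tendsto_mult tendsto_const continuous_on_tendsto_compose[OF continuous_moll] tendsto_diff xs) auto
    show "AE y in lborel. norm (f y * moll \<epsilon> (y - xs n)) \<le> \<bar>f y * ?g y\<bar>" for n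
    proof (rule AE_I2)
      fix y
      show "norm (f y * moll \<epsilon> (y - xs n)) \<le> \<bar>f y * ?g y\<bar>"
      proof (cases "norm y \<le> R + \<epsilon>")
        case True
        then show ?thesis using B[of "y - xs n"] B0 by (auto simp: abs_mult intro!: mult_left_mono)
      next
        case False
        then have "\<epsilon> \<le> norm (y - xs n)" using R[of n] norm_triangle_ineq2[of y "xs n"] by linarith
        then have "moll \<epsilon> (y - xs n) = 0" by (rule moll_eq_0[OF e])
        then show ?thesis by simp
      qed
    qed
  qed auto
qed

text \<open>Extremal points move with the mollification parameter, so convergence is needed along moving
  points.\<close>

lemma mollify_tendsto:
  fixes f :: "'a::euclidean_space \<Rightarrow> real"
  assumes f: "weighted f" and c: "continuous_on (- {0}) f" and x: "x \<noteq> 0"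
    and e: "\<And>n. e n > 0" "e \<longlonglongrightarrow> 0" and xs: "xs \<longlonglongrightarrow> x"
  shows "(\<lambda>n. mollify (e n) f (xs n)) \<longlonglongrightarrow> f x"
proof (rule tendstoI)
  fix \<eta> :: real assume \<eta>: "\<eta> > 0"
  have "isCont f x" using c x continuous_on_eq_continuous_at[of "- {0}" f] by (simp add: open_Compl)
  then obtain d where d: "d > 0" "\<And>y. norm (y - x) < d \<Longrightarrow> \<bar>f y - f x\<bar> < \<eta> / 2"
    unfolding continuous_at_eps_delta using \<eta> half_gt_zero by (metis dist_norm real_norm_def)
  have 1: "\<forall>\<^sub>F n in sequentially. e n < d / 2" by (rule order_tendstoD(2)[OF e(2)]) (use d in simp)
  have 2: "\<forall>\<^sub>F n in sequentially. dist (xs n) x < d / 2" by (rule tendstoD[OF xs]) (use d in simp)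
  show "\<forall>\<^sub>F n in sequentially. dist (mollify (e n) f (xs n)) (f x) < \<eta>"
    using 1 2
  proof eventually_elim
    case (elim n)
    have b: "\<bar>f y - f x\<bar> < \<eta> / 2" if "norm (y - xs n) < e n" for y
      using that elim norm_triangle_ineq[of "y - xs n" "xs n - x"] by (intro d(2)) (simp add: dist_norm)
    have "f y \<le> f x + \<eta> / 2" "f x - \<eta> / 2 \<le> f y" if "norm (y - xs n) < e n" for y
      using b[OF that] by linarith+
    then have "mollify (e n) f (xs n) \<le> f x + \<eta> / 2" "f x - \<eta> / 2 \<le> mollify (e n) f (xs n)"
      by (intro mollify_between weighted_integrable_moll f e; simp)+
    then show ?case using \<eta> by (simp add: dist_real_def abs_le_iff field_simps)
  qed
qed

lemma mollify_bounded:
  fixes f :: "'a::euclidean_space \<Rightarrow> real"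
  assumes f: "weighted f" and e: "\<epsilon> > 0" and l: "(f \<longlongrightarrow> 0) at_infinity"
  shows "\<exists>B. \<forall>x. \<bar>mollify \<epsilon> f x\<bar> \<le> B"
proof -
  obtain L where L: "\<And>y. norm y \<ge> L \<Longrightarrow> \<bar>f y\<bar> < 1"
    using tendstoD[OF l, of 1] by (auto simp: eventually_at_infinity)
  have "compact (mollify \<epsilon> f ` cball 0 (L + \<epsilon>))"
    by (rule compact_continuous_image[OF continuous_on_subset[OF continuous_mollify[OF f e]]]) auto
  then obtain B where B: "\<forall>y\<in>mollify \<epsilon> f ` cball 0 (L + \<epsilon>). norm y \<le> B" using compact_imp_bounded bounded_iff by metis
  have "\<bar>mollify \<epsilon> f x\<bar> \<le> max B 1" for x
  proof (cases "norm x \<le> L + \<epsilon>")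
    case True then show ?thesis using B by (auto simp: le_max_iff_disj)
  next
    case False
    have b: "\<bar>f y\<bar> < 1" if "norm (y - x) < \<epsilon>" for y
      using that False norm_triangle_ineq2[of x "x - y"] by (intro L) (auto simp: norm_minus_commute)
    have "mollify \<epsilon> f x \<le> 1" "-1 \<le> mollify \<epsilon> f x"
      by (intro mollify_between weighted_integrable_moll f e; use b in \<open>force simp: abs_less_iff\<close>)+
    then show ?thesis by auto
  qed
  then show ?thesis by blast
qed

definition mass :: "('a::euclidean_space \<Rightarrow> real) \<Rightarrow> real \<Rightarrow> real" where
  "mass f r = (\<integral>y. f y * indicator (cball 0 r) y \<partial>lborel)"

lemma mass_integrable: "weighted f \<Longrightarrow> integrable lborel (\<lambda>y. f y * indicator (cball 0 r) y)"
  by (rule weighted_integrable_supported[where B=1 and \<rho>=r]) (auto simp: indicator_def)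

lemma mass_mono:
  assumes "weighted f" "\<And>x. f x \<ge> 0" "r \<le> s"
  shows "mass f r \<le> mass f s"
  unfolding mass_def using assms by (intro integral_mono mass_integrable) (auto simp: indicator_def)

lemma mass_nonneg: "(\<And>x. f x \<ge> 0) \<Longrightarrow> 0 \<le> mass f r"
  unfolding mass_def by (intro integral_nonneg_AE) auto

text \<open>By Fubini the mass of the mollification in a ball is the integral of the original function
  against the mollified indicator, which lies between the indicators of two nearby balls.\<close>

lemma mass_mollify:
  fixes f :: "'a::euclidean_space \<Rightarrow> real"
  assumes f: "weighted f" and nn: "\<And>x. f x \<ge> 0" and e: "\<epsilon> > 0" and le: "r + \<epsilon> \<le> s"
  shows "mass f r \<le> mass (mollify \<epsilon> f) s" "mass (mollify \<epsilon> f) r \<le> mass f s"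
proof -
  have [measurable]: "f \<in> borel_measurable borel" using f by (rule weighted_measurable)
  define J where "J = (\<lambda>t (y::'a). \<integral>z. indicator (cball 0 t) z * moll \<epsilon> (y - z) \<partial>lborel)"
  have mi: "integrable lborel (\<lambda>z. moll \<epsilon> (y - z))" "(\<integral>z. moll \<epsilon> (y - z) \<partial>lborel) = 1" for y :: 'a
    using integral_moll[OF e, of y] by (simp_all add: moll_minus[of \<epsilon> "y - _", symmetric] del: moll_minus)
  have ji: "integrable lborel (\<lambda>z. indicator (cball 0 t) z * moll \<epsilon> (y - z))" for t and y :: 'a
    by (rule Bochner_Integration.integrable_bound[OF mi(1)[of y]]) (auto simp: indicator_def)
  have J0: "0 \<le> J t y" for t y unfolding J_def using e by (intro integral_nonneg_AE) auto
  have J1: "J t y \<le> 1" for t y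
  proof -
    have "J t y \<le> (\<integral>z. moll \<epsilon> (y - z) \<partial>lborel)"
      unfolding J_def using e by (intro integral_mono ji mi) (auto simp: indicator_def)
    then show ?thesis using mi(2) by simp
  qed
  have Jz: "J t y = 0" if "norm y > t + \<epsilon>" for t y
  proof -
    have "indicator (cball 0 t) z * moll \<epsilon> (y - z) = 0" for z
      using that norm_triangle_ineq2[of y z] moll_eq_0[OF e, of "y - z"] by (auto simp: indicator_def)
    from this show ?thesis unfolding J_def by (simp only: integral_zero)
  qed
  have Jo: "J t y = 1" if "norm y + \<epsilon> \<le> t" for t y
  proof -
    have "indicator (cball 0 t) z * moll \<epsilon> (y - z) = moll \<epsilon> (y - z)" for z
      using that norm_triangle_ineq2[of z y] moll_eq_0[OF e, of "y - z"] by (cases "norm z \<le> t") (auto simp: indicator_def norm_minus_commute)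
    then show ?thesis unfolding J_def by (simp only: mi(2))
  qed
  have Jm[measurable]: "J t \<in> borel_measurable borel" for t unfolding J_def by measurable
  have fJ: "integrable lborel (\<lambda>y. f y * J t y)" for t
    by (rule weighted_integrable_supported[OF f Jm, where B=1 and \<rho>="t + \<epsilon>"]) (use J0 J1 Jz in auto)
  have key: "mass (mollify \<epsilon> f) t = (\<integral>y. f y * J t y \<partial>lborel)" for t
  proof -
    have int: "integrable (lborel \<Otimes>\<^sub>M lborel) (\<lambda>(y, z). f y * (indicator (cball 0 t) z * moll \<epsilon> (y - z)))"
    proof (rule lborel_pair.Fubini_integrable)
      show "integrable lborel (\<lambda>x. \<integral>y. norm (case (x, y) of (y, z) \<Rightarrow> f y * (indicator (cball 0 t) z * moll \<epsilon> (y - z))) \<partial>lborel)"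
        using fJ[of t] nn e by (simp add: abs_mult J_def)
      show "AE x in lborel. integrable lborel (\<lambda>y. case (x, y) of (y, z) \<Rightarrow> f y * (indicator (cball 0 t) z * moll \<epsilon> (y - z)))"
        using ji by simp
    qed measurable
    have "mass (mollify \<epsilon> f) t = (\<integral>z. (\<integral>y. f y * (indicator (cball 0 t) z * moll \<epsilon> (y - z)) \<partial>lborel) \<partial>lborel)"
      unfolding mass_def mollify_def by (rule Bochner_Integration.integral_cong) (auto simp: indicator_def)
    also have "\<dots> = (\<integral>y. (\<integral>z. f y * (indicator (cball 0 t) z * moll \<epsilon> (y - z)) \<partial>lborel) \<partial>lborel)"
      by (rule lborel_pair.Fubini_integral[OF int])
    finally show ?thesis by (simp add: J_def)
  qed
  show "mass f r \<le> mass (mollify \<epsilon> f) s"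
    unfolding key unfolding mass_def
  proof (rule integral_mono[OF mass_integrable[OF f] fJ])
    show "f y * indicator (cball 0 r) y \<le> f y * J s y" for y
      using nn[of y] J0[of s y] Jo[of y s] le by (cases "norm y \<le> r") auto
  qed
  show "mass (mollify \<epsilon> f) r \<le> mass f s"
    unfolding key unfolding mass_def
  proof (rule integral_mono[OF fJ mass_integrable[OF f]])
    show "f y * J r y \<le> f y * indicator (cball 0 s) y" for y
      using nn[of y] J1[of r y] Jz[of r y] le by (cases "norm y \<le> s") (auto simp: mult_left_le)
  qed
qed

end

section \<open>Mollified solutions and comparison\<close>

text \<open>The solution with its value at the origin set to zero, so that it is a Borel function.\<close>

locale frac_solution = fractional_order \<alpha> for \<alpha> +
  fixes p :: real and U :: "'a::euclidean_space \<Rightarrow> real"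
  assumes p: "1 < p" and U_nonneg: "\<And>x. 0 \<le> U x" and U_cont: "continuous_on (- {0}) U"
    and U_w: "weighted U" and Up_w: "weighted (\<lambda>x. U x powr p)" and U_lim: "(U \<longlongrightarrow> 0) at_infinity"
    and U_eq: "\<And>\<xi>. c11_supported \<xi> \<Longrightarrow> (\<integral>x. U x powr p * \<xi> x - U x * levy_lim \<xi> x \<partial>lborel) = \<xi> 0"
begin

lemma U_measurable [measurable]: "U \<in> borel_measurable borel" using U_w by (rule weighted_measurable)

lemma Up_cont: "continuous_on (- {0}) (\<lambda>x. U x powr p)"
  using p U_nonneg by (intro continuous_intros continuous_on_powr' U_cont) auto

text \<open>The mollified equation holds pointwise away from the origin: the support of the translated
  mollifier avoids the origin, so the Dirac mass does not contribute, and the test function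
  carries the operator over to the mollification.\<close>

lemma mollified_equation:
  assumes e: "\<epsilon> > 0" and x: "\<epsilon> \<le> norm x"
  shows "((\<lambda>\<epsilon>'. levy_op \<alpha> \<epsilon>' (mollify \<epsilon> U) x) \<longlongrightarrow> mollify \<epsilon> (\<lambda>y. U y powr p) x) (at_right 0)"
proof -
  let ?\<phi> = "\<lambda>y. moll \<epsilon> (y - x)"
  have \<phi>: "c11_supported ?\<phi>" by (rule c11_supported_moll[OF e])
  note lim = levy_op_pairing_tendsto(1)[OF U_w \<phi>] and i2 = levy_op_pairing_tendsto(2)[OF U_w \<phi>]
  have i3: "integrable lborel (\<lambda>y. U y powr p * ?\<phi> y)" by (rule weighted_integrable_moll[OF Up_w e])
  have "(\<integral>y. U y powr p * ?\<phi> y \<partial>lborel) - (\<integral>y. U y * levy_lim ?\<phi> y \<partial>lborel) = ?\<phi> 0"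
    using U_eq[OF \<phi>] Bochner_Integration.integral_diff[OF i3 i2] by simp
  also have "\<dots> = 0" using moll_eq_0[OF e, of "0 - x"] x by simp
  finally have "(\<integral>y. U y * levy_lim ?\<phi> y \<partial>lborel) = mollify \<epsilon> (\<lambda>y. U y powr p) x"
    by (simp add: mollify_def)
  moreover have "\<forall>\<^sub>F t in at_right 0. levy_op \<alpha> t (mollify \<epsilon> U) x = (\<integral>y. U y * levy_op \<alpha> t ?\<phi> y \<partial>lborel)"
    using eventually_at_right_less[of "0::real"] by eventually_elim (simp add: levy_op_mollify[OF U_w e])
  ultimately show ?thesis using lim by (subst tendsto_cong) auto
qed

lemma mollify_nonneg: "\<epsilon> > 0 \<Longrightarrow> 0 \<le> mollify \<epsilon> U x"
  by (rule mollify_between(2)[OF weighted_integrable_moll[OF U_w]]) (auto simp: U_nonneg)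

end

context fractional_order
begin

lemma integral_mass_shift:
  assumes "weighted f"
  shows "integrable lborel (\<lambda>h. f (x + h) * indicator (cball 0 r) (x + h))"
    "(\<integral>h. f (x + h) * indicator (cball 0 r) (x + h) \<partial>lborel) = mass f r"
  using lborel_integral_shift(1)[of "\<lambda>y. f y * indicator (cball 0 r) y" x]
    lborel_integral_shift(2)[of "\<lambda>y. f y * indicator (cball 0 r) y" x] mass_integrable[OF assms, of r]
  by (simp_all add: mass_def add.commute[of _ x])

text \<open>Where \<open>w - v\<close> is extremal, the integrand of the difference of the two operators has a sign. In the
  ball of radius \<open>m\<close>, where \<open>v\<close> vanishes, the values of \<open>w\<close> remain and contribute the mass: as a gain at
  a minimum, as a cost at a maximum.\<close>

lemma levy_op_at_minimum:
  fixes w v :: "'a::euclidean_space \<Rightarrow> real"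
  assumes w: "weighted w" "\<And>x. 0 \<le> w x" "\<And>x. \<bar>w x\<bar> \<le> Bw"
    and v: "v \<in> borel_measurable borel" "\<And>x. \<bar>v x\<bar> \<le> Bv" "\<And>x. norm x \<le> m \<Longrightarrow> v x = 0"
    and min: "\<And>z. w x - v x \<le> w z - v z" "w x - v x \<le> 0"
    and e: "\<epsilon> > 0" "m + \<epsilon> < norm x"
  shows "levy_op \<alpha> \<epsilon> v x + (2 * norm x) powr (- (real DIM('a) + 2 * \<alpha>)) * mass w m \<le> levy_op \<alpha> \<epsilon> w x"
proof -
  let ?k = "(2 * norm x) powr (- (real DIM('a) + 2 * \<alpha>))"
  have iw: "integrable lborel (\<lambda>h. (w (x + h) - w x) * tkern \<alpha> \<epsilon> h)"
    by (rule integrable_bounded_increment[OF weighted_measurable[OF w(1)] w(3) e(1)])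
  have iv: "integrable lborel (\<lambda>h. (v (x + h) - v x) * tkern \<alpha> \<epsilon> h)"
    by (rule integrable_bounded_increment[OF v(1,2) e(1)])
  have im: "integrable lborel (\<lambda>h. ?k * (w (x + h) * indicator (cball 0 m) (x + h)))"
    by (intro integrable_mult_right integral_mass_shift w)
  have "levy_op \<alpha> \<epsilon> v x + ?k * mass w m =
     (\<integral>h. (v (x + h) - v x) * tkern \<alpha> \<epsilon> h + ?k * (w (x + h) * indicator (cball 0 m) (x + h)) \<partial>lborel)"
    unfolding Bochner_Integration.integral_add[OF iv im] using integral_mass_shift(2)[OF w(1), of x m] by (simp add: levy_op_def)
  also have "\<dots> \<le> levy_op \<alpha> \<epsilon> w x"
    unfolding levy_op_def
  proof (rule integral_mono[OF Bochner_Integration.integrable_add[OF iv im] iw])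
    fix h
    show "(v (x + h) - v x) * tkern \<alpha> \<epsilon> h + ?k * (w (x + h) * indicator (cball 0 m) (x + h)) \<le> (w (x + h) - w x) * tkern \<alpha> \<epsilon> h"
    proof (cases "norm (x + h) \<le> m")
      case False
      have "(v (x + h) - v x) * tkern \<alpha> \<epsilon> h \<le> (w (x + h) - w x) * tkern \<alpha> \<epsilon> h"
        using min(1)[of "x + h"] by (intro mult_right_mono) auto
      then show ?thesis using False by simp
    next
      case True
      have h: "norm h > \<epsilon>" "norm h \<le> 2 * norm x"
        using True e norm_diff_ineq[of x h] norm_triangle_ineq4[of "x + h" x] by (auto simp: add.commute)
      have "h \<noteq> 0" using h(1) e(1) by auto
      then have "?k \<le> kern \<alpha> h" unfolding kern_def
        using h frac_order_dim_pos[where 'a='a] by (intro powr_mono2') auto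
      then have k: "?k \<le> tkern \<alpha> \<epsilon> h" using h by (simp add: tkern_def)
      have "(v (x + h) - v x) * tkern \<alpha> \<epsilon> h + w (x + h) * tkern \<alpha> \<epsilon> h \<le> (w (x + h) - w x) * tkern \<alpha> \<epsilon> h"
        unfolding distrib_right[symmetric] using v(3)[OF True] min(2) by (intro mult_right_mono) auto
      moreover have "?k * w (x + h) \<le> w (x + h) * tkern \<alpha> \<epsilon> h"
        using mult_right_mono[OF k w(2)[of "x + h"]] by (simp add: mult.commute)
      ultimately show ?thesis using True by simp
    qed
  qed
  finally show ?thesis .
qed

lemma levy_op_at_maximum:
  fixes w v :: "'a::euclidean_space \<Rightarrow> real"
  assumes w: "weighted w" "\<And>x. 0 \<le> w x" "\<And>x. \<bar>w x\<bar> \<le> Bw"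
    and v: "v \<in> borel_measurable borel" "\<And>x. \<bar>v x\<bar> \<le> Bv" "\<And>x. norm x \<le> m \<Longrightarrow> v x = 0"
    and max: "\<And>z. norm z > m \<Longrightarrow> w z - v z \<le> w x - v x" "0 \<le> w x - v x"
    and e: "\<epsilon> > 0" and d: "d > 0" "m + d \<le> norm x"
  shows "levy_op \<alpha> \<epsilon> w x \<le> levy_op \<alpha> \<epsilon> v x + d powr (- (real DIM('a) + 2 * \<alpha>)) * mass w m"
proof -
  let ?k = "d powr (- (real DIM('a) + 2 * \<alpha>))"
  have iw: "integrable lborel (\<lambda>h. (w (x + h) - w x) * tkern \<alpha> \<epsilon> h)"
    by (rule integrable_bounded_increment[OF weighted_measurable[OF w(1)] w(3) e(1)])
  have iv: "integrable lborel (\<lambda>h. (v (x + h) - v x) * tkern \<alpha> \<epsilon> h)"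
    by (rule integrable_bounded_increment[OF v(1,2) e(1)])
  have im: "integrable lborel (\<lambda>h. ?k * (w (x + h) * indicator (cball 0 m) (x + h)))"
    by (intro integrable_mult_right integral_mass_shift w)
  have "levy_op \<alpha> \<epsilon> w x \<le> (\<integral>h. (v (x + h) - v x) * tkern \<alpha> \<epsilon> h + ?k * (w (x + h) * indicator (cball 0 m) (x + h)) \<partial>lborel)"
    unfolding levy_op_def
  proof (rule integral_mono[OF iw Bochner_Integration.integrable_add[OF iv im]])
    fix h
    show "(w (x + h) - w x) * tkern \<alpha> \<epsilon> h \<le> (v (x + h) - v x) * tkern \<alpha> \<epsilon> h + ?k * (w (x + h) * indicator (cball 0 m) (x + h))"
    proof (cases "norm (x + h) \<le> m")
      case False
      have "(w (x + h) - w x) * tkern \<alpha> \<epsilon> h \<le> (v (x + h) - v x) * tkern \<alpha> \<epsilon> h"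
        using max(1)[of "x + h"] False by (intro mult_right_mono) auto
      then show ?thesis using False by simp
    next
      case True
      have h: "d \<le> norm h" using True d norm_diff_ineq[of x h] by auto
      have "kern \<alpha> h \<le> ?k" unfolding kern_def
        using h d frac_order_dim_pos[where 'a='a] by (intro powr_mono2') auto
      then have k: "tkern \<alpha> \<epsilon> h \<le> ?k" using tkern_le_kern order_trans by blast
      have "(w (x + h) - w x) * tkern \<alpha> \<epsilon> h \<le> (v (x + h) - v x) * tkern \<alpha> \<epsilon> h + w (x + h) * tkern \<alpha> \<epsilon> h"
        unfolding distrib_right[symmetric] using v(3)[OF True] max(2) by (intro mult_right_mono) auto
      moreover have "w (x + h) * tkern \<alpha> \<epsilon> h \<le> ?k * w (x + h)"
        using mult_right_mono[OF k w(2)[of "x + h"]] by (simp add: mult.commute)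
      ultimately show ?thesis using True by simp
    qed
  qed
  also have "\<dots> = levy_op \<alpha> \<epsilon> v x + ?k * mass w m"
    unfolding Bochner_Integration.integral_add[OF iv im] using integral_mass_shift(2)[OF w(1), of x m] by (simp add: levy_op_def)
  finally show ?thesis .
qed

end

context frac_solution
begin

lemma mollify_U_bounded: "\<epsilon> > 0 \<Longrightarrow> \<exists>B. \<forall>x. \<bar>mollify \<epsilon> U x\<bar> \<le> B"
  by (rule mollify_bounded[OF U_w _ U_lim])

lemma mollify_U_weighted:
  assumes e: "\<epsilon> > 0"
  shows "weighted (mollify \<epsilon> U)"
proof -
  have m[measurable]: "mollify \<epsilon> U \<in> borel_measurable borel"
    by (rule borel_measurable_continuous_onI[OF continuous_mollify[OF U_w e]])
  obtain B where B: "\<And>x. \<bar>mollify \<epsilon> U x\<bar> \<le> B" using mollify_U_bounded[OF e] by blast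
  have "integrable lborel (\<lambda>x. mollify \<epsilon> U x * wgt \<alpha> x)"
  proof (rule Bochner_Integration.integrable_bound)
    show "integrable lborel (\<lambda>x::'a. B * wgt \<alpha> x)" by (simp add: integrable_wgt)
    show "AE x in lborel. norm (mollify \<epsilon> U x * wgt \<alpha> x) \<le> norm (B * wgt \<alpha> x)"
      using B by (auto simp: abs_mult intro!: mult_right_mono order_trans[OF B abs_ge_self])
  qed measurable
  then show ?thesis by (simp add: weighted_def m)
qed

text \<open>If the barrier \<open>v\<close> exceeds \<open>U\<close> somewhere, then \<open>U - v\<close> has a negative minimum. Since \<open>U\<close> is merely
  continuous, the operator is evaluated on its mollifications instead: each mollification minus
  \<open>v\<close> has a negative minimum, where \<open>levy_op_at_minimum\<close> and the mollified equation apply, and the minima stay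
  in a fixed compact set because \<open>v\<close> vanishes at infinity and near the origin. A limit of them is
  the asserted point. The mass term is the gain from the ball in which \<open>v\<close> vanishes.\<close>

theorem comparison_from_below:
  assumes s: "0 < s" "s < r"
    and v: "v \<in> borel_measurable borel" "\<And>x. \<bar>v x\<bar> \<le> Bv" "\<And>x. norm x < r \<Longrightarrow> v x = 0"
      "continuous_on {x. r \<le> norm x} v" "(v \<longlongrightarrow> 0) at_infinity"
    and b: "continuous_on {x. r \<le> norm x} b"
    and op: "\<And>x. r \<le> norm x \<Longrightarrow> U x < v x \<Longrightarrow> \<forall>\<^sub>F \<epsilon> in at_right 0. b x \<le> levy_op \<alpha> \<epsilon> v x"
    and x1: "r \<le> norm x1" "U x1 < v x1"
  obtains x where "r \<le> norm x" "U x < v x"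
    "b x + (2 * norm x) powr (- (real DIM('a) + 2 * \<alpha>)) * mass U s \<le> U x powr p"
proof -
  define \<delta> where "\<delta> = (v x1 - U x1) / 3"
  have \<delta>: "\<delta> > 0" "v x1 - U x1 = 3 * \<delta>" using x1 by (auto simp: \<delta>_def)
  \<comment> \<open>The mollification blurs the ball of radius \<open>s\<close>; an intermediate radius leaves room on both sides.\<close>
  define m where "m = (s + r) / 2"
  have m: "0 < m" "m < r" "s < m" using s by (auto simp: m_def)
  define e where "e = (\<lambda>n::nat. (m - s) / (real n + 1))"
  have e0: "e n > 0" for n using m by (simp add: e_def)
  have e1: "s + e n \<le> m" for n
  proof -
    have "(m - s) / (real n + 1) \<le> (m - s) / 1" using m by (intro divide_left_mono) auto
    then show ?thesis by (simp add: e_def)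
  qed
  have el: "e \<longlonglongrightarrow> 0" unfolding e_def by real_asymp
  define w where "w = (\<lambda>n. mollify (e n) U)"
  have w_nn: "0 \<le> w n x" for n x unfolding w_def by (rule mollify_nonneg[OF e0])
  have w_cont: "continuous_on S (w n)" for n S
    unfolding w_def by (rule continuous_on_subset[OF continuous_mollify[OF U_w e0]]) simp
  have w_lim: "(\<lambda>n. w (\<sigma> n) (ys n)) \<longlonglongrightarrow> U y" if "strict_mono \<sigma>" "ys \<longlonglongrightarrow> y" "y \<noteq> 0" for \<sigma> ys y
    unfolding w_def using that e0 LIMSEQ_subseq_LIMSEQ[OF el that(1)]
    by (intro mollify_tendsto[OF U_w U_cont, where e="\<lambda>n. e (\<sigma> n)"]) (auto simp: comp_def)
  obtain L0 where L0: "\<And>x. L0 \<le> norm x \<Longrightarrow> \<bar>v x\<bar> < \<delta>"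
    using tendstoD[OF v(5) \<delta>(1)] by (auto simp: eventually_at_infinity)
  define L where "L = max L0 (norm x1)"
  define K where "K = {x::'a. r \<le> norm x \<and> norm x \<le> L}"
  have K: "compact K"
  proof -
    have "K = cball 0 L - ball 0 r" by (auto simp: K_def)
    then show ?thesis by (simp add: compact_diff)
  qed
  have x1K: "x1 \<in> K" using x1 by (simp add: K_def L_def)
  have vK: "continuous_on K v" by (rule continuous_on_subset[OF v(4)]) (auto simp: K_def)
  have "\<exists>x\<in>K. \<forall>y\<in>K. w n x - v x \<le> w n y - v y" for n
    using x1K by (intro continuous_attains_inf K continuous_on_diff w_cont vK) auto
  then obtain xs where xs: "\<And>n. xs n \<in> K" "\<And>n y. y \<in> K \<Longrightarrow> w n (xs n) - v (xs n) \<le> w n y - v y"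
    by metis
  obtain x \<sigma> where x: "x \<in> K" "strict_mono \<sigma>" "(xs \<circ> \<sigma>) \<longlonglongrightarrow> x"
    using K xs(1) unfolding compact_def by metis
  have x0: "x \<noteq> 0" using x(1) m by (auto simp: K_def)
  let ?x = "\<lambda>n. xs (\<sigma> n)" and ?w = "\<lambda>n. w (\<sigma> n)" and ?e = "\<lambda>n. e (\<sigma> n)"
  have xl: "?x \<longlonglongrightarrow> x" using x(3) by (simp add: comp_def)
  have wl: "(\<lambda>n. ?w n (?x n)) \<longlonglongrightarrow> U x" by (rule w_lim[OF x(2) xl x0])
  have vl: "(\<lambda>n. v (?x n)) \<longlonglongrightarrow> v x"
    by (rule continuous_on_tendsto_compose[OF vK xl x(1)]) (simp add: xs)
  have Ul: "(\<lambda>n. U (?x n)) \<longlonglongrightarrow> U x"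
  proof (rule continuous_on_tendsto_compose[OF U_cont xl])
    have "?x n \<noteq> 0" for n using xs(1)[of "\<sigma> n"] m by (auto simp: K_def)
    then show "\<forall>\<^sub>F n in sequentially. ?x n \<in> - {0}" by simp
  qed (use x0 in simp)
  have "(\<lambda>n. ?w n x1) \<longlonglongrightarrow> U x1" by (rule w_lim[OF x(2)]) (use x1 m in auto)
  then have ev1: "\<forall>\<^sub>F n in sequentially. ?w n x1 < U x1 + \<delta>"
    using \<delta> by (intro order_tendstoD) auto
  have neg: "\<forall>\<^sub>F n in sequentially. ?w n (?x n) - v (?x n) \<le> - 2 * \<delta>"
    using ev1
  proof eventually_elim
    case (elim n)
    then show ?case using xs(2)[OF x1K, of "\<sigma> n"] \<delta> by linarith
  qed
  have "U x - v x \<le> - 2 * \<delta>"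
    by (rule tendsto_upperbound[OF tendsto_diff[OF wl vl] neg]) simp
  then have Uv: "U x < v x" using \<delta> by linarith
  then have ev2: "\<forall>\<^sub>F n in sequentially. U (?x n) - v (?x n) < 0"
    using order_tendstoD(2)[OF tendsto_diff[OF Ul vl], of 0] by simp
  let ?q = "real DIM('a) + 2 * \<alpha>"
  have key: "\<forall>\<^sub>F n in sequentially. b (?x n) + (2 * norm (?x n)) powr (- ?q) * mass U s \<le> mollify (?e n) (\<lambda>y. U y powr p) (?x n)"
    using neg ev2
  proof eventually_elim
    case (elim n)
    have xr: "r \<le> norm (?x n)" using xs(1)[of "\<sigma> n"] by (simp add: K_def)
    obtain Bw where Bw: "\<And>z. \<bar>?w n z\<bar> \<le> Bw" using mollify_U_bounded[OF e0] unfolding w_def by blast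
    \<comment> \<open>The minimum over \<open>K\<close> is global: outside \<open>K\<close> the difference is at least \<open>-\<delta>\<close>.\<close>
    have min: "?w n (?x n) - v (?x n) \<le> ?w n z - v z" for z
    proof -
      consider "norm z < r" | "z \<in> K" | "L < norm z" unfolding K_def by force
      then show ?thesis
      proof cases
        case 1 then show ?thesis using v(3)[OF 1] w_nn[of "\<sigma> n" z] elim \<delta> by linarith
      next
        case 2 then show ?thesis by (rule xs(2))
      next
        case 3 then show ?thesis using L0[of z] w_nn[of "\<sigma> n" z] elim(1) \<delta> unfolding L_def by linarith
      qed
    qed
    have mass: "mass U s \<le> mass (?w n) m" unfolding w_def by (rule mass_mollify(1)[OF U_w U_nonneg e0 e1])
    have "\<forall>\<^sub>F \<epsilon> in at_right 0. b (?x n) + (2 * norm (?x n)) powr (- ?q) * mass U s \<le> levy_op \<alpha> \<epsilon> (?w n) (?x n)"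
    proof -
      have "\<forall>\<^sub>F \<epsilon> in at_right 0. b (?x n) \<le> levy_op \<alpha> \<epsilon> v (?x n)" by (rule op[OF xr]) (use elim in simp)
      moreover have "\<forall>\<^sub>F \<epsilon> in at_right (0::real). 0 < \<epsilon> \<and> \<epsilon> < r - m"
        using m by (auto simp: eventually_at_right_field intro!: exI[of _ "r - m"])
      ultimately show ?thesis
      proof eventually_elim
        case (elim \<epsilon>)
        have "levy_op \<alpha> \<epsilon> v (?x n) + (2 * norm (?x n)) powr (- ?q) * mass (?w n) m \<le> levy_op \<alpha> \<epsilon> (?w n) (?x n)"
          by (rule levy_op_at_minimum[OF _ w_nn Bw v(1,2) _ min])
             (use elim m xr v(3) mollify_U_weighted[OF e0] neg \<open>?w n (?x n) - v (?x n) \<le> - 2 * \<delta>\<close> \<delta> in \<open>auto simp: w_def\<close>)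
        moreover have "(2 * norm (?x n)) powr (- ?q) * mass U s \<le> (2 * norm (?x n)) powr (- ?q) * mass (?w n) m"
          using mass by (intro mult_left_mono) auto
        ultimately show ?case using elim by linarith
      qed
    qed
    moreover have "((\<lambda>\<epsilon>. levy_op \<alpha> \<epsilon> (?w n) (?x n)) \<longlongrightarrow> mollify (?e n) (\<lambda>y. U y powr p) (?x n)) (at_right 0)"
      unfolding w_def using e1[of "\<sigma> n"] xr m s by (intro mollified_equation e0) auto
    ultimately show ?case by (intro tendsto_lowerbound) auto
  qed
  have lim1: "(\<lambda>n. mollify (?e n) (\<lambda>y. U y powr p) (?x n)) \<longlonglongrightarrow> U x powr p"
    using e0 LIMSEQ_subseq_LIMSEQ[OF el x(2)] xl x0
    by (intro mollify_tendsto[OF Up_w Up_cont]) (auto simp: comp_def)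
  have lim2: "(\<lambda>n. b (?x n) + (2 * norm (?x n)) powr (- ?q) * mass U s) \<longlonglongrightarrow> b x + (2 * norm x) powr (- ?q) * mass U s"
  proof (intro tendsto_intros)
    show "(\<lambda>n. b (?x n)) \<longlonglongrightarrow> b x"
      by (rule continuous_on_tendsto_compose[OF b xl]) (use x xs in \<open>auto simp: K_def\<close>)
  qed (use xl x0 in auto)
  show ?thesis
  proof (rule that[OF _ Uv])
    show "r \<le> norm x" using x(1) by (simp add: K_def)
    show "b x + (2 * norm x) powr (- ?q) * mass U s \<le> U x powr p"
      by (rule tendsto_le[OF _ lim1 lim2 key]) simp
  qed
qed

text \<open>Add \<open>S\<close> times a bump of radius \<open>r\<close> around \<open>x1\<close>. The sum exceeds \<open>S\<close> at \<open>x1\<close>, hence has its maximum over the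
  complement of the ball of radius \<open>2 r\<close> in the support of the bump. At a maximum the operator is
  at most what the bump costs plus the interaction with the mass in that ball, at a distance of
  at least \<open>r\<close>.\<close>

theorem local_upper_bound:
  assumes r: "r > 0" and S: "\<And>y. r \<le> norm y \<Longrightarrow> U y \<le> S" and x1: "4 * r \<le> norm x1"
  shows "U x1 powr p \<le> 54 * levy_mass TYPE('a) * r powr (- 2 * \<alpha>) * S + r powr (- (real DIM('a) + 2 * \<alpha>)) * mass U (3 * r)"
proof (cases "U x1 = 0")
  let ?q = "real DIM('a) + 2 * \<alpha>"
  let ?C = "54 * levy_mass TYPE('a) * r powr (- 2 * \<alpha>) * S + r powr (- ?q) * mass U (3 * r)"
  have S0: "0 \<le> S" using S[of x1] U_nonneg[of x1] x1 r by linarith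
  case True
  then show ?thesis using S0 levy_mass_nonneg[where 'a='a] mass_nonneg[of U "3 * r", OF U_nonneg]
    by (simp del: minus_add_distrib)
next
  let ?q = "real DIM('a) + 2 * \<alpha>"
  let ?C = "54 * levy_mass TYPE('a) * r powr (- 2 * \<alpha>) * S + r powr (- ?q) * mass U (3 * r)"
  have S0: "0 \<le> S" using S[of x1] U_nonneg[of x1] x1 r by linarith
  case False
  then have pos: "0 < U x1" using U_nonneg[of x1] by linarith
  have x10: "x1 \<noteq> 0" using x1 r by auto
  \<comment> \<open>The negative of the added bump, in the role of the function with which \<open>U\<close> is compared.\<close>
  define v where "v = (\<lambda>y. - S * bump ((y - x1) /\<^sub>R r))"
  have v_cont: "continuous_on A v" for A unfolding v_def bump_def by (intro continuous_intros)
  have v_m: "v \<in> borel_measurable borel" by (rule borel_measurable_continuous_onI[OF v_cont])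
  have v_b: "- S \<le> v y" "v y \<le> 0" for y
    using bump_simps(2,3)[of "(y - x1) /\<^sub>R r"] S0 by (auto simp: v_def mult_left_le)
  have v_abs: "\<bar>v y\<bar> \<le> S" for y using v_b[of y] by linarith
  have v_out: "v y = 0" if "r \<le> norm (y - x1)" for y
    using bump_affine_eq_0[OF r that] by (simp add: v_def)
  have v1: "v x1 = - S" by (simp add: v_def)
  have v_s: "\<bar>sdiff v x h\<bar> \<le> (54 * S) * min 1 ((norm h / r)\<^sup>2)" for x h
  proof -
    have "sdiff v x h = - S * sdiff (\<lambda>y. bump ((y - x1) /\<^sub>R r)) x h" by (simp add: v_def sdiff_def algebra_simps)
    then show ?thesis using mult_left_mono[OF bump_affine_sdiff[OF r, of x1 x h] S0] S0 by (simp add: abs_mult mult_ac)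
  qed
  have v_op: "levy_op \<alpha> \<epsilon> v x \<le> 54 * levy_mass TYPE('a) * r powr (- 2 * \<alpha>) * S" if "\<epsilon> > 0" for \<epsilon> x
    using levy_op_bound(2)[OF v_m v_abs r v_s that] by (simp add: abs_le_iff mult_ac)
  define e where "e = (\<lambda>n::nat. r / (real n + 1))"
  have e0: "e n > 0" for n using r by (simp add: e_def)
  have e1: "e n \<le> r" for n
  proof -
    have "r / (real n + 1) \<le> r / 1" using r by (intro divide_left_mono) auto
    then show ?thesis by (simp add: e_def)
  qed
  have el: "e \<longlonglongrightarrow> 0" unfolding e_def by real_asymp
  define w where "w = (\<lambda>n. mollify (e n) U)"
  have w_nn: "0 \<le> w n x" for n x unfolding w_def by (rule mollify_nonneg[OF e0])
  have w_S: "w n x \<le> S" if x: "2 * r \<le> norm x" for n x unfolding w_def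
  proof (rule mollify_between(1)[OF weighted_integrable_moll[OF U_w e0] e0])
    fix y assume "norm (y - x) < e n"
    then show "U y \<le> S" using e1[of n] x norm_triangle_ineq2[of x "x - y"] by (intro S) (auto simp: norm_minus_commute)
  qed
  have w_cont: "continuous_on A (w n)" for n A
    unfolding w_def by (rule continuous_on_subset[OF continuous_mollify[OF U_w e0]]) simp
  have w_lim: "(\<lambda>n. w (\<sigma> n) (ys n)) \<longlonglongrightarrow> U y" if "strict_mono \<sigma>" "ys \<longlonglongrightarrow> y" "y \<noteq> 0" for \<sigma> ys y
    unfolding w_def using that e0 LIMSEQ_subseq_LIMSEQ[OF el that(1)]
    by (intro mollify_tendsto[OF U_w U_cont, where e="\<lambda>n. e (\<sigma> n)"]) (auto simp: comp_def)
  define K where "K = cball x1 r"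
  have x1K: "x1 \<in> K" using r by (simp add: K_def)
  have "\<exists>x\<in>K. \<forall>y\<in>K. w n y - v y \<le> w n x - v x" for n
    unfolding K_def using r by (intro continuous_attains_sup continuous_on_diff w_cont v_cont) auto
  then obtain xs where xs: "\<And>n. xs n \<in> K" "\<And>n y. y \<in> K \<Longrightarrow> w n y - v y \<le> w n (xs n) - v (xs n)"
    by metis
  obtain x \<sigma> where x: "x \<in> K" "strict_mono \<sigma>" "(xs \<circ> \<sigma>) \<longlonglongrightarrow> x"
    using compact_cball[of x1 r] xs(1) unfolding K_def[symmetric] compact_def by metis
  have K3: "3 * r \<le> norm y" if "y \<in> K" for y
    using that x1 norm_triangle_ineq2[of x1 "x1 - y"] by (auto simp: K_def dist_norm)
  have x0: "x \<noteq> 0" using K3[OF x(1)] r by auto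
  let ?x = "\<lambda>n. xs (\<sigma> n)" and ?w = "\<lambda>n. w (\<sigma> n)" and ?e = "\<lambda>n. e (\<sigma> n)"
  have xl: "?x \<longlonglongrightarrow> x" using x(3) by (simp add: comp_def)
  have wl: "(\<lambda>n. ?w n (?x n)) \<longlonglongrightarrow> U x" by (rule w_lim[OF x(2) xl x0])
  have wl1: "(\<lambda>n. ?w n x1) \<longlonglongrightarrow> U x1" by (rule w_lim[OF x(2)]) (use x10 in auto)
  \<comment> \<open>The bump is largest at \<open>x1\<close>, so at the maximum of the sum \<open>U\<close> must be at least as large as at \<open>x1\<close>.\<close>
  have ge: "?w n x1 \<le> ?w n (?x n)" for n
    using xs(2)[OF x1K, of "\<sigma> n"] v1 v_b[of "?x n"] by linarith
  have "U x1 \<le> U x" by (rule LIMSEQ_le[OF wl1 wl]) (use ge in auto)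
  then have "U x1 powr p \<le> U x powr p" using p pos by (intro powr_mono2) auto
  also have "U x powr p \<le> ?C"
  proof (rule tendsto_upperbound)
    show "(\<lambda>n. mollify (?e n) (\<lambda>y. U y powr p) (?x n)) \<longlonglongrightarrow> U x powr p"
      using e0 LIMSEQ_subseq_LIMSEQ[OF el x(2)] xl x0
      by (intro mollify_tendsto[OF Up_w Up_cont]) (auto simp: comp_def)
    have "\<forall>\<^sub>F n in sequentially. 0 < ?w n x1" using order_tendstoD(1)[OF wl1 pos] .
    then show "\<forall>\<^sub>F n in sequentially. mollify (?e n) (\<lambda>y. U y powr p) (?x n) \<le> ?C"
    proof eventually_elim
      case (elim n)
      obtain Bw where Bw: "\<And>z. \<bar>?w n z\<bar> \<le> Bw" using mollify_U_bounded[OF e0] unfolding w_def by blast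
      have big: "S < ?w n (?x n) - v (?x n)" using xs(2)[OF x1K, of "\<sigma> n"] v1 elim by linarith
      have max: "?w n z - v z \<le> ?w n (?x n) - v (?x n)" if "2 * r < norm z" for z
      proof (cases "z \<in> K")
        case True then show ?thesis by (rule xs(2))
      next
        case False
        then have "v z = 0" by (intro v_out) (auto simp: K_def dist_norm norm_minus_commute)
        then show ?thesis using w_S[of z "\<sigma> n"] that big by linarith
      qed
      have v_in: "v z = 0" if "norm z \<le> 2 * r" for z
        using that x1 r norm_triangle_ineq2[of x1 "x1 - z"] by (intro v_out) (auto simp: norm_minus_commute)
      have mass: "mass (?w n) (2 * r) \<le> mass U (3 * r)"
        unfolding w_def using e1[of "\<sigma> n"] by (intro mass_mollify(2)[OF U_w U_nonneg e0]) auto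
      have "\<forall>\<^sub>F \<epsilon> in at_right 0. levy_op \<alpha> \<epsilon> (?w n) (?x n) \<le> ?C"
        using eventually_at_right_less[of "0::real"]
      proof eventually_elim
        case (elim \<epsilon>)
        have "levy_op \<alpha> \<epsilon> (?w n) (?x n) \<le> levy_op \<alpha> \<epsilon> v (?x n) + r powr (- ?q) * mass (?w n) (2 * r)"
          by (rule levy_op_at_maximum[OF _ w_nn Bw v_m v_abs v_in max])
             (use elim r K3[OF xs(1)[of "\<sigma> n"]] mollify_U_weighted[OF e0] big S0 in \<open>auto simp: w_def\<close>)
        moreover have "r powr (- ?q) * mass (?w n) (2 * r) \<le> r powr (- ?q) * mass U (3 * r)"
          using mass by (intro mult_left_mono) auto
        ultimately show ?case using v_op[OF elim, of "?x n"] by linarith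
      qed
      moreover have "((\<lambda>\<epsilon>. levy_op \<alpha> \<epsilon> (?w n) (?x n)) \<longlongrightarrow> mollify (?e n) (\<lambda>y. U y powr p) (?x n)) (at_right 0)"
        unfolding w_def using e1[of "\<sigma> n"] K3[OF xs(1)[of "\<sigma> n"]] r by (intro mollified_equation e0) auto
      ultimately show ?case by (intro tendsto_upperbound) auto
    qed
  qed simp
  finally show ?thesis .
qed

text \<open>Compare with a bump of height \<open>t\<close> slightly above the value at \<open>x1\<close> and radius \<open>r\<close>. At the point produced by the
  comparison the value of \<open>U\<close> is at most \<open>t\<close>, the operator on the bump costs at most a multiple of
  \<open>t\<close>, and the mass near the origin interacts over a distance of at most \<open>34 r\<close>.\<close>

theorem local_lower_bound:
  assumes r: "r > 0" and x1: "4 * r \<le> norm x1" "norm x1 \<le> 16 * r"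
  shows "(34 * r) powr (- (real DIM('a) + 2 * \<alpha>)) * mass U r \<le>
     U x1 powr p + 54 * levy_mass TYPE('a) * r powr (- 2 * \<alpha>) * U x1"
proof -
  let ?q = "real DIM('a) + 2 * \<alpha>"
  let ?k = "54 * levy_mass TYPE('a) * r powr (- 2 * \<alpha>)"
  have k: "0 \<le> ?k" using levy_mass_nonneg[where 'a='a] by simp
  have main: "(34 * r) powr (- ?q) * mass U r \<le> t powr p + ?k * t" if t: "U x1 < t" for t
  proof -
    have t0: "0 < t" using t U_nonneg[of x1] by linarith
    define v where "v = (\<lambda>y. t * bump ((y - x1) /\<^sub>R r))"
    have v_cont: "continuous_on A v" for A unfolding v_def bump_def by (intro continuous_intros)
    have v_m: "v \<in> borel_measurable borel" by (rule borel_measurable_continuous_onI[OF v_cont])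
    have v_b: "0 \<le> v y" "v y \<le> t" for y
      using bump_simps(2,3)[of "(y - x1) /\<^sub>R r"] t0 by (auto simp: v_def mult_left_le)
    have v_abs: "\<bar>v y\<bar> \<le> t" for y using v_b[of y] by linarith
    have v_out: "v y = 0" if "r \<le> norm (y - x1)" for y
      using bump_affine_eq_0[OF r that] by (simp add: v_def)
    have v1: "v x1 = t" by (simp add: v_def)
    have v_s: "\<bar>sdiff v x h\<bar> \<le> (54 * t) * min 1 ((norm h / r)\<^sup>2)" for x h
    proof -
      have "sdiff v x h = t * sdiff (\<lambda>y. bump ((y - x1) /\<^sub>R r)) x h" by (simp add: v_def sdiff_def algebra_simps)
      then show ?thesis using mult_left_mono[OF bump_affine_sdiff[OF r, of x1 x h], of t] t0 by (simp add: abs_mult mult_ac)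
    qed
    have v_op: "- (?k * t) \<le> levy_op \<alpha> \<epsilon> v x" if "\<epsilon> > 0" for \<epsilon> x
      using levy_op_bound(2)[OF v_m v_abs r v_s that, of x] unfolding abs_le_iff
      by (simp add: mult_ac)
    \<comment> \<open>The bump lives in the annulus between \<open>2 r\<close> and \<open>17 r\<close>; twice the latter is the constant \<open>34\<close>.\<close>
    have far: "v y = 0" if "norm y < 2 * r \<or> 17 * r \<le> norm y" for y
      using that x1 r norm_triangle_ineq2[of x1 "x1 - y"] norm_triangle_ineq2[of y x1]
      by (intro v_out) (auto simp: norm_minus_commute)
    have v_lim: "(v \<longlongrightarrow> 0) at_infinity"
      by (rule tendsto_eventually) (auto simp: eventually_at_infinity far intro!: exI[of _ "17 * r"])
    obtain x where x: "U x < v x" "- (?k * t) + (2 * norm x) powr (- ?q) * mass U r \<le> U x powr p"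
    proof (rule comparison_from_below[of r "2 * r" v t "\<lambda>_. - (?k * t)" x1])
      show "\<forall>\<^sub>F \<epsilon> in at_right 0. - (?k * t) \<le> levy_op \<alpha> \<epsilon> v x" for x
        using eventually_at_right_less[of "0::real"] by eventually_elim (rule v_op)
    qed (use r v_m v_abs v_cont v_lim far x1 t v1 that in auto)
    have "norm x < 17 * r" using x(1) far[of x] U_nonneg[of x] by (cases "norm x < 17 * r") auto
    moreover have "x \<noteq> 0" using x(1) far[of x] U_nonneg[of x] r by auto
    ultimately have "(34 * r) powr (- ?q) \<le> (2 * norm x) powr (- ?q)"
      using frac_order_dim_pos[where 'a='a] by (intro powr_mono2') auto
    then have "(34 * r) powr (- ?q) * mass U r \<le> (2 * norm x) powr (- ?q) * mass U r"
      by (intro mult_right_mono mass_nonneg U_nonneg)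
    moreover have "U x powr p \<le> t powr p"
      using x(1) v_b[of x] U_nonneg[of x] p by (intro powr_mono2) auto
    ultimately show ?thesis using x(2) by linarith
  qed
  show ?thesis
  proof (rule tendsto_lowerbound)
    show "((\<lambda>t. t powr p + ?k * t) \<longlongrightarrow> U x1 powr p + ?k * U x1) (at_right (U x1))"
      using p by (intro tendsto_intros tendsto_powr') (auto simp: eventually_at_right_less U_nonneg intro: eventually_mono[OF eventually_at_right_less] order_trans[OF U_nonneg])
    show "\<forall>\<^sub>F t in at_right (U x1). (34 * r) powr (- ?q) * mass U r \<le> t powr p + ?k * t"
      using eventually_at_right_less[of "U x1"] by eventually_elim (rule main)
  qed simp
qed

end

context frac_solution
begin

section \<open>Upper bounds by iteration over the radii \<open>4 ^ k\<close>\<close>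

lemma U_bounded_outside:
  assumes "r > 0"
  obtains S where "S > 0" "\<And>y. r \<le> norm y \<Longrightarrow> U y \<le> S"
proof -
  obtain L where L: "\<And>y. norm y \<ge> L \<Longrightarrow> \<bar>U y\<bar> < 1"
    using tendstoD[OF U_lim, of 1] by (auto simp: eventually_at_infinity)
  have "compact (cball (0::'a) L - ball 0 r)" by (simp add: compact_diff)
  then have "compact (U ` (cball 0 L - ball 0 r))"
    by (rule compact_continuous_image[rotated]) (use assms in \<open>auto intro: continuous_on_subset[OF U_cont]\<close>)
  then obtain B where B: "\<forall>y\<in>U ` (cball 0 L - ball 0 r). norm y \<le> B" using compact_imp_bounded bounded_iff by metis
  show ?thesis
  proof (rule that[of "max B 1"])
    fix y :: 'a assume y: "r \<le> norm y"
    show "U y \<le> max B 1"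
    proof (cases "norm y \<le> L")
      case True
      then have "norm (U y) \<le> B" using B y by auto
      then show ?thesis by simp
    next
      case False
      then show ?thesis using L[of y] by simp
    qed
  qed simp
qed

lemma mass_growth_upper:
  assumes S: "\<And>y. r \<le> norm y \<Longrightarrow> U y \<le> S" and r: "0 < r" "r \<le> t"
  shows "mass U t \<le> mass U r + S * unit_ball_vol (real DIM('a)) * t ^ DIM('a)"
proof -
  obtain b :: 'a where b: "norm b = r" using vector_choose_size[of r] r by auto
  have S0: "0 \<le> S" using S[of b] U_nonneg[of b] b by linarith
  have i: "integrable lborel (\<lambda>y. S * indicator (cball 0 t) (y::'a))" using r by (simp add: emeasure_cball)
  have "mass U t \<le> (\<integral>y. U y * indicator (cball 0 r) y + S * indicator (cball 0 t) y \<partial>lborel)"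
    unfolding mass_def
  proof (rule integral_mono[OF mass_integrable[OF U_w] Bochner_Integration.integrable_add[OF mass_integrable[OF U_w] i]])
    show "U y * indicator (cball 0 t) y \<le> U y * indicator (cball 0 r) y + S * indicator (cball 0 t) y" for y
      using S[of y] S0 r U_nonneg[of y] by (auto simp: indicator_def)
  qed
  also have "\<dots> = mass U r + S * unit_ball_vol (real DIM('a)) * t ^ DIM('a)"
    unfolding Bochner_Integration.integral_add[OF mass_integrable[OF U_w] i] mass_def using r by (simp add: content_cball)
  finally show ?thesis .
qed

lemma mass_growth_lower:
  assumes m: "\<And>y. r \<le> norm y \<Longrightarrow> norm y \<le> t \<Longrightarrow> m \<le> U y" and r: "0 < r" "r \<le> t"
  shows "mass U r + m * unit_ball_vol (real DIM('a)) * (t ^ DIM('a) - r ^ DIM('a)) \<le> mass U t"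
proof -
  have i: "integrable lborel (\<lambda>y. m * (indicator (cball 0 t) (y::'a) - indicator (cball 0 r) y))" using r by (simp add: emeasure_cball)
  have "mass U r + m * unit_ball_vol (real DIM('a)) * (t ^ DIM('a) - r ^ DIM('a)) = (\<integral>y. U y * indicator (cball 0 r) y + m * (indicator (cball 0 t) y - indicator (cball 0 r) y) \<partial>lborel)"
    unfolding Bochner_Integration.integral_add[OF mass_integrable[OF U_w] i] mass_def
    using r by (simp add: content_cball emeasure_cball right_diff_distrib)
  also have "\<dots> \<le> mass U t"
    unfolding mass_def
  proof (rule integral_mono[OF Bochner_Integration.integrable_add[OF mass_integrable[OF U_w] i] mass_integrable[OF U_w]])
    show "U y * indicator (cball 0 r) y + m * (indicator (cball 0 t) y - indicator (cball 0 r) y) \<le> U y * indicator (cball 0 t) y" for y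
      using m[of y] r by (auto simp: indicator_def)
  qed
  finally show ?thesis .
qed

text \<open>A function without mass solves the equation without the Dirac mass; the bump, whose value at the
  origin is 1, detects the difference.\<close>

lemma mass_pos: obtains r where "r > 0" "mass U r > 0"
proof (rule ccontr)
  assume no: "\<not> thesis"
  have z: "mass U (real n + 1) = 0" for n :: nat
    using no that[of "real n + 1"] mass_nonneg[of U "real n + 1", OF U_nonneg] by force
  have "AE y in lborel. U y * indicator (cball 0 (real n + 1)) y = 0" for n :: nat
    using integral_nonneg_eq_0_iff_AE[OF mass_integrable[OF U_w, of "real n + 1"]] z[of n] U_nonneg
    by (simp add: mass_def)
  then have "AE y in lborel. \<forall>n::nat. U y * indicator (cball 0 (real n + 1)) y = 0"
    unfolding AE_all_countable by blast
  then have "AE y in lborel. U y = 0"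
  proof eventually_elim
    case (elim y)
    obtain n :: nat where "norm y \<le> real n" using real_arch_simple by blast
    then show ?case using elim[rule_format, of n] by (simp add: indicator_def)
  qed
  then have "AE y in lborel. U y powr p * bump y - U y * levy_lim bump y = 0"
    by eventually_elim simp
  then have "(\<integral>y. U y powr p * bump y - U y * levy_lim bump y \<partial>lborel) = 0"
    by (rule integral_eq_zero_AE)
  moreover have "c11_supported (bump :: 'a \<Rightarrow> real)" using c11_supported_bump[of 1 "0::'a"] by simp
  ultimately show False using U_eq[of bump] by simp
qed

text \<open>The local upper bound with the mass in the larger ball replaced by the mass in the ball of radius
  \<open>r\<close>: the difference is at most \<open>S\<close> times a volume of order \<open>r ^ N\<close>, which is absorbed in the first term.\<close>

lemma decay_step:
  obtains C where "C > 0" "\<And>r S x. r > 0 \<Longrightarrow> (\<And>y. r \<le> norm y \<Longrightarrow> U y \<le> S) \<Longrightarrow> 4 * r \<le> norm x \<Longrightarrow>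
    U x powr p \<le> C * (r powr (- 2 * \<alpha>) * S + r powr (- (real DIM('a) + 2 * \<alpha>)) * mass U r)"
proof
  let ?q = "real DIM('a) + 2 * \<alpha>"
  define C where "C = 54 * levy_mass TYPE('a) + unit_ball_vol (real DIM('a)) * 3 ^ DIM('a) + 1"
  have L0: "0 \<le> levy_mass TYPE('a)" by (rule levy_mass_nonneg)
  have u0: "0 \<le> unit_ball_vol (real DIM('a)) * 3 ^ DIM('a)" by simp
  show "C > 0" unfolding C_def using L0 u0 by linarith
  fix r S and x :: 'a assume r: "r > 0" and S: "\<And>y. r \<le> norm y \<Longrightarrow> U y \<le> S" and x: "4 * r \<le> norm x"
  have S0: "0 \<le> S" using S[of x] U_nonneg[of x] x r by linarith
  let ?A = "r powr (- 2 * \<alpha>) * S" and ?M = "r powr (- ?q) * mass U r"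
  have A: "0 \<le> ?A" using S0 by simp
  have M: "0 \<le> ?M" using mass_nonneg[of U r, OF U_nonneg] by simp
  have e: "r powr (- ?q) * r ^ DIM('a) = r powr (- 2 * \<alpha>)"
    using r by (simp add: powr_realpow[symmetric] powr_add[symmetric] del: powr_realpow')
  have "U x powr p \<le> 54 * levy_mass TYPE('a) * r powr (- 2 * \<alpha>) * S + r powr (- ?q) * mass U (3 * r)"
    by (rule local_upper_bound[OF r S x])
  also have "\<dots> \<le> 54 * levy_mass TYPE('a) * r powr (- 2 * \<alpha>) * S + r powr (- ?q) * (mass U r + S * unit_ball_vol (real DIM('a)) * (3 * r) ^ DIM('a))"
    using r by (intro add_left_mono mult_left_mono mass_growth_upper S) auto
  also have "\<dots> = (54 * levy_mass TYPE('a) + unit_ball_vol (real DIM('a)) * 3 ^ DIM('a)) * ?A + ?M"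
    unfolding e[symmetric] by (simp add: algebra_simps power_mult_distrib)
  also have "\<dots> \<le> C * ?A + C * ?M"
  proof (rule add_mono)
    show "(54 * levy_mass TYPE('a) + unit_ball_vol (real DIM('a)) * 3 ^ DIM('a)) * ?A \<le> C * ?A"
      using A by (intro mult_right_mono) (auto simp: C_def)
    show "?M \<le> C * ?M" using mult_right_mono[of 1 C ?M] M L0 u0 by (simp add: C_def)
  qed
  finally show "U x powr p \<le> C * (?A + ?M)" by (simp add: distrib_left)
qed

text \<open>The pair (bound on \<open>U\<close> outside the ball of radius \<open>4 ^ k\<close>, bound on the mass inside) is
  propagated from \<open>k\<close> to \<open>k + 1\<close> by \<open>decay_step\<close> and \<open>mass_growth_upper\<close>. A profile that is consistent up
  to a constant, in the sense of the two recursive hypotheses, becomes an upper bound after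
  multiplication by a large \<open>A\<close>, because one step gains \<open>A\<close> on one side and \<open>A powr p\<close> on the other.\<close>

lemma upper_profile:
  fixes \<psi> m :: "nat \<Rightarrow> real"
  assumes pos: "\<And>k. k \<ge> k0 \<Longrightarrow> \<psi> k > 0" "\<And>k. k \<ge> k0 \<Longrightarrow> m k > 0"
    and 1: "\<And>k. k \<ge> k0 \<Longrightarrow> (4^k) powr (- 2 * \<alpha>) * \<psi> k + (4^k) powr (- (real DIM('a) + 2 * \<alpha>)) * m k \<le> C1 * \<psi> (Suc k) powr p"
    and 2: "\<And>k. k \<ge> k0 \<Longrightarrow> m k + unit_ball_vol (real DIM('a)) * (4 * 4^k) ^ DIM('a) * \<psi> k \<le> m (Suc k)"
  obtains A where "A > 0" "\<And>k x. k \<ge> k0 \<Longrightarrow> 4^k \<le> norm x \<Longrightarrow> U x \<le> A * \<psi> k"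
proof -
  let ?q = "real DIM('a) + 2 * \<alpha>"
  obtain C where C: "C > 0" "\<And>r S x. r > 0 \<Longrightarrow> (\<And>y. r \<le> norm y \<Longrightarrow> U y \<le> S) \<Longrightarrow> 4 * r \<le> norm x \<Longrightarrow>
    U x powr p \<le> C * (r powr (- 2 * \<alpha>) * S + r powr (- ?q) * mass U r)" using decay_step by metis
  obtain S0 where S0: "S0 > 0" "\<And>y. 4^k0 \<le> norm y \<Longrightarrow> U y \<le> S0" using U_bounded_outside[of "4^k0"] by auto
  define A where "A = Max {1, S0 / \<psi> k0, mass U (4^k0) / m k0, \<bar>C * C1\<bar> powr (1 / (p - 1))}"
  have A: "1 \<le> A" "S0 / \<psi> k0 \<le> A" "mass U (4^k0) / m k0 \<le> A" "\<bar>C * C1\<bar> powr (1 / (p - 1)) \<le> A"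
    by (auto simp: A_def)
  have "(\<bar>C * C1\<bar> powr (1 / (p - 1))) powr (p - 1) \<le> A powr (p - 1)"
    using A p by (intro powr_mono2) auto
  then have "\<bar>C * C1\<bar> \<le> A powr (p - 1)" using p by (cases "C * C1 = 0") (auto simp: powr_powr)
  then have Ap: "C * C1 * A \<le> A powr p"
    using mult_right_mono[of "C * C1" "A powr (p - 1)" A] A(1) by (simp add: powr_diff abs_le_iff)
  have "(\<forall>x. 4^k \<le> norm x \<longrightarrow> U x \<le> A * \<psi> k) \<and> mass U (4^k) \<le> A * m k" if "k \<ge> k0" for k
    using that
  proof (induction k rule: dec_induct)
    case base
    have "S0 \<le> A * \<psi> k0" "mass U (4^k0) \<le> A * m k0" using A pos[of k0] by (auto simp: field_simps)
    then show ?case using S0 by force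
  next
    case (step k)
    have IH: "\<And>y. 4^k \<le> norm y \<Longrightarrow> U y \<le> A * \<psi> k" "mass U (4^k) \<le> A * m k" using step.IH by auto
    have "U x \<le> A * \<psi> (Suc k)" if x: "4 ^ Suc k \<le> norm x" for x
    proof (rule ccontr)
      assume "\<not> U x \<le> A * \<psi> (Suc k)"
      then have "(A * \<psi> (Suc k)) powr p < U x powr p"
        using A pos(1)[of "Suc k"] step p by (intro powr_less_mono2) auto
      also have "\<dots> \<le> C * ((4^k) powr (- 2 * \<alpha>) * (A * \<psi> k) + (4^k) powr (- ?q) * mass U (4^k))"
        using x by (intro C(2) IH) auto
      also have "\<dots> \<le> C * ((4^k) powr (- 2 * \<alpha>) * (A * \<psi> k) + (4^k) powr (- ?q) * (A * m k))"
        using C(1) IH(2) by (intro mult_left_mono add_left_mono) auto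
      also have "\<dots> = C * A * ((4^k) powr (- 2 * \<alpha>) * \<psi> k + (4^k) powr (- ?q) * m k)" by (simp add: algebra_simps)
      also have "\<dots> \<le> C * A * (C1 * \<psi> (Suc k) powr p)"
        using C(1) A(1) step by (intro mult_left_mono 1) auto
      also have "\<dots> = (C * C1 * A) * \<psi> (Suc k) powr p" by simp
      also have "\<dots> \<le> A powr p * \<psi> (Suc k) powr p" by (intro mult_right_mono Ap) auto
      also have "\<dots> = (A * \<psi> (Suc k)) powr p" using A pos(1)[of "Suc k"] step by (simp add: powr_mult)
      finally show False by simp
    qed
    moreover have "mass U (4 ^ Suc k) \<le> A * m (Suc k)"
    proof -
      have "mass U (4 ^ Suc k) \<le> mass U (4^k) + (A * \<psi> k) * unit_ball_vol (real DIM('a)) * (4 ^ Suc k) ^ DIM('a)"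
        by (rule mass_growth_upper[OF IH(1)]) auto
      also have "\<dots> \<le> A * m k + (A * \<psi> k) * unit_ball_vol (real DIM('a)) * (4 ^ Suc k) ^ DIM('a)" using IH(2) by simp
      also have "\<dots> = A * (m k + unit_ball_vol (real DIM('a)) * (4 * 4^k) ^ DIM('a) * \<psi> k)" by (simp add: algebra_simps)
      also have "\<dots> \<le> A * m (Suc k)" using A(1) 2[of k] step by (intro mult_left_mono) auto
      finally show ?thesis .
    qed
    ultimately show ?case by blast
  qed
  then show ?thesis using A(1) by (intro that[of A]) auto
qed

lemma between_powers_of_4:
  fixes t :: real
  assumes "4 ^ k0 \<le> t"
  obtains k where "k \<ge> k0" "4^k \<le> t" "t < 4 * 4^k"
proof -
  obtain n where n: "t < 4^n" using real_arch_pow[of 4 t] by auto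
  define P where "P = (\<lambda>k. 4^(k0 + k) \<le> t)"
  have "\<exists>k. \<not> P k"
  proof
    have "(4::real)^n \<le> 4^(k0 + n)" by (intro power_increasing) auto
    then show "\<not> P n" using n unfolding P_def by linarith
  qed
  moreover have "P 0" using assms by (simp add: P_def)
  ultimately obtain j where "P j" "\<not> P (Suc j)" by (metis nat_induct)
  then show ?thesis by (intro that[of "k0 + j"]) (auto simp: P_def)
qed

lemma upper_power:
  assumes A: "A > 0" "\<And>k x. 4^k \<le> norm x \<Longrightarrow> U x \<le> A * (4^k) powr (- \<sigma>)" and \<sigma>: "\<sigma> > 0"
  shows "\<exists>C>0. \<forall>x. norm x \<ge> 1 \<longrightarrow> U x \<le> C * norm x powr (- \<sigma>)"
proof (intro exI[of _ "A * 4 powr \<sigma>"] conjI allI impI)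
  fix x :: 'a assume x: "norm x \<ge> 1"
  then obtain k where k: "4^k \<le> norm x" "norm x < 4 * 4^k" using between_powers_of_4[of 0 "norm x"] by auto
  have "(4 * 4^k) powr (- \<sigma>) \<le> norm x powr (- \<sigma>)" using k x \<sigma> by (intro powr_mono2') auto
  then have "(4^k) powr (- \<sigma>) \<le> 4 powr \<sigma> * norm x powr (- \<sigma>)"
    by (simp add: powr_mult powr_minus field_simps)
  then have "A * (4^k) powr (- \<sigma>) \<le> A * (4 powr \<sigma> * norm x powr (- \<sigma>))" using A(1) by (intro mult_left_mono) auto
  then show "U x \<le> A * 4 powr \<sigma> * norm x powr (- \<sigma>)" using A(2)[OF k(1)] by simp
qed (use A in simp)

text \<open>Faster decay than the power \<open>-N\<close> keeps the mass bounded; the mass profile increases to its limit at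
  the geometric rate dictated by the decay.\<close>

theorem upper_bound_subcritical:
  assumes sub: "real DIM('a) < (real DIM('a) + 2 * \<alpha>) / p"
  shows "\<exists>C>0. \<forall>x. norm x \<ge> 1 \<longrightarrow> U x \<le> C * norm x powr (- ((real DIM('a) + 2 * \<alpha>) / p))"
proof -
  define q where "q = real DIM('a) + 2 * \<alpha>"
  define \<sigma> where "\<sigma> = q / p"
  define d where "d = \<sigma> - real DIM('a)"
  have d: "d > 0" using sub by (simp add: d_def \<sigma>_def q_def)
  have \<sigma>p: "\<sigma> * p = q" using p by (simp add: \<sigma>_def)
  have lt: "4 powr (- d) < (1::real)" using d powr_less_mono[of "-d" 0 4] by simp
  \<comment> \<open>With this factor the second hypothesis of \<open>upper_profile\<close> is an equality.\<close>
  define E where "E = unit_ball_vol (real DIM('a)) * 4 ^ DIM('a) / (1 - 4 powr (- d))"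
  have E0: "E > 0" using lt by (simp add: E_def)
  have E: "E * (1 - 4 powr (- d)) = unit_ball_vol (real DIM('a)) * 4 ^ DIM('a)" using lt d by (simp add: E_def)
  have le1: "(4^k) powr (- d) \<le> (1::real)" for k
    using powr_mono[of "-d" 0 "4^k"] d by simp
  obtain A where A: "A > 0" "\<And>k x. k \<ge> 0 \<Longrightarrow> 4^k \<le> norm x \<Longrightarrow> U x \<le> A * (4^k) powr (- \<sigma>)"
  proof (rule upper_profile[of 0 "\<lambda>k. (4^k) powr (- \<sigma>)" "\<lambda>k. E * (2 - (4^k) powr (- d))" "4 powr q * (1 + 2 * E)"])
    fix k :: nat
    show "0 < E * (2 - (4^k) powr (- d))" using E0 le1[of k] by (intro mult_pos_pos) linarith+
    let ?R = "4^k :: real"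
    have R: "?R \<ge> 1" by simp
    have "?R powr (- 2 * \<alpha>) * ?R powr (- \<sigma>) \<le> ?R powr (- q)"
      unfolding powr_add[symmetric] using R d by (intro powr_mono) (auto simp: d_def q_def)
    moreover have "?R powr (- q) * (E * (2 - ?R powr (- d))) \<le> ?R powr (- q) * (E * 2)"
      using E0 by (intro mult_left_mono) auto
    moreover have "(?R powr (- q)) * (1 + 2 * E) = (4 powr q * (1 + 2 * E)) * ((4 ^ Suc k) powr (- \<sigma>)) powr p"
    proof -
      have "((4 ^ Suc k) powr (- \<sigma>)) powr p = (4 * ?R) powr (- q)" by (simp only: powr_powr power_Suc mult_minus_left \<sigma>p)
      also have "\<dots> = 4 powr (- q) * ?R powr (- q)" by (simp add: powr_mult)
      finally show ?thesis by (simp add: powr_minus)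
    qed
    ultimately show "?R powr (- 2 * \<alpha>) * ?R powr (- \<sigma>) + ?R powr (- (real DIM('a) + 2 * \<alpha>)) * (E * (2 - ?R powr (- d)))
        \<le> 4 powr q * (1 + 2 * E) * ((4 ^ Suc k) powr (- \<sigma>)) powr p"
      unfolding q_def[symmetric] by (simp add: algebra_simps)
    have "(4 * ?R) ^ DIM('a) * ?R powr (- \<sigma>) = 4 ^ DIM('a) * ?R powr (- d)"
      using R by (simp add: power_mult_distrib powr_realpow[symmetric] powr_add[symmetric] d_def del: powr_realpow')
    then have "unit_ball_vol (real DIM('a)) * (4 * ?R) ^ DIM('a) * ?R powr (- \<sigma>) = E * (1 - 4 powr (- d)) * ?R powr (- d)"
      unfolding E by (simp add: mult.assoc)
    moreover have "(4 ^ Suc k) powr (- d) = 4 powr (- d) * ?R powr (- d)" by (simp add: powr_mult)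
    ultimately show "E * (2 - ?R powr (- d)) + unit_ball_vol (real DIM('a)) * (4 * ?R) ^ DIM('a) * ?R powr (- \<sigma>) \<le> E * (2 - (4 ^ Suc k) powr (- d))"
      by (simp add: algebra_simps)
  qed auto
  have "\<sigma> > 0" using d unfolding d_def by (smt (verit) of_nat_0_le_iff)
  from upper_power[OF A(1) A(2)[OF zero_le] this] show ?thesis unfolding \<sigma>_def q_def .
qed

text \<open>Slower decay than the power \<open>-N\<close>: the mass grows like a power and both terms of \<open>decay_step\<close> are of
  the same order.\<close>

theorem upper_bound_supercritical:
  assumes \<tau>: "\<tau> * p = \<tau> + 2 * \<alpha>" "0 < \<tau>" "\<tau> < real DIM('a)"
  shows "\<exists>C>0. \<forall>x. norm x \<ge> 1 \<longrightarrow> U x \<le> C * norm x powr (- \<tau>)"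
proof -
  define q where "q = real DIM('a) + 2 * \<alpha>"
  define d where "d = real DIM('a) - \<tau>"
  have d: "d > 0" using \<tau> by (simp add: d_def)
  have lt: "4 powr d > (1::real)" using d powr_less_mono[of 0 d 4] by simp
  \<comment> \<open>Again the second hypothesis of \<open>upper_profile\<close> becomes an equality.\<close>
  define E where "E = unit_ball_vol (real DIM('a)) * 4 ^ DIM('a) / (4 powr d - 1)"
  have E0: "E > 0" using lt by (simp add: E_def)
  have E: "E * (4 powr d - 1) = unit_ball_vol (real DIM('a)) * 4 ^ DIM('a)" using lt d by (simp add: E_def)
  obtain A where A: "A > 0" "\<And>k x. k \<ge> 0 \<Longrightarrow> 4^k \<le> norm x \<Longrightarrow> U x \<le> A * (4^k) powr (- \<tau>)"
  proof (rule upper_profile[of 0 "\<lambda>k. (4^k) powr (- \<tau>)" "\<lambda>k. E * (4^k) powr d" "4 powr (\<tau> * p) * (1 + E)"])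
    fix k :: nat
    show "0 < E * (4^k) powr d" using E0 by simp
    let ?R = "4^k :: real"
    have R: "?R > 0" by simp
    have "?R powr (- 2 * \<alpha>) * ?R powr (- \<tau>) = ?R powr (- (\<tau> * p))"
      unfolding powr_add[symmetric] \<tau>(1) by (rule arg_cong[where f="(powr) (4^k)"]) simp
    moreover have "?R powr (- q) * (E * ?R powr d) = ?R powr (- (\<tau> * p)) * E"
    proof -
      have "?R powr (- q) * ?R powr d = ?R powr (- (\<tau> * p))"
        unfolding powr_add[symmetric] \<tau>(1) by (rule arg_cong[where f="(powr) (4^k)"]) (simp add: q_def d_def)
      then show ?thesis by (simp add: mult.left_commute[of _ E] mult.commute[of _ E])
    qed
    moreover have "?R powr (- (\<tau> * p)) * (1 + E) = 4 powr (\<tau> * p) * (1 + E) * ((4 ^ Suc k) powr (- \<tau>)) powr p"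
    proof -
      have "((4 ^ Suc k) powr (- \<tau>)) powr p = (4 * ?R) powr (- (\<tau> * p))" by (simp only: powr_powr power_Suc mult_minus_left)
      also have "\<dots> = 4 powr (- (\<tau> * p)) * ?R powr (- (\<tau> * p))" by (simp add: powr_mult)
      finally show ?thesis by (simp add: powr_minus)
    qed
    ultimately show "?R powr (- 2 * \<alpha>) * ?R powr (- \<tau>) + ?R powr (- (real DIM('a) + 2 * \<alpha>)) * (E * ?R powr d)
        \<le> 4 powr (\<tau> * p) * (1 + E) * ((4 ^ Suc k) powr (- \<tau>)) powr p"
      unfolding q_def[symmetric] distrib_left[of "?R powr (- (\<tau> * p))"] by linarith
    have "(4 * ?R) ^ DIM('a) * ?R powr (- \<tau>) = 4 ^ DIM('a) * ?R powr d"
      using R by (simp add: power_mult_distrib powr_realpow[symmetric] powr_add[symmetric] d_def del: powr_realpow')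
    then have "unit_ball_vol (real DIM('a)) * (4 * ?R) ^ DIM('a) * ?R powr (- \<tau>) = E * (4 powr d - 1) * ?R powr d"
      unfolding E by (simp add: mult.assoc)
    moreover have "(4 ^ Suc k) powr d = 4 powr d * ?R powr d" by (simp add: powr_mult)
    ultimately show "E * ?R powr d + unit_ball_vol (real DIM('a)) * (4 * ?R) ^ DIM('a) * ?R powr (- \<tau>) \<le> E * (4 ^ Suc k) powr d"
      by (simp add: algebra_simps)
  qed auto
  from upper_power[OF A(1) A(2)[OF zero_le] \<tau>(2)] show ?thesis .
qed

text \<open>At the critical exponent every scale contributes mass of the same order up to the logarithmic
  factor, and \<open>k\<close> stands for the logarithm of the radius.\<close>

theorem upper_bound_critical:
  assumes crit: "real DIM('a) * p = real DIM('a) + 2 * \<alpha>" and \<beta>: "\<beta> * p = \<beta> + 1" "\<beta> > 0"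
  shows "\<exists>C>0. \<forall>x. norm x \<ge> 4 \<longrightarrow> U x \<le> C * norm x powr (- real DIM('a)) * ln (norm x) powr \<beta>"
proof -
  define q where "q = real DIM('a) + 2 * \<alpha>"
  let ?N = "real DIM('a)"
  define E where "E = unit_ball_vol (real DIM('a)) * 4 ^ DIM('a)"
  have E0: "E > 0" by (simp add: E_def)
  obtain A where A: "A > 0" "\<And>k x. k \<ge> 1 \<Longrightarrow> 4^k \<le> norm x \<Longrightarrow> U x \<le> A * ((4^k) powr (- ?N) * real k powr \<beta>)"
  proof (rule upper_profile[of 1 "\<lambda>k. (4^k) powr (- ?N) * real k powr \<beta>" "\<lambda>k. E * real k powr (\<beta> + 1)" "4 powr q * (1 + E)"])
    fix k :: nat assume k: "1 \<le> k"
    let ?R = "4^k :: real"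
    have R: "?R > 0" by simp
    have m1: "real k powr \<beta> \<le> real (Suc k) powr (\<beta> + 1)"
    proof -
      have "real k powr \<beta> \<le> real (Suc k) powr \<beta>" using \<beta> by (intro powr_mono2) auto
      also have "\<dots> \<le> real (Suc k) powr (\<beta> + 1)" by (intro powr_mono) auto
      finally show ?thesis .
    qed
    have m2: "real k powr (\<beta> + 1) \<le> real (Suc k) powr (\<beta> + 1)" using \<beta> by (intro powr_mono2) auto
    have "?R powr (- 2 * \<alpha>) * (?R powr (- ?N) * real k powr \<beta>) = ?R powr (- q) * real k powr \<beta>"
      unfolding mult.assoc[symmetric] powr_add[symmetric] by (simp add: q_def algebra_simps)
    also have "\<dots> \<le> ?R powr (- q) * real (Suc k) powr (\<beta> + 1)" by (intro mult_left_mono m1) auto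
    finally have a: "?R powr (- 2 * \<alpha>) * (?R powr (- ?N) * real k powr \<beta>) \<le> ?R powr (- q) * real (Suc k) powr (\<beta> + 1)" .
    have b: "?R powr (- q) * (E * real k powr (\<beta> + 1)) \<le> ?R powr (- q) * (E * real (Suc k) powr (\<beta> + 1))"
      using E0 by (intro mult_left_mono m2) auto
    have "((4 ^ Suc k) powr (- ?N) * real (Suc k) powr \<beta>) powr p = (4 * ?R) powr (- q) * real (Suc k) powr (\<beta> + 1)"
      using \<beta>(1) crit by (simp add: powr_powr powr_mult q_def[symmetric] mult.commute[of p] del: of_nat_Suc)
    also have "(4 * ?R) powr (- q) = 4 powr (- q) * ?R powr (- q)" by (simp add: powr_mult)
    finally have "4 powr q * (1 + E) * ((4 ^ Suc k) powr (- ?N) * real (Suc k) powr \<beta>) powr p = ?R powr (- q) * (1 + E) * real (Suc k) powr (\<beta> + 1)"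
      by (simp add: powr_minus field_simps del: of_nat_Suc)
    then show "?R powr (- 2 * \<alpha>) * (?R powr (- ?N) * real k powr \<beta>) + ?R powr (- (?N + 2 * \<alpha>)) * (E * real k powr (\<beta> + 1))
        \<le> 4 powr q * (1 + E) * ((4 ^ Suc k) powr (- ?N) * real (Suc k) powr \<beta>) powr p"
      using a b unfolding q_def[symmetric] by (simp add: algebra_simps del: of_nat_Suc)
    have "(4 * ?R) ^ DIM('a) * ?R powr (- ?N) = 4 ^ DIM('a)"
      using R by (simp add: power_mult_distrib powr_realpow[symmetric] powr_add[symmetric] del: powr_realpow')
    then have "unit_ball_vol (real DIM('a)) * (4 * ?R) ^ DIM('a) * (?R powr (- ?N) * real k powr \<beta>) = E * real k powr \<beta>"
      unfolding E_def by (simp add: mult.assoc[symmetric])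
    moreover have "E * real k powr (\<beta> + 1) + E * real k powr \<beta> = E * (real k powr \<beta> * real (Suc k))"
      using k by (simp add: powr_add algebra_simps)
    moreover have "\<dots> \<le> E * (real (Suc k) powr \<beta> * real (Suc k))"
      using E0 \<beta> by (intro mult_left_mono mult_right_mono powr_mono2) auto
    moreover have "\<dots> = E * real (Suc k) powr (\<beta> + 1)" by (simp add: powr_add del: of_nat_Suc)
    ultimately show "E * real k powr (\<beta> + 1) + unit_ball_vol (real DIM('a)) * (4 * ?R) ^ DIM('a) * (?R powr (- ?N) * real k powr \<beta>) \<le> E * real (Suc k) powr (\<beta> + 1)"
      by linarith
  qed (use E0 in auto)
  show ?thesis
  proof (intro exI[of _ "A * 4 powr ?N"] conjI allI impI)
    fix x :: 'a assume x: "norm x \<ge> 4"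
    then obtain k where k: "k \<ge> 1" "4^k \<le> norm x" "norm x < 4 * 4^k" using between_powers_of_4[of 1 "norm x"] by auto
    have "(4 * 4^k) powr (- ?N) \<le> norm x powr (- ?N)" using k x by (intro powr_mono2') auto
    then have a: "(4^k) powr (- ?N) \<le> 4 powr ?N * norm x powr (- ?N)"
      by (simp add: powr_mult powr_minus field_simps)
    have "1 \<le> ln (4::real)" using exp_le by (subst ln_ge_iff) auto
    then have "real k * 1 \<le> real k * ln 4" by (intro mult_left_mono) auto
    also have "\<dots> = ln (4^k)" by (simp add: ln_realpow)
    also have "\<dots> \<le> ln (norm x)" using k x by (subst ln_le_cancel_iff) auto
    finally have "real k powr \<beta> \<le> ln (norm x) powr \<beta>" using \<beta> by (intro powr_mono2) auto
    then have "(4^k) powr (- ?N) * real k powr \<beta> \<le> (4 powr ?N * norm x powr (- ?N)) * ln (norm x) powr \<beta>"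
      using a by (intro mult_mono) auto
    then have "A * ((4^k) powr (- ?N) * real k powr \<beta>) \<le> A * ((4 powr ?N * norm x powr (- ?N)) * ln (norm x) powr \<beta>)"
      using A(1) by (intro mult_left_mono) auto
    then show "U x \<le> A * 4 powr ?N * norm x powr (- ?N) * ln (norm x) powr \<beta>" using A(2)[OF k(1,2)] by (simp add: mult.assoc)
  qed (use A in simp)
qed

section \<open>Lower bounds from the mass near the origin\<close>

lemma positivity_step:
  obtains c C where "c > 0" "C > 0" "\<And>r x. r > 0 \<Longrightarrow> 4 * r \<le> norm x \<Longrightarrow> norm x \<le> 16 * r \<Longrightarrow>
    c * r powr (- (real DIM('a) + 2 * \<alpha>)) * mass U r \<le> U x powr p + C * r powr (- 2 * \<alpha>) * U x"
proof
  let ?q = "real DIM('a) + 2 * \<alpha>"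
  show "34 powr (- ?q) > (0::real)" "54 * levy_mass TYPE('a) + 1 > 0" using levy_mass_nonneg[where 'a='a] by simp_all
  fix r and x :: 'a assume r: "r > 0" and x: "4 * r \<le> norm x" "norm x \<le> 16 * r"
  have e: "(34 * r) powr (- ?q) = 34 powr (- ?q) * r powr (- ?q)" using r by (simp add: powr_mult)
  have "54 * levy_mass TYPE('a) * r powr (- 2 * \<alpha>) * U x \<le> (54 * levy_mass TYPE('a) + 1) * r powr (- 2 * \<alpha>) * U x"
    using U_nonneg[of x] by (intro mult_right_mono) auto
  then show "34 powr (- ?q) * r powr (- ?q) * mass U r \<le> U x powr p + (54 * levy_mass TYPE('a) + 1) * r powr (- 2 * \<alpha>) * U x"
    using local_lower_bound[OF r x] unfolding e by linarith
qed

lemma U_pos_far: obtains r where "r > 0" "\<And>x. norm x \<ge> r \<Longrightarrow> U x > 0"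
proof -
  obtain r0 where r0: "r0 > 0" "mass U r0 > 0" using mass_pos by blast
  obtain c C where c: "c > 0" "C > 0" "\<And>r x. r > 0 \<Longrightarrow> 4 * r \<le> norm x \<Longrightarrow> norm x \<le> 16 * r \<Longrightarrow>
    c * r powr (- (real DIM('a) + 2 * \<alpha>)) * mass U r \<le> U x powr p + C * r powr (- 2 * \<alpha>) * U x"
    using positivity_step by blast
  show ?thesis
  proof (rule that[of "4 * r0"])
    fix x :: 'a assume x: "4 * r0 \<le> norm x"
    let ?r = "norm x / 4"
    have "mass U ?r > 0" using mass_mono[OF U_w U_nonneg, of r0 ?r] x r0 by simp
    then have "0 < c * ?r powr (- (real DIM('a) + 2 * \<alpha>)) * mass U ?r" using c x r0 by (intro mult_pos_pos) auto
    also have "\<dots> \<le> U x powr p + C * ?r powr (- 2 * \<alpha>) * U x" using x r0 by (intro c(3)) auto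
    finally have "U x \<noteq> 0" by auto
    then show "U x > 0" using U_nonneg[of x] by linarith
  qed (use r0 in simp)
qed

text \<open>The mass is bounded below by a positive constant, and at the asserted size the linear term of
  \<open>positivity_step\<close> is dominated because the decay is at least as fast as the power \<open>-N\<close>.\<close>

theorem lower_bound_subcritical:
  assumes sub: "real DIM('a) \<le> (real DIM('a) + 2 * \<alpha>) / p"
  shows "\<exists>c>0. \<exists>R. \<forall>x. norm x \<ge> R \<longrightarrow> c * norm x powr (- ((real DIM('a) + 2 * \<alpha>) / p)) \<le> U x"
proof -
  define q where "q = real DIM('a) + 2 * \<alpha>"
  define \<sigma> where "\<sigma> = q / p"
  have \<sigma>p: "\<sigma> * p = q" using p by (simp add: \<sigma>_def)
  have \<sigma>: "real DIM('a) \<le> \<sigma>" "\<sigma> \<ge> 0" using sub p alpha by (auto simp: \<sigma>_def q_def)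
  obtain r0 where r0: "r0 > 0" "mass U r0 > 0" using mass_pos by blast
  obtain c C where c: "c > 0" "C > 0" "\<And>r x. r > 0 \<Longrightarrow> 4 * r \<le> norm x \<Longrightarrow> norm x \<le> 16 * r \<Longrightarrow>
    c * r powr (- q) * mass U r \<le> U x powr p + C * r powr (- 2 * \<alpha>) * U x"
    using positivity_step unfolding q_def by blast
  define \<delta> where "\<delta> = min 1 (c * mass U r0 / (1 + C))"
  have \<delta>: "0 < \<delta>" "\<delta> \<le> 1" using c r0 by (auto simp: \<delta>_def)
  have \<delta>3: "(1 + C) * \<delta> \<le> c * mass U r0"
  proof -
    have "\<delta> \<le> c * mass U r0 / (1 + C)" by (simp add: \<delta>_def)
    then show ?thesis using c(2) by (simp add: pos_le_divide_eq mult.commute)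
  qed
  show ?thesis
  proof (rule exI[of _ "\<delta> * 4 powr \<sigma>"], rule conjI[OF _ exI[of _ "4 * max r0 1"], rotated], intro allI impI)
    fix x :: 'a assume x: "4 * max r0 1 \<le> norm x"
    define r where "r = norm x / 4"
    have r: "r \<ge> 1" "r \<ge> r0" using x by (auto simp: r_def)
    have "\<delta> * r powr (- \<sigma>) \<le> U x"
    proof (rule ccontr)
      assume "\<not> \<delta> * r powr (- \<sigma>) \<le> U x"
      then have lt: "U x < \<delta> * r powr (- \<sigma>)" by simp
      have "U x powr p < (\<delta> * r powr (- \<sigma>)) powr p" using lt U_nonneg[of x] p by (intro powr_less_mono2) auto
      also have "\<dots> = \<delta> powr p * r powr (- q)" using \<sigma>p \<delta> by (simp add: powr_mult powr_powr)
      also have "\<dots> \<le> \<delta> * r powr (- q)"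
        using powr_mono'[of 1 p \<delta>] p \<delta> by (intro mult_right_mono) auto
      finally have a: "U x powr p < \<delta> * r powr (- q)" .
      have "C * r powr (- 2 * \<alpha>) * U x \<le> C * r powr (- 2 * \<alpha>) * (\<delta> * r powr (- \<sigma>))"
        using lt c by (intro mult_left_mono) auto
      also have "\<dots> = C * \<delta> * r powr (- 2 * \<alpha> - \<sigma>)" by (simp add: powr_add[symmetric] powr_diff powr_minus field_simps)
      also have "\<dots> \<le> C * \<delta> * r powr (- q)"
        using c \<delta> r \<sigma> by (intro mult_left_mono powr_mono) (auto simp: q_def)
      finally have b: "C * r powr (- 2 * \<alpha>) * U x \<le> C * \<delta> * r powr (- q)" .
      have "c * mass U r0 * r powr (- q) \<le> c * r powr (- q) * mass U r"
        using mass_mono[OF U_w U_nonneg r(2)] c by (simp add: mult_ac mult_left_mono mult_right_mono)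
      also have "\<dots> \<le> U x powr p + C * r powr (- 2 * \<alpha>) * U x" using r by (intro c(3)) (auto simp: r_def)
      also have "\<dots> < ((1 + C) * \<delta>) * r powr (- q)" using a b by (simp add: algebra_simps)
      also have "\<dots> \<le> c * mass U r0 * r powr (- q)" using \<delta>3 by (intro mult_right_mono) auto
      finally show False by simp
    qed
    moreover have "r powr (- \<sigma>) = 4 powr \<sigma> * norm x powr (- \<sigma>)"
      unfolding r_def by (simp add: powr_divide powr_minus field_simps)
    ultimately show "\<delta> * 4 powr \<sigma> * norm x powr (- ((real DIM('a) + 2 * \<alpha>) / p)) \<le> U x"
      by (simp add: \<sigma>_def q_def mult.assoc)
  qed (use \<delta> in auto)
qed

lemma powr_Suc_diff_le:
  fixes x \<gamma> :: real
  assumes "x > 0" "\<gamma> \<ge> 1"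
  shows "(x + 1) powr \<gamma> - x powr \<gamma> \<le> \<gamma> * (x + 1) powr (\<gamma> - 1)"
proof -
  have "\<exists>z>x. z < x + 1 \<and> (x + 1) powr \<gamma> - x powr \<gamma> = ((x + 1) - x) * (\<gamma> * z powr (\<gamma> - 1))"
    using assms by (intro MVT2) (auto intro!: derivative_eq_intros)
  then obtain z where z: "x < z" "z < x + 1" "(x + 1) powr \<gamma> - x powr \<gamma> = \<gamma> * z powr (\<gamma> - 1)" by auto
  have "z powr (\<gamma> - 1) \<le> (x + 1) powr (\<gamma> - 1)" using z assms by (intro powr_mono2) auto
  then show ?thesis using z assms by (simp add: mult_left_mono)
qed

text \<open>Now \<open>U\<close> on the annulus at radius \<open>4 ^ k\<close> is at least of order \<open>4 ^ (-N k)\<close> times the mass to the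
  power \<open>1/p\<close>. Integrated over the annulus this is a recursion for the masses whose discrete
  solution grows like \<open>k\<close> to the power \<open>\<beta> + 1\<close>, and it feeds back into the pointwise bound.\<close>

theorem lower_bound_critical:
  assumes crit: "real DIM('a) * p = real DIM('a) + 2 * \<alpha>" and \<beta>: "\<beta> * p = \<beta> + 1" "\<beta> > 0"
  shows "\<exists>c>0. \<exists>R. \<forall>x. norm x \<ge> R \<longrightarrow> c * norm x powr (- real DIM('a)) * ln (norm x) powr \<beta> \<le> U x"
proof -
  define q where "q = real DIM('a) + 2 * \<alpha>"
  let ?N = "real DIM('a)"
  have Np: "?N * p = q" using crit by (simp add: q_def)
  obtain r0 where r0: "r0 > 0" "mass U r0 > 0" using mass_pos by blast
  define M0 where "M0 = mass U r0"
  have M0: "M0 > 0" using r0 by (simp add: M0_def)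
  obtain k0 :: nat where k0: "r0 < 4 ^ k0" using real_arch_pow[of 4 r0] by auto
  obtain c C where c: "c > 0" "C > 0" "\<And>r x. r > 0 \<Longrightarrow> 4 * r \<le> norm x \<Longrightarrow> norm x \<le> 16 * r \<Longrightarrow>
    c * r powr (- q) * mass U r \<le> U x powr p + C * r powr (- 2 * \<alpha>) * U x"
    using positivity_step unfolding q_def by blast
  \<comment> \<open>For masses of at least \<open>M0\<close> the linear term of \<open>positivity_step\<close> is controlled by the mass itself.\<close>
  define D where "D = 1 + C * M0 powr (1 / p - 1)"
  have D: "D > 0" "C * M0 powr (1 / p - 1) \<ge> 0" using c by (auto simp: D_def add_pos_nonneg)
  define c1 where "c1 = min 1 (c / D)"
  have c1: "0 < c1" "c1 \<le> 1" "c1 * D \<le> c" using c D by (auto simp: c1_def min_def field_simps)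
  have ann: "c1 * r powr (- ?N) * mass U r powr (1 / p) \<le> U x"
    if r: "r \<ge> r0" and x: "4 * r \<le> norm x" "norm x \<le> 16 * r" for r x
  proof (rule ccontr)
    have rp: "r > 0" using r r0 by simp
    define M where "M = mass U r"
    have M: "M0 \<le> M" "M > 0" using mass_mono[OF U_w U_nonneg r] M0 by (auto simp: M_def M0_def)
    assume "\<not> c1 * r powr (- ?N) * mass U r powr (1 / p) \<le> U x"
    then have lt: "U x < c1 * r powr (- ?N) * M powr (1 / p)" by (simp add: M_def)
    have "U x powr p < (c1 * r powr (- ?N) * M powr (1 / p)) powr p"
      using lt U_nonneg[of x] p by (intro powr_less_mono2) auto
    also have "\<dots> = c1 powr p * (r powr (- q) * M)" using Np c1 M p by (simp add: powr_mult powr_powr)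
    also have "\<dots> \<le> c1 * (r powr (- q) * M)"
      using powr_mono'[of 1 p c1] p c1 M by (intro mult_right_mono) auto
    finally have a: "U x powr p < c1 * (r powr (- q) * M)" .
    have "M powr (1 / p) = M powr (1 / p - 1) * M" using M by (simp add: powr_diff)
    also have "\<dots> \<le> M0 powr (1 / p - 1) * M"
      using M M0 p by (intro mult_right_mono powr_mono2') auto
    finally have Mp: "M powr (1 / p) \<le> M0 powr (1 / p - 1) * M" .
    have "C * r powr (- 2 * \<alpha>) * U x \<le> C * r powr (- 2 * \<alpha>) * (c1 * r powr (- ?N) * M powr (1 / p))"
      using lt c by (intro mult_left_mono) auto
    also have "\<dots> = C * c1 * r powr (- q) * M powr (1 / p)"
    proof -
      have "r powr (- 2 * \<alpha>) * r powr (- ?N) = r powr (- q)" unfolding powr_add[symmetric] by (rule arg_cong[where f="(powr) r"]) (simp add: q_def)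
      then show ?thesis by (simp add: mult_ac)
    qed
    also have "\<dots> \<le> C * c1 * r powr (- q) * (M0 powr (1 / p - 1) * M)"
      using c c1 by (intro mult_left_mono Mp) auto
    finally have b: "C * r powr (- 2 * \<alpha>) * U x \<le> C * c1 * r powr (- q) * (M0 powr (1 / p - 1) * M)" .
    have "c * r powr (- q) * M \<le> U x powr p + C * r powr (- 2 * \<alpha>) * U x" unfolding M_def by (rule c(3)[OF rp x])
    also have "\<dots> < (c1 * D) * (r powr (- q) * M)" using a b by (simp add: D_def algebra_simps)
    also have "\<dots> \<le> c * (r powr (- q) * M)" using M c1(3) by (intro mult_right_mono) auto
    finally show False by simp
  qed
  define m where "m = (\<lambda>j::nat. mass U (4 ^ (k0 + j)))"
  have ge0: "r0 \<le> 4 ^ (k0 + j)" for j :: nat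
  proof -
    have "(4::real) ^ k0 \<le> 4 ^ (k0 + j)" by (rule power_increasing) auto
    then show ?thesis using k0 by linarith
  qed
  have m_ge: "M0 \<le> m j" for j unfolding m_def M0_def by (rule mass_mono[OF U_w U_nonneg ge0])
  define c2 where "c2 = c1 * unit_ball_vol (real DIM('a)) * (16 ^ DIM('a) - 4 ^ DIM('a))"
  have c2: "c2 > 0" unfolding c2_def using c1 by (intro mult_pos_pos) (auto simp: power_strict_mono)
  have rec: "m (Suc j) + c2 * m j powr (1 / p) \<le> m (Suc (Suc j))" for j
  proof -
    let ?r = "4 ^ (k0 + j) :: real"
    have "mass U (4 * ?r) + (c1 * ?r powr (- ?N) * mass U ?r powr (1 / p)) * unit_ball_vol (real DIM('a)) * ((16 * ?r) ^ DIM('a) - (4 * ?r) ^ DIM('a)) \<le> mass U (16 * ?r)"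
      by (rule mass_growth_lower) (auto intro!: ann ge0)
    moreover have "?r powr (- ?N) * ((16 * ?r) ^ DIM('a) - (4 * ?r) ^ DIM('a)) = 16 ^ DIM('a) - 4 ^ DIM('a)"
      by (simp add: power_mult_distrib powr_minus powr_realpow field_simps)
    then have "c1 * unit_ball_vol (real DIM('a)) * (?r powr (- ?N) * ((16 * ?r) ^ DIM('a) - (4 * ?r) ^ DIM('a))) * mass U ?r powr (1 / p)
      = c1 * unit_ball_vol (real DIM('a)) * (16 ^ DIM('a) - 4 ^ DIM('a)) * mass U ?r powr (1 / p)" by (simp only:)
    then have "(c1 * ?r powr (- ?N) * mass U ?r powr (1 / p)) * unit_ball_vol (real DIM('a)) * ((16 * ?r) ^ DIM('a) - (4 * ?r) ^ DIM('a)) = c2 * m j powr (1 / p)"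
      unfolding c2_def m_def by (simp only: mult_ac)
    ultimately have "mass U (4 * ?r) + c2 * m j powr (1 / p) \<le> mass U (16 * ?r)" by linarith
    then show ?thesis by (simp add: m_def)
  qed
  define \<gamma> where "\<gamma> = \<beta> + 1"
  have \<gamma>: "\<gamma> / p = \<beta>" "\<gamma> \<ge> 1" using \<beta> p by (auto simp: \<gamma>_def field_simps)
  define K where "K = \<gamma> * 3 powr \<beta>"
  have K: "K > 0" using \<gamma> by (simp add: K_def)
  \<comment> \<open>The first term starts the induction, the second makes the increment of \<open>a k powr \<gamma>\<close> smaller
    than what the recursion supplies.\<close>
  define a where "a = min (M0 / 2 powr \<gamma>) ((c2 / K) powr (p / (p - 1)))"
  have a: "a > 0" "a * 2 powr \<gamma> \<le> M0" "a \<le> (c2 / K) powr (p / (p - 1))"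
    using M0 c2 K p by (auto simp: a_def min_def field_simps)
  have aK: "a * K \<le> c2 * a powr (1 / p)"
  proof -
    have "a powr ((p - 1) / p) \<le> ((c2 / K) powr (p / (p - 1))) powr ((p - 1) / p)"
      using a p by (intro powr_mono2) auto
    also have "\<dots> = c2 / K" using p c2 K by (simp add: powr_powr)
    finally have "a powr ((p - 1) / p) * K \<le> c2" using K by (simp add: field_simps)
    then have "a powr ((p - 1) / p) * K * a powr (1 / p) \<le> c2 * a powr (1 / p)" by (intro mult_right_mono) auto
    moreover have "a powr ((p - 1) / p) * a powr (1 / p) = a"
      unfolding powr_add[symmetric] using p a by (simp add: add_divide_distrib[symmetric])
    ultimately show ?thesis by (simp add: mult_ac)
  qed
  have lower: "a * real (Suc j) powr \<gamma> \<le> m (Suc j) \<and> a * real (Suc (Suc j)) powr \<gamma> \<le> m (Suc (Suc j))" for j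
  proof (induction j)
    case 0
    have "a * 1 \<le> a * 2 powr \<gamma>" using a \<gamma> by (intro mult_left_mono ge_one_powr_ge_zero) auto
    then have "a \<le> M0" using a(2) by linarith
    then show ?case using m_ge[of 1] m_ge[of 2] a by (simp add: numeral_2_eq_2)
  next
    case (Suc j)
    let ?j = "real (Suc j)"
    have "a * (?j + 2) powr \<gamma> \<le> a * (?j + 1) powr \<gamma> + a * (\<gamma> * (?j + 2) powr \<beta>)"
      using mult_left_mono[OF powr_Suc_diff_le[of "?j + 1" \<gamma>], of a] a \<gamma> by (simp add: \<gamma>_def algebra_simps)
    also have "a * (\<gamma> * (?j + 2) powr \<beta>) \<le> a * K * ?j powr \<beta>"
    proof -
      have "(?j + 2) powr \<beta> \<le> (3 * ?j) powr \<beta>" using \<beta> by (intro powr_mono2) auto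
      also have "\<dots> = 3 powr \<beta> * ?j powr \<beta>" by (rule powr_mult)
      finally have "a * \<gamma> * ((?j + 2) powr \<beta>) \<le> a * \<gamma> * (3 powr \<beta> * ?j powr \<beta>)"
        using a(1) \<gamma>(2) by (intro mult_left_mono) auto
      then show ?thesis by (simp only: K_def mult.assoc)
    qed
    also have "a * K * ?j powr \<beta> \<le> c2 * a powr (1 / p) * ?j powr \<beta>" by (intro mult_right_mono aK) auto
    also have "c2 * a powr (1 / p) * ?j powr \<beta> = c2 * (a * ?j powr \<gamma>) powr (1 / p)"
      using a \<gamma> by (simp add: powr_mult powr_powr)
    also have "\<dots> \<le> c2 * m (Suc j) powr (1 / p)"
      using Suc a c2 p by (intro mult_left_mono powr_mono2) auto
    finally have "a * (?j + 2) powr \<gamma> \<le> a * (?j + 1) powr \<gamma> + c2 * m (Suc j) powr (1 / p)" by simp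
    also have "a * (?j + 1) powr \<gamma> \<le> m (Suc (Suc j))" using Suc by (simp add: algebra_simps)
    finally have "a * (?j + 2) powr \<gamma> \<le> m (Suc (Suc (Suc j)))" using rec[of "Suc j"] by linarith
    then show ?case using Suc by (simp add: algebra_simps)
  qed
  define c3 where "c3 = c1 * a powr (1 / p) / (2 * (real k0 + 3)) powr \<beta>"
  have c3: "c3 > 0" using c1 a by (simp add: c3_def)
  show ?thesis
  proof (rule exI[of _ c3], rule conjI[OF c3 exI[of _ "4 * 4 ^ (k0 + 1)"]], intro allI impI)
    fix x :: 'a assume x: "4 * 4 ^ (k0 + 1) \<le> norm x"
    then obtain k where k: "k \<ge> k0 + 2" "4 ^ k \<le> norm x" "norm x < 4 * 4 ^ k"
      using between_powers_of_4[of "k0 + 2" "norm x"] by auto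
    obtain j where j: "k = k0 + j + 1" "j \<ge> 1" using k(1) by (metis add.assoc add_leD2 le_Suc_ex nat_1_add_1 le_add1 one_add_one add.commute)
    let ?r = "4 ^ (k0 + j) :: real"
    have xr: "4 * ?r \<le> norm x" "norm x \<le> 16 * ?r" using k j by auto
    have "a * real j powr \<gamma> \<le> m j" using lower[of "j - 1"] j by (cases j) auto
    then have "(a * real j powr \<gamma>) powr (1 / p) \<le> mass U ?r powr (1 / p)"
      unfolding m_def using a p by (intro powr_mono2) auto
    then have A: "a powr (1 / p) * real j powr \<beta> \<le> mass U ?r powr (1 / p)"
      using a \<gamma> by (simp add: powr_mult powr_powr)
    have B: "norm x powr (- ?N) \<le> ?r powr (- ?N)"
    proof (rule powr_mono2')
      have "0 < ?r" by simp
      then show "?r \<le> norm x" using xr(1) by linarith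
    qed auto
    have ln4: "ln (4::real) \<le> 2"
    proof -
      have "(1 + 1::real) \<le> exp 1" by (rule exp_ge_add_one_self)
      then have "(2::real) ^ 2 \<le> exp 1 ^ 2" by (intro power_mono) auto
      then have "(4::real) \<le> exp 2" by (simp add: exp_double[symmetric] exp_of_nat_mult[symmetric] flip: exp_of_nat_mult)
      then have "ln (4::real) \<le> ln (exp 2)" by (subst ln_le_cancel_iff) auto
      then show ?thesis by simp
    qed
    have nx: "1 \<le> norm x" using xr one_le_power[of "4::real" "k0 + j"] by linarith
    have "ln (norm x) \<le> ln (4 ^ (k0 + j + 2))" using xr nx by (subst ln_le_cancel_iff) auto
    also have "\<dots> = real (k0 + j + 2) * ln 4" by (rule ln_realpow)
    also have "\<dots> \<le> real (k0 + j + 2) * 2" by (intro mult_left_mono ln4) auto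
    also have "\<dots> \<le> (2 * (real k0 + 3)) * real j"
    proof -
      have "1 \<le> real j" using j by simp
      moreover from this have "real k0 * 1 \<le> real k0 * real j" by (rule mult_left_mono) simp
      ultimately show ?thesis by (simp add: algebra_simps)
    qed
    finally have "ln (norm x) powr \<beta> \<le> ((2 * (real k0 + 3)) * real j) powr \<beta>"
      using nx \<beta> by (intro powr_mono2) auto
    then have Cc: "ln (norm x) powr \<beta> \<le> (2 * (real k0 + 3)) powr \<beta> * real j powr \<beta>" by (simp add: powr_mult)
    have "c3 * norm x powr (- ?N) * ln (norm x) powr \<beta> \<le> c3 * ?r powr (- ?N) * ((2 * (real k0 + 3)) powr \<beta> * real j powr \<beta>)"
      using c3 B Cc by (intro mult_mono) auto
    also have "\<dots> = c1 * ?r powr (- ?N) * (a powr (1 / p) * real j powr \<beta>)" by (simp add: c3_def)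
    also have "\<dots> \<le> c1 * ?r powr (- ?N) * mass U ?r powr (1 / p)" using A c1 by (intro mult_left_mono) auto
    also have "\<dots> \<le> U x" by (rule ann[OF ge0 xr])
    finally show "c3 * norm x powr (- ?N) * ln (norm x) powr \<beta> \<le> U x" .
  qed
qed

end

section \<open>The Riesz kernel\<close>

lemma reflection_swap:
  fixes x y :: "'a::euclidean_space"
  assumes "norm x = norm y"
  obtains T where "orthogonal_transformation T" "T x = y"
proof (cases "x = y")
  case True
  then show ?thesis by (intro that[of id]) (auto simp: orthogonal_transformation_def id_def linear_id[unfolded id_def])
next
  case False
  define n where "n = x - y"
  define T where "T = (\<lambda>z. z - (2 * (z \<bullet> n) / (n \<bullet> n)) *\<^sub>R n)"
  have n: "n \<bullet> n \<noteq> 0" using False by (simp add: n_def)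
  have "linear T"
    unfolding T_def by (rule linearI) (simp_all add: inner_left_distrib algebra_simps add_divide_distrib)
  moreover have "T v \<bullet> T w = v \<bullet> w" for v w
  proof -
    have "T v \<bullet> T w = v \<bullet> w - 2 * (w \<bullet> n) / (n \<bullet> n) * (v \<bullet> n) - 2 * (v \<bullet> n) / (n \<bullet> n) * (n \<bullet> w)
        + (2 * (v \<bullet> n) / (n \<bullet> n)) * (2 * (w \<bullet> n) / (n \<bullet> n)) * (n \<bullet> n)"
      unfolding T_def by (simp add: inner_diff_left inner_diff_right)
    also have "\<dots> = v \<bullet> w" using n by (simp add: inner_commute[of n w])
    finally show ?thesis .
  qed
  ultimately have "orthogonal_transformation T" unfolding orthogonal_transformation_def by blast
  moreover have "T x = y"
  proof -
    have xx: "x \<bullet> x = y \<bullet> y" using assms by (simp add: power2_norm_eq_inner[symmetric])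
    have "n \<bullet> n = 2 * (x \<bullet> n)" unfolding n_def by (simp add: inner_diff_left inner_diff_right inner_commute xx)
    then have "2 * (x \<bullet> n) / (n \<bullet> n) = 1" using n by simp
    then have "T x = x - 1 *\<^sub>R n" unfolding T_def by (simp only:)
    then show ?thesis by (simp add: n_def)
  qed
  ultimately show ?thesis by (rule that)
qed

lemma lborel_integral_orthogonal:
  fixes f :: "'a::euclidean_space \<Rightarrow> real" and T :: "'a \<Rightarrow> 'a"
  assumes T: "orthogonal_transformation T" and [measurable]: "f \<in> borel_measurable borel"
  shows "(\<integral>x. f (T x) \<partial>lborel) = (\<integral>x. f x \<partial>lborel)"
proof -
  have "continuous_on UNIV T" using orthogonal_transformation_linear[OF T] by (simp add: linear_continuous_on linear_linear)
  then have [measurable]: "T \<in> borel \<rightarrow>\<^sub>M borel" by (rule borel_measurable_continuous_onI)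
  have "(\<integral>x. f x \<partial>lborel) = (\<integral>x. f x \<partial>distr lborel borel T)" using lborel_distr_orthogonal[OF T] by simp
  also have "\<dots> = (\<integral>x. f (T x) \<partial>lborel)" by (rule integral_distr) auto
  finally show ?thesis by simp
qed

text \<open>Taylor expansion of order two, with the second derivative, which is decreasing, taken at the left
  end of the admissible range.\<close>

lemma powr_taylor_bound:
  fixes s \<delta> a :: real
  assumes s: "s > 0" and d: "s / 4 \<le> s + \<delta>" and a: "a > 0"
  shows "\<bar>(s + \<delta>) powr (- a) - s powr (- a) - (- a * s powr (- a - 1)) * \<delta>\<bar> \<le> (a * (a + 1) * (s / 4) powr (- a - 2)) * \<delta>\<^sup>2"
proof (cases "\<delta> = 0")
  case False
  define diff where "diff = (\<lambda>m::nat. if m = 0 then (\<lambda>t. t powr (- a)) else if m = 1 then (\<lambda>t. - a * t powr (- a - 1))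
     else (\<lambda>t::real. a * (a + 1) * t powr (- a - 2)))"
  let ?x = "s + \<delta>"
  let ?lo = "min s ?x" and ?hi = "max s ?x"
  have lo: "?lo \<ge> s / 4" using s d by auto
  have "\<exists>t. (if ?x < s then ?x < t \<and> t < s else s < t \<and> t < ?x) \<and>
    ?x powr (- a) = (\<Sum>m<2. diff m s / fact m * (?x - s)^m) + diff 2 t / fact 2 * (?x - s)^2"
  proof (rule Taylor[where a="?lo" and b="?hi"])
    show "\<forall>m t. m < 2 \<and> ?lo \<le> t \<and> t \<le> ?hi \<longrightarrow> DERIV (diff m) t :> diff (Suc m) t"
    proof (intro allI impI)
      fix m :: nat and t assume mt: "m < 2 \<and> ?lo \<le> t \<and> t \<le> ?hi"
      then have t: "t > 0" using lo s by linarith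
      have "m = 0 \<or> m = 1" using mt by auto
      then show "DERIV (diff m) t :> diff (Suc m) t"
      proof
        assume "m = 0"
        then show ?thesis using t unfolding diff_def by (auto intro!: derivative_eq_intros)
      next
        assume "m = 1"
        then show ?thesis using t unfolding diff_def
          by (auto intro!: derivative_eq_intros simp: algebra_simps)
      qed
    qed
  qed (use False in \<open>auto simp: diff_def\<close>)
  then obtain t where t0: "if ?x < s then ?x < t \<and> t < s else s < t \<and> t < ?x" and t1: "?x powr (- a) = (\<Sum>m<2. diff m s / fact m * (?x - s)^m) + diff 2 t / fact 2 * (?x - s)^2"
    by blast
  have t: "?lo \<le> t" using t0 by (auto split: if_splits)
  have eq: "?x powr (- a) - s powr (- a) - (- a * s powr (- a - 1)) * \<delta> = a * (a + 1) * t powr (- a - 2) / 2 * \<delta>\<^sup>2"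
    unfolding t1 by (simp add: diff_def numeral_2_eq_2)
  have "t powr (- a - 2) \<le> (s / 4) powr (- a - 2)" using t lo s a by (intro powr_mono2') auto
  then have "a * (a + 1) * t powr (- a - 2) / 2 \<le> a * (a + 1) * (s / 4) powr (- a - 2)"
    using mult_left_mono[of "t powr (- a - 2) / 2" "(s / 4) powr (- a - 2)" "a * (a + 1)"] a
      powr_ge_zero[of t "- a - 2"] by (simp del: powr_ge_zero)
  then have X: "a * (a + 1) * t powr (- a - 2) / 2 * \<delta>\<^sup>2 \<le> a * (a + 1) * (s / 4) powr (- a - 2) * \<delta>\<^sup>2"
    by (rule mult_right_mono) simp
  have "0 \<le> a * (a + 1) * t powr (- a - 2) / 2" using a by simp
  then have "0 \<le> a * (a + 1) * t powr (- a - 2) / 2 * \<delta>\<^sup>2" by (rule mult_nonneg_nonneg) simp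
  then show ?thesis unfolding eq using X by (simp only: abs_of_nonneg)
qed (use a in simp)

text \<open>Convexity of the power in quantitative form: the gap above the tangent at 1 is nonnegative, and
  beyond \<open>a\<close> at least the positive gap at \<open>a\<close>.\<close>

lemma powr_above_tangent:
  fixes s t :: real
  assumes s: "s > 1"
  shows "0 \<le> t \<Longrightarrow> 1 + s * (t - 1) \<le> t powr s"
    and "1 < a \<Longrightarrow> a \<le> t \<Longrightarrow> a powr s - 1 - s * (a - 1) \<le> t powr s - 1 - s * (t - 1)"
    and "1 < a \<Longrightarrow> 0 < a powr s - 1 - s * (a - 1)"
proof -
  define g where "g = (\<lambda>t::real. t powr s - 1 - s * (t - 1))"
  have g: "\<exists>z>a. z < b \<and> g b - g a = (b - a) * (s * z powr (s - 1) - s)" if "0 < a" "a < b" for a b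
    unfolding g_def using that by (intro MVT2) (auto intro!: derivative_eq_intros)
  have up: "0 < s * z powr (s - 1) - s" if "1 < z" for z
    using s powr_less_mono2[of "s - 1" 1 z] that by simp
  have down: "s * z powr (s - 1) - s < 0" if "0 < z" "z < 1" for z
    using s powr_less_mono2[of "s - 1" z 1] that by simp
  show mono: "1 < a \<Longrightarrow> a \<le> t \<Longrightarrow> a powr s - 1 - s * (a - 1) \<le> t powr s - 1 - s * (t - 1)"
  proof (cases "a = t")
    case False
    assume a: "1 < a" "a \<le> t"
    then obtain z where z: "a < z" "g t - g a = (t - a) * (s * z powr (s - 1) - s)" using g[of a t] False by auto
    then have "0 \<le> g t - g a" using a up[of z] by simp
    then show ?thesis by (simp add: g_def)
  qed simp
  show pos: "0 < a powr s - 1 - s * (a - 1)" if a1: "1 < a" for a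
  proof -
    obtain z where z: "1 < z" "g a - g 1 = (a - 1) * (s * z powr (s - 1) - s)" using g[of 1 a] a1 by auto
    then have "0 < g a - g 1" using a1 up[of z] by simp
    then show ?thesis by (simp add: g_def)
  qed
  show "1 + s * (t - 1) \<le> t powr s" if t0: "0 \<le> t"
  proof -
    consider "t = 0" | "0 < t" "t < 1" | "t = 1" | "1 < t" using t0 by linarith
    then show ?thesis
    proof cases
      case 2
      then obtain z where z: "t < z" "z < 1" "g 1 - g t = (1 - t) * (s * z powr (s - 1) - s)" using g[of t 1] by auto
      then have "g 1 - g t \<le> 0" using 2 down[of z] by (simp add: mult_nonneg_nonpos)
      then show ?thesis by (simp add: g_def)
    qed (use s pos[of t] in auto)
  qed
qed

context fractional_order
begin

text \<open>Up to a constant, the fundamental solution of the operator.\<close>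

definition riesz :: "'a::euclidean_space \<Rightarrow> real" where
  "riesz x = norm x powr (- (real DIM('a) - 2 * \<alpha>))"

lemma riesz_nonneg [simp]: "0 \<le> riesz x"
  by (simp add: riesz_def)

lemma riesz_measurable [measurable]: "(riesz :: 'a::euclidean_space \<Rightarrow> real) \<in> borel_measurable borel"
  unfolding riesz_def by measurable

lemma riesz_scale:
  fixes x :: "'a::euclidean_space"
  assumes "c > 0" shows "riesz (c *\<^sub>R x) = c powr (- (real DIM('a) - 2 * \<alpha>)) * riesz x"
  using assms by (simp add: riesz_def powr_mult)

lemma integrable_riesz_ball: "integrable lborel (\<lambda>x::'a::euclidean_space. indicator (cball 0 R) x * riesz x)"
  unfolding riesz_def by (rule integrable_norm_powr_cball) (use alpha in auto)

lemma riesz_le_1: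
  fixes x :: "'a::euclidean_space"
  assumes "2 * \<alpha> < real DIM('a)" "1 \<le> norm x" shows "riesz x \<le> 1"
  unfolding riesz_def using assms powr_mono[of "- (real DIM('a) - 2 * \<alpha>)" 0 "norm x"] by (cases "x = 0") auto

lemma riesz_le_split:
  fixes x :: "'a::euclidean_space"
  assumes "2 * \<alpha> < real DIM('a)" shows "riesz x \<le> indicator (cball 0 1) x * riesz x + 1"
  using riesz_le_1[OF assms, of x] by (cases "norm x \<le> 1") auto

lemma weighted_riesz:
  assumes d: "2 * \<alpha> < real DIM('a::euclidean_space)"
  shows "weighted (riesz :: 'a \<Rightarrow> real)"
proof -
  have "integrable lborel (\<lambda>x::'a. riesz x * wgt \<alpha> x)"
  proof (rule Bochner_Integration.integrable_bound)
    show "integrable lborel (\<lambda>x::'a. indicator (cball 0 1) x * riesz x + wgt \<alpha> x)"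
      by (intro Bochner_Integration.integrable_add integrable_riesz_ball integrable_wgt)
    have "riesz x * wgt \<alpha> x \<le> indicator (cball 0 1) x * riesz x + wgt \<alpha> x" for x :: 'a
    proof -
      have w: "0 < wgt \<alpha> x" "wgt \<alpha> x \<le> 1" by (rule wgt_pos wgt_le_1)+
      have "riesz x * wgt \<alpha> x \<le> (indicator (cball 0 1) x * riesz x + 1) * wgt \<alpha> x"
        using w by (intro mult_right_mono riesz_le_split d) auto
      also have "\<dots> \<le> indicator (cball 0 1) x * riesz x + wgt \<alpha> x"
        using w mult_left_le[of "wgt \<alpha> x" "indicator (cball 0 1) x * riesz x"] by (simp add: distrib_right)
      finally show ?thesis .
    qed
    moreover have "0 \<le> wgt \<alpha> x" for x :: 'a using wgt_pos[of \<alpha> x] by simp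
    ultimately show "AE x in lborel. norm (riesz x * wgt \<alpha> x) \<le> norm (indicator (cball 0 1) x * riesz x + wgt \<alpha> (x::'a))"
      by (intro AE_I2) (simp add: abs_of_nonneg)
  qed measurable
  then show ?thesis by (simp add: weighted_def)
qed

lemma riesz_tkern:
  assumes d: "2 * \<alpha> < real DIM('a::euclidean_space)" and e: "\<epsilon> > 0"
  shows "integrable lborel (\<lambda>h::'a. riesz (x + h) * tkern \<alpha> \<epsilon> h)"
    and "(\<integral>h. riesz (x + h) * tkern \<alpha> \<epsilon> (h::'a) \<partial>lborel) \<le>
       \<epsilon> powr (- (real DIM('a) + 2 * \<alpha>)) * (\<integral>y. indicator (cball 0 1) y * riesz (y::'a) \<partial>lborel) + (\<integral>h. tkern \<alpha> \<epsilon> (h::'a) \<partial>lborel)"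
proof -
  let ?k = "\<epsilon> powr (- (real DIM('a) + 2 * \<alpha>))"
  let ?F = "\<lambda>y::'a. indicator (cball 0 1) y * riesz y"
  have i1: "integrable lborel (\<lambda>h. ?F (x + h))" "(\<integral>h. ?F (x + h) \<partial>lborel) = (\<integral>h. ?F h \<partial>lborel)"
    using lborel_integral_shift[of ?F x] integrable_riesz_ball[of 1] by (simp_all add: add.commute)
  have i: "integrable lborel (\<lambda>h. ?k * ?F (x + h) + tkern \<alpha> \<epsilon> h)"
    by (intro Bochner_Integration.integrable_add integrable_mult_right i1 integrable_tkern e)
  have tk: "tkern \<alpha> \<epsilon> h \<le> ?k" for h :: 'a
    unfolding tkern_def kern_def using e frac_order_dim_pos[where 'a='a] by (auto intro!: powr_mono2')
  have le: "riesz (x + h) * tkern \<alpha> \<epsilon> h \<le> ?k * ?F (x + h) + tkern \<alpha> \<epsilon> h" for h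
  proof -
    have "riesz (x + h) * tkern \<alpha> \<epsilon> h \<le> (?F (x + h) + 1) * tkern \<alpha> \<epsilon> h"
      by (intro mult_right_mono riesz_le_split d) simp
    also have "\<dots> \<le> ?F (x + h) * ?k + tkern \<alpha> \<epsilon> h"
      using mult_left_mono[OF tk[of h], of "?F (x + h)"] by (simp add: distrib_right)
    finally show ?thesis by (simp add: mult.commute)
  qed
  show j: "integrable lborel (\<lambda>h::'a. riesz (x + h) * tkern \<alpha> \<epsilon> h)"
    by (rule Bochner_Integration.integrable_bound[OF i])
       (use le in \<open>auto intro!: AE_I2 simp: abs_of_nonneg intro: order_trans[OF _ abs_ge_self]\<close>)
  have "(\<integral>h. riesz (x + h) * tkern \<alpha> \<epsilon> (h::'a) \<partial>lborel) \<le> (\<integral>h. ?k * ?F (x + h) + tkern \<alpha> \<epsilon> h \<partial>lborel)"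
    by (rule integral_mono[OF j i le])
  also have "\<dots> = ?k * (\<integral>h. ?F h \<partial>lborel) + (\<integral>h. tkern \<alpha> \<epsilon> (h::'a) \<partial>lborel)"
    using i1 by (subst Bochner_Integration.integral_add) (auto intro: integrable_tkern e)
  finally show "(\<integral>h. riesz (x + h) * tkern \<alpha> \<epsilon> (h::'a) \<partial>lborel) \<le> ?k * (\<integral>y. ?F y \<partial>lborel) + (\<integral>h. tkern \<alpha> \<epsilon> (h::'a) \<partial>lborel)" .
qed

lemma riesz_sdiff_local:
  fixes x :: "'a::euclidean_space"
  assumes d: "2 * \<alpha> < real DIM('a)" and x: "x \<noteq> 0"
  shows "\<exists>C. \<forall>h. norm h \<le> norm x / 2 \<longrightarrow> \<bar>sdiff riesz x h\<bar> \<le> C * (norm h)\<^sup>2"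
proof -
  define a where "a = (real DIM('a) - 2 * \<alpha>) / 2"
  have a: "a > 0" using d by (simp add: a_def)
  define \<phi> where "\<phi> = (\<lambda>s::real. s powr (- a))"
  have r: "riesz = (\<lambda>y::'a. \<phi> ((norm y)\<^sup>2))"
  proof
    fix y :: 'a
    have "(norm y)\<^sup>2 powr (- a) = norm y powr (2 * (- a))"
    proof (cases "y = 0")
      case False
      then have "(norm y)\<^sup>2 = norm y powr 2" by simp
      then show ?thesis by (simp only: powr_powr)
    qed simp
    moreover have "2 * (- a) = - (real DIM('a) - 2 * \<alpha>)" by (simp add: a_def field_simps)
    ultimately show "riesz y = \<phi> ((norm y)\<^sup>2)" by (simp only: riesz_def \<phi>_def)
  qed
  let ?s = "(norm x)\<^sup>2"
  have s: "?s > 0" using x by simp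
  define A where "A = a * (a + 1) * (?s / 4) powr (- a - 2)"
  define D where "D = - a * ?s powr (- a - 1)"
  have A: "A \<ge> 0" using a by (simp add: A_def)
  show ?thesis
  proof (intro exI allI impI)
    fix h :: 'a assume h: "norm h \<le> norm x / 2"
    have m: "?s / 4 \<le> (norm (x + k))\<^sup>2" if "norm k \<le> norm x / 2" for k
    proof -
      have "norm x / 2 \<le> norm (x + k)" using that norm_diff_ineq[of x k] by linarith
      then have "(norm x / 2)\<^sup>2 \<le> (norm (x + k))\<^sup>2" by (intro power_mono) auto
      then show ?thesis by (simp add: power_divide)
    qed
    have "\<bar>sdiff (\<lambda>y. \<phi> ((norm y)\<^sup>2)) x h\<bar> \<le> 2 * \<bar>D\<bar> * (norm h)\<^sup>2 + 2 * A * (2 * norm x * norm h + (norm h)\<^sup>2)\<^sup>2"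
    proof (rule sdiff_radial[where m="?s / 4"])
      show "?s / 4 \<le> (norm (x + h))\<^sup>2" by (rule m[OF h])
      show "?s / 4 \<le> (norm (x - h))\<^sup>2" using m[of "- h"] h by simp
      fix \<delta> :: real assume "- ?s + ?s / 4 \<le> \<delta>"
      then have "?s / 4 \<le> ?s + \<delta>" by simp
      then show "\<bar>\<phi> (?s + \<delta>) - \<phi> ?s - D * \<delta>\<bar> \<le> A * \<delta>\<^sup>2"
        unfolding \<phi>_def D_def A_def by (rule powr_taylor_bound[OF s _ a])
    qed (rule A)
    also have "\<dots> \<le> 2 * \<bar>D\<bar> * (norm h)\<^sup>2 + 2 * A * (3 * norm x * norm h)\<^sup>2"
    proof -
      have "norm h \<le> norm x" using h norm_ge_zero[of x] by linarith
      then have "norm h * norm h \<le> norm x * norm h" by (rule mult_right_mono) simp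
      then have "2 * norm x * norm h + (norm h)\<^sup>2 \<le> 3 * norm x * norm h" unfolding power2_eq_square by linarith
      then show ?thesis using A by (intro add_left_mono mult_left_mono power_mono) auto
    qed
    also have "\<dots> = (2 * \<bar>D\<bar> + 18 * A * (norm x)\<^sup>2) * (norm h)\<^sup>2" by (simp add: power_mult_distrib algebra_simps)
    finally show "\<bar>sdiff riesz x h\<bar> \<le> (2 * \<bar>D\<bar> + 18 * A * (norm x)\<^sup>2) * (norm h)\<^sup>2" unfolding r .
  qed
qed

lemma integrable_riesz_sdiff:
  fixes x :: "'a::euclidean_space"
  assumes d: "2 * \<alpha> < real DIM('a)" and x: "x \<noteq> 0"
  shows "integrable lborel (\<lambda>h. sdiff riesz x h * kern \<alpha> h)"
proof -
  obtain C where C: "\<And>h. norm h \<le> norm x / 2 \<Longrightarrow> \<bar>sdiff riesz x h\<bar> \<le> C * (norm h)\<^sup>2"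
    using riesz_sdiff_local[OF d x] by blast
  let ?\<rho> = "norm x / 2"
  have \<rho>: "?\<rho> > 0" using x by simp
  have p: "integrable lborel (\<lambda>h. riesz (x + h) * tkern \<alpha> ?\<rho> h)" by (rule riesz_tkern(1)[OF d \<rho>])
  have mi: "integrable lborel (\<lambda>h. riesz (x - h) * tkern \<alpha> ?\<rho> h)"
    using lborel_integral_minus(2)[of "\<lambda>h. riesz (x + h) * tkern \<alpha> ?\<rho> h"] p by simp
  have co: "integrable lborel (\<lambda>h. (2 * riesz x) * tkern \<alpha> ?\<rho> h)" by (intro integrable_mult_right integrable_tkern \<rho>)
  have far: "integrable lborel (\<lambda>h. sdiff riesz x h * tkern \<alpha> ?\<rho> h)"
    using Bochner_Integration.integrable_diff[OF Bochner_Integration.integrable_add[OF p mi] co]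
    by (simp add: sdiff_def left_diff_distrib distrib_right)
  have near: "integrable lborel (\<lambda>h. (\<bar>C\<bar> * ?\<rho>\<^sup>2) * (min 1 ((norm h / ?\<rho>)\<^sup>2) * kern \<alpha> h))"
    by (intro integrable_mult_right min_kern_scaled \<rho>)
  show ?thesis
  proof (rule Bochner_Integration.integrable_bound[OF Bochner_Integration.integrable_add[OF near integrable_abs[OF far]]])
    show "(\<lambda>h. sdiff riesz x h * kern \<alpha> h) \<in> borel_measurable lborel" unfolding sdiff_def by measurable
    show "AE h in lborel. norm (sdiff riesz x h * kern \<alpha> h) \<le> norm ((\<bar>C\<bar> * ?\<rho>\<^sup>2) * (min 1 ((norm h / ?\<rho>)\<^sup>2) * kern \<alpha> h) + \<bar>sdiff riesz x h * tkern \<alpha> ?\<rho> h\<bar>)"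
    proof (rule AE_I2)
      fix h :: 'a
      have n: "0 \<le> (\<bar>C\<bar> * ?\<rho>\<^sup>2) * (min 1 ((norm h / ?\<rho>)\<^sup>2) * kern \<alpha> h)" by simp
      have "\<bar>sdiff riesz x h * kern \<alpha> h\<bar> \<le> (\<bar>C\<bar> * ?\<rho>\<^sup>2) * (min 1 ((norm h / ?\<rho>)\<^sup>2) * kern \<alpha> h) + \<bar>sdiff riesz x h * tkern \<alpha> ?\<rho> h\<bar>"
      proof (cases "norm h \<le> ?\<rho>")
        case True
        have "(norm h / ?\<rho>)\<^sup>2 \<le> 1" using True \<rho> by (intro power_le_one) auto
        then have "min 1 ((norm h / ?\<rho>)\<^sup>2) = (norm h)\<^sup>2 / ?\<rho>\<^sup>2" by (simp add: power_divide)
        then have e: "(\<bar>C\<bar> * ?\<rho>\<^sup>2) * (min 1 ((norm h / ?\<rho>)\<^sup>2) * kern \<alpha> h) = \<bar>C\<bar> * (norm h)\<^sup>2 * kern \<alpha> h" using \<rho> x by simp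
        have "\<bar>sdiff riesz x h\<bar> \<le> \<bar>C\<bar> * (norm h)\<^sup>2"
          using C[OF True] mult_right_mono[OF abs_ge_self[of C], of "(norm h)\<^sup>2"] by simp
        then have "\<bar>sdiff riesz x h * kern \<alpha> h\<bar> \<le> \<bar>C\<bar> * (norm h)\<^sup>2 * kern \<alpha> h"
          by (simp add: abs_mult mult_right_mono)
        then show ?thesis unfolding e by linarith
      next
        case False
        then have "tkern \<alpha> ?\<rho> h = kern \<alpha> h" by (simp add: tkern_def)
        then show ?thesis using n by simp
      qed
      then show "norm (sdiff riesz x h * kern \<alpha> h) \<le> norm ((\<bar>C\<bar> * ?\<rho>\<^sup>2) * (min 1 ((norm h / ?\<rho>)\<^sup>2) * kern \<alpha> h) + \<bar>sdiff riesz x h * tkern \<alpha> ?\<rho> h\<bar>)"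
        unfolding real_norm_def by linarith
    qed
  qed
qed

lemma riesz_levy_op:
  fixes x :: "'a::euclidean_space"
  assumes d: "2 * \<alpha> < real DIM('a)" and x: "x \<noteq> 0"
  shows "((\<lambda>\<epsilon>. levy_op \<alpha> \<epsilon> riesz x) \<longlongrightarrow> levy_lim riesz x) (at_right 0)"
    and "\<epsilon> > 0 \<Longrightarrow> \<bar>levy_op \<alpha> \<epsilon> riesz x\<bar> \<le> (\<integral>h. \<bar>sdiff riesz x h\<bar> * kern \<alpha> h \<partial>lborel)"
proof -
  show "((\<lambda>\<epsilon>. levy_op \<alpha> \<epsilon> riesz x) \<longlongrightarrow> levy_lim riesz x) (at_right 0)"
    unfolding levy_lim_def by (rule levy_op_tendsto[OF riesz_tkern(1)[OF d] integrable_riesz_sdiff[OF d x]])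
  assume e: "\<epsilon> > 0"
  have "\<bar>I / 2\<bar> \<le> J" if "\<bar>I\<bar> \<le> J" for I J :: real using that by linarith
  then show "\<bar>levy_op \<alpha> \<epsilon> riesz x\<bar> \<le> (\<integral>h. \<bar>sdiff riesz x h\<bar> * kern \<alpha> h \<partial>lborel)"
    unfolding levy_op_eq_sdiff[OF e riesz_tkern(1)[OF d e]] using integral_tkern_bound[OF integrable_riesz_sdiff[OF d x]] .
qed

text \<open>Dilations and reflections act transitively on the complement of the origin and transform second
  differences of the kernel by a factor. With the identity for \<open>\<Phi>\<close> this gives the shape of the limit
  operator on the kernel, with the absolute value a majorant for the truncations.\<close>

lemma riesz_homogeneous:
  fixes \<Phi> :: "real \<Rightarrow> real" and x y :: "'a::euclidean_space"
  assumes \<Phi>: "\<And>c t. c > 0 \<Longrightarrow> \<Phi> (c * t) = c * \<Phi> t" and [measurable]: "\<Phi> \<in> borel_measurable borel"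
    and x: "x \<noteq> 0" and y: "norm y = 1"
  shows "(\<integral>h. \<Phi> (sdiff riesz x h) * kern \<alpha> h \<partial>lborel) = (\<integral>h. \<Phi> (sdiff riesz y h) * kern \<alpha> h \<partial>lborel) * norm x powr (- real DIM('a))"
proof -
  define c where "c = norm x"
  have c: "c > 0" using x by (simp add: c_def)
  define z where "z = x /\<^sub>R c"
  have z: "norm y = norm z" "x = c *\<^sub>R z" using c y by (simp_all add: z_def c_def)
  let ?J = "\<lambda>x. \<integral>h. \<Phi> (sdiff riesz x h) * kern \<alpha> h \<partial>lborel"
  have sm: "(\<lambda>h. \<Phi> (sdiff riesz x h) * kern \<alpha> h) \<in> borel_measurable borel" for x :: 'a unfolding sdiff_def by measurable
  have sc: "sdiff riesz (c *\<^sub>R z) (c *\<^sub>R h) = c powr (- (real DIM('a) - 2 * \<alpha>)) * sdiff riesz z h" for h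
    unfolding sdiff_scale[symmetric] by (simp add: sdiff_def riesz_scale[OF c] algebra_simps)
  have "?J x / c ^ DIM('a) = (\<integral>h. \<Phi> (sdiff riesz x (c *\<^sub>R h)) * kern \<alpha> (c *\<^sub>R h) \<partial>lborel)"
    using lborel_integral_scale(1)[of c "\<lambda>h. \<Phi> (sdiff riesz x h) * kern \<alpha> h"] c by simp
  also have "\<dots> = (\<integral>h. (c powr (- (real DIM('a) - 2 * \<alpha>)) * c powr (- (real DIM('a) + 2 * \<alpha>))) * (\<Phi> (sdiff riesz z h) * kern \<alpha> h) \<partial>lborel)"
  proof -
    have "0 < c powr (- (real DIM('a) - 2 * \<alpha>))" using c by simp
    then show ?thesis unfolding z(2) sc \<Phi>[OF \<open>0 < c powr _\<close>] kern_scale[OF c] by (simp only: mult_ac)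
  qed
  also have "\<dots> = (c powr (- (real DIM('a) - 2 * \<alpha>)) * c powr (- (real DIM('a) + 2 * \<alpha>))) * ?J z" by simp
  also have "c powr (- (real DIM('a) - 2 * \<alpha>)) * c powr (- (real DIM('a) + 2 * \<alpha>)) = c powr (- real DIM('a)) / c ^ DIM('a)"
    using c by (simp add: powr_add[symmetric] powr_realpow[symmetric] powr_diff[symmetric] powr_minus_divide[symmetric] divide_inverse powr_minus[symmetric] del: powr_realpow')
  finally have 1: "?J x = c powr (- real DIM('a)) * ?J z" using c by simp
  obtain T where T: "orthogonal_transformation T" "T y = z" using reflection_swap[OF z(1)] .
  have lin: "linear T" by (rule orthogonal_transformation_linear[OF T(1)])
  have nT: "norm (T v) = norm v" for v by (rule orthogonal_transformation_norm[OF T(1)])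
  have "?J z = (\<integral>h. \<Phi> (sdiff riesz (T y) (T h)) * kern \<alpha> (T h) \<partial>lborel)"
    using lborel_integral_orthogonal[OF T(1) sm] T(2) by simp
  also have "\<dots> = ?J y"
    by (simp add: sdiff_def riesz_def kern_def nT linear_add[OF lin, symmetric] linear_diff[OF lin, symmetric])
  finally show ?thesis using 1 by (simp add: c_def mult.commute)
qed

lemma levy_lim_diff:
  assumes "c11_supported f" "c11_supported g"
  shows "levy_lim (\<lambda>x. f x - g x) x = levy_lim f x - levy_lim g x"
proof -
  have i: "integrable lborel (\<lambda>h. sdiff f x h * kern \<alpha> h)" if f: "c11_supported f" for f :: "'b::euclidean_space \<Rightarrow> real" and x
  proof -
    obtain B D where *: "\<And>x. \<bar>f x\<bar> \<le> B" "\<And>x h. \<bar>sdiff f x h\<bar> \<le> D * min 1 ((norm h)\<^sup>2)" "f \<in> borel_measurable borel"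
      using c11_supportedD[OF f] by metis
    show ?thesis by (rule levy_op_bound(1)[OF *(3,1), of 1 x D]) (use *(2) in auto)
  qed
  have "sdiff (\<lambda>x. f x - g x) x h * kern \<alpha> h = sdiff f x h * kern \<alpha> h - sdiff g x h * kern \<alpha> h" for h
    by (simp add: sdiff_def algebra_simps)
  then show ?thesis unfolding levy_lim_def using Bochner_Integration.integral_diff[OF i[OF assms(1), of x] i[OF assms(2), of x]]
    by (simp add: diff_divide_distrib)
qed

lemma levy_lim_scale:
  fixes f :: "'a::euclidean_space \<Rightarrow> real"
  assumes c: "c > 0" and f: "c11_supported f" "c11_supported (\<lambda>x. f (c *\<^sub>R x))"
  shows "levy_lim (\<lambda>x. f (c *\<^sub>R x)) x = c powr (2 * \<alpha>) * levy_lim f (c *\<^sub>R x)"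
proof (rule tendsto_unique[OF _ levy_op_tendsto_levy_lim[OF f(2)]])
  have "((\<lambda>\<epsilon>. c powr (2 * \<alpha>) * levy_op \<alpha> (c * \<epsilon>) f (c *\<^sub>R x)) \<longlongrightarrow> c powr (2 * \<alpha>) * levy_lim f (c *\<^sub>R x)) (at_right 0)"
  proof (intro tendsto_mult tendsto_const filterlim_compose[OF levy_op_tendsto_levy_lim[OF f(1)]])
    show "filterlim ((*) c) (at_right 0) (at_right 0)"
      unfolding filterlim_at
    proof
      show "\<forall>\<^sub>F x in at_right 0. c * x \<in> {0<..} \<and> c * x \<noteq> 0"
        using eventually_at_right_less[of "0::real"] by eventually_elim (use c in auto)
      show "((*) c \<longlongrightarrow> 0) (at_right 0)" by (auto intro!: tendsto_eq_intros)
    qed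
  qed
  then show "((\<lambda>\<epsilon>. levy_op \<alpha> \<epsilon> (\<lambda>x. f (c *\<^sub>R x)) x) \<longlongrightarrow> c powr (2 * \<alpha>) * levy_lim f (c *\<^sub>R x)) (at_right 0)"
    by (simp add: levy_op_scale[OF c])
qed simp

end

context fractional_order
begin

text \<open>The truncated operator is symmetric by Fubini, so it can be moved onto the singular kernel.\<close>

lemma riesz_duality:
  fixes \<phi> :: "'a::euclidean_space \<Rightarrow> real"
  assumes d: "2 * \<alpha> < real DIM('a)" and \<phi>: "c11_supported \<phi>" and e: "\<epsilon> > 0"
  shows "(\<integral>y. riesz y * levy_op \<alpha> \<epsilon> \<phi> y \<partial>lborel) = (\<integral>z. \<phi> z * levy_op \<alpha> \<epsilon> riesz z \<partial>lborel)"
proof -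
  obtain \<rho> B D where *: "\<rho> > 0" "B > 0" "\<And>x. norm x \<ge> \<rho> \<Longrightarrow> \<phi> x = 0" "\<And>x. \<bar>\<phi> x\<bar> \<le> B" and m[measurable]: "\<phi> \<in> borel_measurable borel"
    using c11_supportedD[OF \<phi>] by metis
  have w: "weighted (riesz :: 'a \<Rightarrow> real)" by (rule weighted_riesz[OF d])
  have i0: "integrable lborel (\<lambda>y. riesz y * \<phi> (y + h))" for h
  proof (rule weighted_integrable_supported[OF w, where B=B and \<rho>="\<rho> + norm h"])
    show "\<bar>\<phi> (y + h)\<bar> \<le> B" for y by (rule *(4))
    show "\<phi> (y + h) = 0" if "\<rho> + norm h < norm y" for y
      using that norm_diff_ineq[of y h] by (intro *(3)) linarith
  qed measurable
  have s: "(\<integral>y. riesz y * \<phi> (y + h) \<partial>lborel) = (\<integral>z. riesz (z - h) * \<phi> z \<partial>lborel)"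
    "integrable lborel (\<lambda>z. riesz (z - h) * \<phi> z)" for h
    using lborel_integral_shift[of "\<lambda>z. riesz (z - h) * \<phi> z" h] i0[of h] by simp_all
  have A: "(\<integral>y. riesz y * \<phi> (y + h) \<partial>lborel) - (\<integral>y. riesz y * \<phi> y \<partial>lborel) = (\<integral>z. (riesz (z - h) - riesz z) * \<phi> z \<partial>lborel)" for h
    unfolding s(1) using Bochner_Integration.integral_diff[OF s(2)[of h] s(2)[of 0]] by (simp add: left_diff_distrib)
  define T where "T = (\<integral>h. tkern \<alpha> \<epsilon> (h::'a) \<partial>lborel)"
  define K where "K = \<epsilon> powr (- (real DIM('a) + 2 * \<alpha>)) * (\<integral>y. indicator (cball 0 1) y * riesz (y::'a) \<partial>lborel) + T"
  have r1: "integrable lborel (\<lambda>h. riesz (z - h) * tkern \<alpha> \<epsilon> h)" "(\<integral>h. riesz (z - h) * tkern \<alpha> \<epsilon> h \<partial>lborel) \<le> K" for z :: 'a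
    using riesz_tkern[OF d e, of z] lborel_integral_minus[of "\<lambda>h. riesz (z + h) * tkern \<alpha> \<epsilon> h"] by (simp_all add: K_def T_def)
  have r2: "integrable lborel (\<lambda>h. riesz z * tkern \<alpha> \<epsilon> h)" for z :: 'a by (intro integrable_mult_right integrable_tkern e)
  have r3: "integrable lborel (\<lambda>h. (riesz (z - h) - riesz z) * tkern \<alpha> \<epsilon> h)" for z :: 'a
    using Bochner_Integration.integrable_diff[OF r1(1) r2] by (simp add: left_diff_distrib)
  have r3a: "integrable lborel (\<lambda>h. \<bar>riesz (z - h) - riesz z\<bar> * tkern \<alpha> \<epsilon> h)" for z :: 'a
    using integrable_abs[OF r3[of z]] by (simp add: abs_mult)
  let ?I = "\<lambda>z::'a. \<integral>h. \<bar>riesz (z - h) - riesz z\<bar> * tkern \<alpha> \<epsilon> h \<partial>lborel"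
  have I0: "0 \<le> ?I z" for z by (intro integral_nonneg_AE) auto
  have I1: "?I z \<le> K + riesz z * T" for z
  proof -
    have "?I z \<le> (\<integral>h. riesz (z - h) * tkern \<alpha> \<epsilon> h + riesz z * tkern \<alpha> \<epsilon> h \<partial>lborel)"
    proof (rule integral_mono[OF r3a Bochner_Integration.integrable_add[OF r1(1) r2]])
      fix h
      have "\<bar>riesz (z - h) - riesz z\<bar> \<le> riesz (z - h) + riesz z"
        using riesz_nonneg[of z] riesz_nonneg[of "z - h"] by (simp add: abs_le_iff)
      then show "\<bar>riesz (z - h) - riesz z\<bar> * tkern \<alpha> \<epsilon> h \<le> riesz (z - h) * tkern \<alpha> \<epsilon> h + riesz z * tkern \<alpha> \<epsilon> h"
        unfolding distrib_right[symmetric] by (rule mult_right_mono) simp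
    qed
    also have "\<dots> = (\<integral>h. riesz (z - h) * tkern \<alpha> \<epsilon> h \<partial>lborel) + riesz z * T"
      unfolding Bochner_Integration.integral_add[OF r1(1) r2] by (simp add: T_def)
    finally show ?thesis using r1(2)[of z] by linarith
  qed
  have "weighted (\<lambda>_::'a. 1)" by (simp add: weighted_def integrable_wgt)
  then have \<phi>i: "integrable lborel (\<lambda>z. 1 * \<phi> z)"
    by (rule weighted_integrable_supported[where B=B and \<rho>=\<rho>]) (use * in auto)
  have dom: "integrable lborel (\<lambda>z. K * \<bar>\<phi> z\<bar> + T * \<bar>riesz z * \<phi> z\<bar>)"
    using integrable_abs[OF \<phi>i] integrable_abs[OF i0[of 0]]
    by (intro Bochner_Integration.integrable_add integrable_mult_right) simp_all
  have int: "integrable (lborel \<Otimes>\<^sub>M lborel) (\<lambda>(z, h). \<phi> z * ((riesz (z - h) - riesz z) * tkern \<alpha> \<epsilon> h))"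
  proof (rule lborel_pair.Fubini_integrable)
    have "integrable lborel (\<lambda>z. \<bar>\<phi> z\<bar> * ?I z)"
    proof (rule Bochner_Integration.integrable_bound[OF dom])
      show "AE z in lborel. norm (\<bar>\<phi> z\<bar> * ?I z) \<le> norm (K * \<bar>\<phi> z\<bar> + T * \<bar>riesz z * \<phi> z\<bar>)"
      proof (rule AE_I2)
        fix z
        have "\<bar>\<phi> z\<bar> * ?I z \<le> \<bar>\<phi> z\<bar> * (K + riesz z * T)" by (intro mult_left_mono I1) simp
        also have "\<dots> = K * \<bar>\<phi> z\<bar> + T * \<bar>riesz z * \<phi> z\<bar>" by (simp add: abs_mult algebra_simps)
        finally show "norm (\<bar>\<phi> z\<bar> * ?I z) \<le> norm (K * \<bar>\<phi> z\<bar> + T * \<bar>riesz z * \<phi> z\<bar>)"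
          using I0[of z] by (simp add: abs_mult)
      qed
    qed measurable
    then show "integrable lborel (\<lambda>x. \<integral>y. norm (case (x, y) of (z, h) \<Rightarrow> \<phi> z * ((riesz (z - h) - riesz z) * tkern \<alpha> \<epsilon> h)) \<partial>lborel)"
      by (simp add: abs_mult)
    show "AE x in lborel. integrable lborel (\<lambda>y. case (x, y) of (z, h) \<Rightarrow> \<phi> z * ((riesz (z - h) - riesz z) * tkern \<alpha> \<epsilon> h))"
      by (simp add: r3)
  qed measurable
  have "(\<integral>y. riesz y * levy_op \<alpha> \<epsilon> \<phi> y \<partial>lborel) = (\<integral>h. (\<integral>z. (riesz (z - h) - riesz z) * \<phi> z \<partial>lborel) * tkern \<alpha> \<epsilon> h \<partial>lborel)"
    using integral_levy_op_swap[OF _ _ \<phi> e, of riesz] w unfolding A by (simp add: weighted_def)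
  also have "\<dots> = (\<integral>h. (\<integral>z. \<phi> z * ((riesz (z - h) - riesz z) * tkern \<alpha> \<epsilon> h) \<partial>lborel) \<partial>lborel)"
    by (subst integral_mult_left_zero[symmetric]) (simp add: mult_ac)
  also have "\<dots> = (\<integral>z. (\<integral>h. \<phi> z * ((riesz (z - h) - riesz z) * tkern \<alpha> \<epsilon> h) \<partial>lborel) \<partial>lborel)"
    by (rule lborel_pair.Fubini_integral[OF int])
  also have "\<dots> = (\<integral>z. \<phi> z * levy_op \<alpha> \<epsilon> riesz z \<partial>lborel)"
  proof (rule Bochner_Integration.integral_cong)
    fix z :: 'a
    have "(\<integral>h. (riesz (z - h) - riesz z) * tkern \<alpha> \<epsilon> h \<partial>lborel) = levy_op \<alpha> \<epsilon> riesz z"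
      unfolding levy_op_def using lborel_integral_minus(1)[of "\<lambda>h. (riesz (z + h) - riesz z) * tkern \<alpha> \<epsilon> h"] by simp
    then show "(\<integral>h. \<phi> z * ((riesz (z - h) - riesz z) * tkern \<alpha> \<epsilon> h) \<partial>lborel) = \<phi> z * levy_op \<alpha> \<epsilon> riesz z" by simp
  qed simp
  finally show ?thesis .
qed

text \<open>It vanishes to second order at the origin, which makes it integrable against the power \<open>-N\<close> of the norm.\<close>

definition ring_bump :: "'a::euclidean_space \<Rightarrow> real" where
  "ring_bump x = bump ((1 / 2) *\<^sub>R x) - bump x"

lemma c11_bump_half: "c11_supported (bump :: 'a::euclidean_space \<Rightarrow> real)" "c11_supported (\<lambda>x::'a. bump ((1 / 2) *\<^sub>R x))"
  using c11_supported_bump[of 1 "0::'a"] c11_supported_bump[of 2 "0::'a"] by (simp_all add: inverse_eq_divide)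

lemma ring_bump_props:
  fixes x :: "'a::euclidean_space"
  shows "0 \<le> ring_bump x" "ring_bump x \<le> 2 * (norm x)\<^sup>2" "2 \<le> norm x \<Longrightarrow> ring_bump x = 0"
    "1 \<le> norm x \<Longrightarrow> norm x \<le> 3 / 2 \<Longrightarrow> 1 / 9 \<le> ring_bump x"
proof -
  let ?s = "(norm x)\<^sup>2"
  have h: "bump ((1 / 2) *\<^sub>R x) = (max 0 (1 - ?s / 4))\<^sup>2" by (simp add: bump_def power_divide)
  have b: "bump x = (max 0 (1 - ?s))\<^sup>2" by (simp add: bump_def)
  have "max 0 (1 - ?s) \<le> max 0 (1 - ?s / 4)" by (intro max.mono) auto
  then show "0 \<le> ring_bump x" unfolding ring_bump_def h b by (simp add: power_mono)
  show "ring_bump x \<le> 2 * ?s"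
  proof (cases "?s \<le> 1")
    case True
    have "ring_bump x = (1 - ?s / 4)\<^sup>2 - (1 - ?s)\<^sup>2" unfolding ring_bump_def h b using True by simp
    also have "\<dots> = 2 * ?s - (?s / 2 + 15 / 16 * ?s\<^sup>2)" by (simp add: power2_eq_square field_simps)
    also have "\<dots> \<le> 2 * ?s" using zero_le_power2[of ?s] zero_le_power2[of "norm x"] by linarith
    finally show ?thesis .
  next
    case False
    have "ring_bump x \<le> 1" unfolding ring_bump_def using bump_simps(2)[of x] bump_simps(3)[of "(1 / 2) *\<^sub>R x"] by linarith
    then show ?thesis using False by linarith
  qed
  show "2 \<le> norm x \<Longrightarrow> ring_bump x = 0" unfolding ring_bump_def by (simp add: bump_eq_0)
  show "1 / 9 \<le> ring_bump x" if x: "1 \<le> norm x" "norm x \<le> 3 / 2"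
  proof -
    have "?s \<le> (3 / 2)\<^sup>2" using x by (intro power_mono) auto
    also have "(3 / 2)\<^sup>2 = (9 / 4 :: real)" by (simp add: power2_eq_square)
    finally have "1 / 3 \<le> max 0 (1 - ?s / 4)" unfolding le_max_iff_disj by linarith
    then have "(1 / 3)\<^sup>2 \<le> (max 0 (1 - ?s / 4))\<^sup>2" by (rule power_mono) simp
    moreover have "(1 / 3)\<^sup>2 = (1 / 9 :: real)" by (simp add: power2_eq_square)
    ultimately show ?thesis unfolding ring_bump_def h bump_eq_0[OF x(1)] by linarith
  qed
qed

text \<open>By \<open>riesz_homogeneous\<close> the limit operator maps the kernel to a multiple of the power \<open>-N\<close> of the norm.
  The pairing of the kernel with the operator applied to a bump does not change when the bump is
  dilated, so it vanishes on the difference of a bump and its dilate. By duality this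
  nonnegative difference integrates to zero against that multiple, which must be zero.\<close>

theorem levy_lim_riesz:
  fixes x :: "'a::euclidean_space"
  assumes d: "2 * \<alpha> < real DIM('a)" and x: "x \<noteq> 0"
  shows "levy_lim riesz x = 0"
proof -
  obtain e :: 'a where e: "norm e = 1" using vector_choose_size[of 1] by auto
  define \<l> where "\<l> = levy_lim riesz e"
  define m0 where "m0 = (\<integral>h. \<bar>sdiff riesz e h\<bar> * kern \<alpha> h \<partial>lborel)"
  have ell: "levy_lim riesz z = \<l> * norm z powr (- real DIM('a))" if z: "z \<noteq> 0" for z :: 'a
    using riesz_homogeneous[of "\<lambda>t. t" z e] z e by (simp add: levy_lim_def \<l>_def)
  have maj: "(\<integral>h. \<bar>sdiff riesz z h\<bar> * kern \<alpha> h \<partial>lborel) = m0 * norm z powr (- real DIM('a))" if z: "z \<noteq> 0" for z :: 'a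
    using riesz_homogeneous[of abs z e] z e by (simp add: m0_def abs_mult)
  let ?\<phi> = "ring_bump :: 'a \<Rightarrow> real"
  have \<phi>: "c11_supported ?\<phi>" unfolding ring_bump_def by (intro c11_supported_diff c11_bump_half)
  have [measurable]: "?\<phi> \<in> borel_measurable borel" using c11_supportedD[OF \<phi>] by metis
  have \<phi>0: "?\<phi> 0 = 0" by (simp add: ring_bump_def)
  let ?P = "\<lambda>z::'a. ?\<phi> z * norm z powr (- real DIM('a))"
  have P0: "0 \<le> ?P z" for z using ring_bump_props(1)[of z] by simp
  have Ple: "?P z \<le> 2 * (indicator (cball 0 2) z * norm z powr (- (real DIM('a) - 2)))" for z
  proof (cases "z = 0 \<or> 2 < norm z")
    case True
    then show ?thesis using ring_bump_props(3)[of z] \<phi>0 by auto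
  next
    case False
    have "(norm z)\<^sup>2 = norm z powr 2" using False by simp
    then have eq: "(norm z)\<^sup>2 * norm z powr (- real DIM('a)) = norm z powr (- (real DIM('a) - 2))"
      by (simp only: powr_add[symmetric]) simp
    have "?P z \<le> (2 * (norm z)\<^sup>2) * norm z powr (- real DIM('a))"
      by (intro mult_right_mono ring_bump_props) simp
    then show ?thesis unfolding mult.assoc eq using False by simp
  qed
  have iP: "integrable lborel ?P"
  proof (rule Bochner_Integration.integrable_bound)
    show "integrable lborel (\<lambda>z::'a. 2 * (indicator (cball 0 2) z * norm z powr (- (real DIM('a) - 2))))"
      by (intro integrable_mult_right integrable_norm_powr_cball) simp
    show "AE z in lborel. norm (?P z) \<le> norm (2 * (indicator (cball 0 2) z * norm (z::'a) powr (- (real DIM('a) - 2))))"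
    proof (rule AE_I2)
      fix z :: 'a
      have "\<bar>?P z\<bar> = ?P z" using P0[of z] by (rule abs_of_nonneg)
      then show "norm (?P z) \<le> norm (2 * (indicator (cball 0 2) z * norm (z::'a) powr (- (real DIM('a) - 2))))"
        unfolding real_norm_def using Ple[of z] by linarith
    qed
  qed measurable
  have Ppos: "0 < (\<integral>z. ?P z \<partial>lborel)"
  proof -
    define c where "c = 1 / 9 * (3 / 2 :: real) powr (- real DIM('a))"
    have c: "c > 0" by (simp add: c_def)
    have "0 < c * (unit_ball_vol (real DIM('a)) * ((3 / 2) ^ DIM('a) - 1))"
      using c one_less_power[of "3/2::real" "DIM('a)"] by (intro mult_pos_pos) auto
    also have "\<dots> = (\<integral>z. c * (indicator (cball 0 (3 / 2)) (z::'a) - indicator (cball 0 1) z) \<partial>lborel)"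
      by (simp add: content_cball emeasure_cball right_diff_distrib)
    also have "\<dots> \<le> (\<integral>z. ?P z \<partial>lborel)"
    proof (rule integral_mono[OF _ iP])
      fix z :: 'a
      show "c * (indicator (cball 0 (3 / 2)) z - indicator (cball 0 1) z) \<le> ?P z"
      proof (cases "1 < norm z \<and> norm z \<le> 3 / 2")
        case True
        have "(3 / 2 :: real) powr (- real DIM('a)) \<le> norm z powr (- real DIM('a))"
          using True by (intro powr_mono2') auto
        then have "c \<le> ?P z" unfolding c_def using ring_bump_props(4)[of z] True by (intro mult_mono) auto
        then show ?thesis using True by simp
      next
        case False
        then show ?thesis using P0[of z] by (auto simp: indicator_def)
      qed
    qed (simp add: emeasure_cball)
    finally show ?thesis .
  qed
  have w: "weighted (riesz :: 'a \<Rightarrow> real)" by (rule weighted_riesz[OF d])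
  note pair = levy_op_pairing_tendsto(2)[OF w] levy_op_pairing_tendsto(1)[OF w]
  let ?F = "\<lambda>y::'a. riesz y * levy_lim bump y"
  have half: "riesz y * levy_lim (\<lambda>x. bump ((1 / 2) *\<^sub>R x)) y = (1 / 2) ^ DIM('a) * ?F ((1 / 2) *\<^sub>R y)" for y :: 'a
  proof -
    have "riesz ((1 / 2) *\<^sub>R y) = (1 / 2) powr (- (real DIM('a) - 2 * \<alpha>)) * riesz y" by (rule riesz_scale) simp
    moreover have "(1 / 2 :: real) powr (2 * \<alpha>) = (1 / 2) ^ DIM('a) * (1 / 2) powr (- (real DIM('a) - 2 * \<alpha>))"
      by (simp add: powr_realpow[symmetric] powr_add[symmetric] del: powr_realpow')
    ultimately show ?thesis by (subst levy_lim_scale) (simp_all add: c11_bump_half)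
  qed
  have zero: "(\<integral>y. riesz y * levy_lim ?\<phi> y \<partial>lborel) = 0"
  proof -
    have "(\<integral>y. riesz y * levy_lim ?\<phi> y \<partial>lborel) = (\<integral>y. riesz y * levy_lim (\<lambda>x. bump ((1 / 2) *\<^sub>R x)) y - ?F y \<partial>lborel)"
      unfolding ring_bump_def by (subst levy_lim_diff[OF c11_bump_half(2,1)]) (simp add: right_diff_distrib)
    also have "\<dots> = (\<integral>y. riesz y * levy_lim (\<lambda>x. bump ((1 / 2) *\<^sub>R x)) (y::'a) \<partial>lborel) - (\<integral>y. ?F y \<partial>lborel)"
      by (subst Bochner_Integration.integral_diff)
         (use pair(1)[OF c11_bump_half(2)] pair(1)[OF c11_bump_half(1)] in auto)
    also have "(\<integral>y. riesz y * levy_lim (\<lambda>x. bump ((1 / 2) *\<^sub>R x)) (y::'a) \<partial>lborel) = (1 / 2) ^ DIM('a) * (\<integral>y. ?F ((1 / 2) *\<^sub>R y) \<partial>lborel)"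
      unfolding half by simp
    also have "(\<integral>y. ?F ((1 / 2) *\<^sub>R y) \<partial>lborel) = (\<integral>y. ?F y \<partial>lborel) / \<bar>1 / 2\<bar> ^ DIM('a)"
      by (rule lborel_integral_scale(1)) simp
    finally show ?thesis by simp
  qed
  have b: "\<bar>?\<phi> z * levy_op \<alpha> t riesz z\<bar> \<le> m0 * ?P z" if t: "t > 0" for t z
  proof (cases "z = 0")
    case False
    then have "\<bar>levy_op \<alpha> t riesz z\<bar> \<le> m0 * norm z powr (- real DIM('a))"
      using riesz_levy_op(2)[OF d False t] maj[OF False] by simp
    then have "?\<phi> z * \<bar>levy_op \<alpha> t riesz z\<bar> \<le> ?\<phi> z * (m0 * norm z powr (- real DIM('a)))"
      by (intro mult_left_mono ring_bump_props)
    then show ?thesis using ring_bump_props(1)[of z] by (simp add: abs_mult mult_ac)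
  qed (simp add: \<phi>0)
  have l: "((\<lambda>t. ?\<phi> z * levy_op \<alpha> t riesz z) \<longlongrightarrow> \<l> * ?P z) (at_right 0)" for z
  proof (cases "z = 0")
    case False
    have "((\<lambda>t. ?\<phi> z * levy_op \<alpha> t riesz z) \<longlongrightarrow> ?\<phi> z * levy_lim riesz z) (at_right 0)"
      by (intro tendsto_intros riesz_levy_op d False)
    then show ?thesis unfolding ell[OF False] by (simp add: mult_ac)
  qed (simp add: \<phi>0)
  have "((\<lambda>t. \<integral>z. ?\<phi> z * levy_op \<alpha> t riesz z \<partial>lborel) \<longlongrightarrow> (\<integral>z. \<l> * ?P z \<partial>lborel)) (at_right 0)"
  proof (rule integral_dominated_convergence_at_right_0(1)[OF _ _ _ l b])
    show "(\<lambda>z. ?\<phi> z * levy_op \<alpha> t riesz z) \<in> borel_measurable lborel" for t unfolding levy_op_def by measurable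
  qed (use iP in auto)
  moreover have "\<forall>\<^sub>F t in at_right 0. (\<integral>z. ?\<phi> z * levy_op \<alpha> t riesz z \<partial>lborel) = (\<integral>y. riesz y * levy_op \<alpha> t ?\<phi> y \<partial>lborel)"
    using eventually_at_right_less[of "0::real"] by eventually_elim (simp add: riesz_duality[OF d \<phi>])
  ultimately have "((\<lambda>t. \<integral>y. riesz y * levy_op \<alpha> t ?\<phi> y \<partial>lborel) \<longlongrightarrow> (\<integral>z. \<l> * ?P z \<partial>lborel)) (at_right 0)"
    by (rule Lim_transform_eventually)
  from tendsto_unique[OF _ this pair(2)[OF \<phi>]] have "(\<integral>z. \<l> * ?P z \<partial>lborel) = 0"
    unfolding zero by simp
  then have "\<l> = 0" using Ppos by simp
  then show ?thesis using ell[OF x] by simp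
qed

text \<open>The power of the norm with exponent \<open>-\<tau>\<close> is the Riesz kernel to a power \<open>s > 1\<close>, and a convex
  function of a solution of the linear equation is a subsolution. A strict gain comes from the
  ball of half the radius around the origin, where the kernel is larger than at \<open>x\<close> by a fixed
  factor; it has the homogeneity \<open>-\<tau> - 2\<alpha>\<close> and so dominates, for large \<open>x\<close>, the loss of order
  \<open>-N - 2\<alpha>\<close> caused by cutting the power off inside a fixed ball.\<close>

theorem power_barrier:
  assumes d: "2 * \<alpha> < real DIM('a::euclidean_space)"
    and \<tau>: "real DIM('a) - 2 * \<alpha> < \<tau>" "\<tau> < real DIM('a)" and r: "r > 0"
  defines "w \<equiv> \<lambda>x::'a. if r \<le> norm x then norm x powr (- \<tau>) else 0"
  obtains \<kappa> R where "\<kappa> > 0" "R > 0"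
    "\<And>x. R \<le> norm x \<Longrightarrow> \<forall>\<^sub>F \<epsilon> in at_right 0. \<kappa> * norm x powr (- \<tau> - 2 * \<alpha>) \<le> levy_op \<alpha> \<epsilon> w x"
proof -
  define q where "q = real DIM('a) + 2 * \<alpha>"
  define \<gamma> where "\<gamma> = real DIM('a) - 2 * \<alpha>"
  define s where "s = \<tau> / \<gamma>"
  have \<gamma>: "\<gamma> > 0" using d by (simp add: \<gamma>_def)
  have s: "s > 1" "\<gamma> * s = \<tau>" using \<tau> \<gamma> by (auto simp: s_def \<gamma>_def field_simps)
  have \<tau>0: "\<tau> > 0" using \<tau> d by simp
  define a where "a = (2::real) powr \<gamma>"
  have a: "a > 1" using powr_less_mono[of 0 \<gamma> 2] \<gamma> by (simp add: a_def)
  define q0 where "q0 = a powr s - 1 - s * (a - 1)"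
  have q0: "q0 > 0" unfolding q0_def by (rule powr_above_tangent(3)[OF s(1) a])
  define w0 where "w0 = (\<lambda>x::'a. norm x powr (- \<tau>))"
  have [measurable]: "w0 \<in> borel_measurable borel" unfolding w0_def by measurable
  have wm[measurable]: "w \<in> borel_measurable borel" unfolding w_def by measurable
  have iW: "integrable lborel (\<lambda>x. indicator (cball 0 r) x * w0 x)" unfolding w0_def by (rule integrable_norm_powr_cball) (use \<tau> in simp)
  define W where "W = (\<integral>x. indicator (cball 0 r) x * w0 x \<partial>lborel)"
  have W: "W \<ge> 0" unfolding W_def w0_def by (intro integral_nonneg_AE) auto
  define c1 where "c1 = q0 * (3 / 2) powr (- q) * unit_ball_vol (real DIM('a)) * (1 / 2) ^ DIM('a)"
  have c1: "c1 > 0" using q0 by (simp add: c1_def)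
  define dd where "dd = real DIM('a) - \<tau>"
  have dd: "dd > 0" using \<tau> by (simp add: dd_def)
  \<comment> \<open>From this radius on, the loss from the cut-off is at most a quarter of the gain.\<close>
  define R where "R = max (2 * r) ((4 * (2 powr q * W) / c1) powr (1 / dd))"
  have R: "R > 0" "2 * r \<le> R" "(4 * (2 powr q * W) / c1) powr (1 / dd) \<le> R" using r by (auto simp: R_def)
  show ?thesis
  proof (rule that[of "c1 / 2" R])
    fix x :: 'a assume xR: "R \<le> norm x"
    let ?X = "norm x"
    have X: "?X > 0" "2 * r \<le> ?X" using xR R by auto
    have x0: "x \<noteq> 0" using X by auto
    \<comment> \<open>The tangent inequality at the ratio of the two kernel values, scaled back.\<close>
    have bern: "w0 y - w0 x \<ge> s * ?X powr (\<gamma> - \<tau>) * (riesz y - riesz x) + q0 * ?X powr (- \<tau>) * indicator (cball 0 (?X / 2)) y"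
      if y: "y \<noteq> 0" for y :: 'a
    proof -
      define t where "t = (?X / norm y) powr \<gamma>"
      have t: "t \<ge> 0" by (simp add: t_def)
      have w0y: "w0 y = ?X powr (- \<tau>) * t powr s"
        using X y unfolding w0_def t_def powr_powr s(2) by (simp add: powr_divide powr_minus field_simps)
      have rx: "riesz x = ?X powr (- \<gamma>)" by (simp add: riesz_def \<gamma>_def)
      have ry: "riesz y = ?X powr (- \<gamma>) * t"
        using X y unfolding t_def riesz_def \<gamma>_def[symmetric] by (simp add: powr_divide powr_minus field_simps)
      have "?X powr (\<gamma> - \<tau>) * ?X powr (- \<gamma>) = ?X powr (- \<tau>)" by (simp add: powr_add[symmetric])
      then have e: "s * ?X powr (\<gamma> - \<tau>) * (riesz y - riesz x) = ?X powr (- \<tau>) * (s * (t - 1))"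
        unfolding rx ry by (simp add: algebra_simps)
      have "s * (t - 1) + q0 * indicator (cball 0 (?X / 2)) y \<le> t powr s - 1"
      proof (cases "norm y \<le> ?X / 2")
        case True
        have "2 \<le> ?X / norm y" using True y by (simp add: field_simps)
        then have "a \<le> t" unfolding a_def t_def using \<gamma> by (intro powr_mono2) auto
        then have "q0 \<le> t powr s - 1 - s * (t - 1)" unfolding q0_def by (rule powr_above_tangent(2)[OF s(1) a])
        then show ?thesis using True by simp
      next
        case False
        then show ?thesis using powr_above_tangent(1)[OF s(1) t] by simp
      qed
      then have "?X powr (- \<tau>) * (s * (t - 1) + q0 * indicator (cball 0 (?X / 2)) y) \<le> ?X powr (- \<tau>) * (t powr s - 1)"
        by (intro mult_left_mono) auto
      moreover have "w0 x = ?X powr (- \<tau>)" by (simp add: w0_def)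
      ultimately show ?thesis unfolding e w0y by (simp add: algebra_simps)
    qed
    have alg: "(k * d + l * i - j) * t = k * (d * t) + l * (i * t) - j * t" for k d l i j t :: real
      by (simp add: algebra_simps)
    have wb: "\<bar>w y\<bar> \<le> r powr (- \<tau>)" for y
      unfolding w_def using r \<tau>0 by (auto intro!: powr_mono2')
    have est: "s * ?X powr (\<gamma> - \<tau>) * levy_op \<alpha> \<epsilon> riesz x + c1 * ?X powr (- \<tau> - 2 * \<alpha>) - 2 powr q * W * ?X powr (- q) \<le> levy_op \<alpha> \<epsilon> w x"
      if e: "0 < \<epsilon>" "\<epsilon> < ?X / 2" for \<epsilon>
    proof -
      let ?A = "\<lambda>h. (s * ?X powr (\<gamma> - \<tau>)) * ((riesz (x + h) - riesz x) * tkern \<alpha> \<epsilon> h)"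
      let ?B = "\<lambda>h. (q0 * ?X powr (- \<tau>) * (3 / 2 * ?X) powr (- q)) * indicator (cball 0 (?X / 2)) (x + h)"
      let ?C = "\<lambda>h. (?X / 2) powr (- q) * (indicator (cball 0 r) (x + h) * w0 (x + h))"
      let ?D = "\<lambda>h. (w (x + h) - w x) * tkern \<alpha> \<epsilon> h"
      have c: "integrable lborel (\<lambda>h. riesz x * tkern \<alpha> \<epsilon> (h::'a))" by (intro integrable_mult_right integrable_tkern e)
      have iA0: "integrable lborel (\<lambda>h. (riesz (x + h) - riesz x) * tkern \<alpha> \<epsilon> h)"
        using Bochner_Integration.integrable_diff[OF riesz_tkern(1)[OF d e(1), of x] c] by (simp add: left_diff_distrib)
      have iA: "integrable lborel ?A" by (rule integrable_mult_right[OF iA0])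
      have iB: "integrable lborel ?B" using integral_indicator_cball_shift(1)[of "?X / 2" x] by (intro integrable_mult_right) auto
      have iC0: "integrable lborel (\<lambda>h. indicator (cball 0 r) (x + h) * w0 (x + h))" "(\<integral>h. indicator (cball 0 r) (x + h) * w0 (x + h) \<partial>lborel) = W"
        using lborel_integral_shift[of "\<lambda>y. indicator (cball 0 r) y * w0 y" x] iW by (simp_all add: add.commute W_def)
      have iC: "integrable lborel ?C" by (rule integrable_mult_right[OF iC0(1)])
      have iD: "integrable lborel ?D" by (rule integrable_bounded_increment[OF wm wb e(1)])
      have "(\<integral>h. ?A h + ?B h - ?C h \<partial>lborel) \<le> (\<integral>h. ?D h \<partial>lborel)"
      proof (rule integral_mono_AE)
        show "AE h in lborel. ?A h + ?B h - ?C h \<le> ?D h"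
          using AE_lborel_singleton[of "- x"]
        proof eventually_elim
          case (elim h)
          let ?y = "x + h"
          have y: "?y \<noteq> 0" using elim by (metis add_eq_0_iff)
          have far: "?X / 2 \<le> norm h" if "norm ?y \<le> ?X / 2" using that norm_diff_ineq[of x h] norm_triangle_ineq4[of ?y h] by simp
          have wx: "w x = w0 x" using X r by (simp add: w_def w0_def)
          have wy: "w0 ?y - indicator (cball 0 r) ?y * w0 ?y \<le> w ?y" by (auto simp: w_def w0_def indicator_def)
          have k1: "indicator (cball 0 (?X / 2)) ?y * (3 / 2 * ?X) powr (- q) \<le> indicator (cball 0 (?X / 2)) ?y * tkern \<alpha> \<epsilon> h"
          proof (cases "norm ?y \<le> ?X / 2")
            case True
            have h: "?X / 2 \<le> norm h" by (rule far[OF True])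
            have "norm h \<le> 3 / 2 * ?X" using True norm_triangle_ineq4[of ?y x] by simp
            then have "(3 / 2 * ?X) powr (- q) \<le> norm h powr (- q)"
              using h X frac_order_dim_pos[where 'a='a] by (intro powr_mono2') (auto simp: q_def)
            then have "(3 / 2 * ?X) powr (- q) \<le> tkern \<alpha> \<epsilon> h" using h e by (simp add: tkern_def kern_def q_def)
            then show ?thesis by (rule mult_left_mono) simp
          qed simp
          have k2: "indicator (cball 0 r) ?y * tkern \<alpha> \<epsilon> h \<le> indicator (cball 0 r) ?y * (?X / 2) powr (- q)"
          proof (cases "norm ?y \<le> r")
            case True
            have h: "?X / 2 \<le> norm h" using far True X by linarith
            have "norm h powr (- q) \<le> (?X / 2) powr (- q)"
              using h X frac_order_dim_pos[where 'a='a] by (intro powr_mono2') (auto simp: q_def)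
            then have "tkern \<alpha> \<epsilon> h \<le> (?X / 2) powr (- q)"
              using tkern_le_kern[of \<alpha> \<epsilon> h] unfolding kern_def q_def by linarith
            then show ?thesis by (rule mult_left_mono) simp
          qed simp
          have B: "?B h \<le> (q0 * ?X powr (- \<tau>)) * (indicator (cball 0 (?X / 2)) ?y * tkern \<alpha> \<epsilon> h)"
            using mult_left_mono[OF k1, of "q0 * ?X powr (- \<tau>)"] q0 by (simp add: mult_ac)
          have w00: "0 \<le> w0 ?y" by (simp add: w0_def)
          have C: "(indicator (cball 0 r) ?y * w0 ?y) * tkern \<alpha> \<epsilon> h \<le> ?C h"
            using mult_left_mono[OF k2 w00] by (simp add: mult_ac)
          have "(s * ?X powr (\<gamma> - \<tau>) * (riesz ?y - riesz x) + q0 * ?X powr (- \<tau>) * indicator (cball 0 (?X / 2)) ?y - indicator (cball 0 r) ?y * w0 ?y) * tkern \<alpha> \<epsilon> h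
             \<le> (w ?y - w x) * tkern \<alpha> \<epsilon> h"
            using bern[OF y] wy unfolding wx by (intro mult_right_mono) auto
          then have "?A h + (q0 * ?X powr (- \<tau>)) * (indicator (cball 0 (?X / 2)) ?y * tkern \<alpha> \<epsilon> h) - (indicator (cball 0 r) ?y * w0 ?y) * tkern \<alpha> \<epsilon> h \<le> ?D h"
            unfolding alg .
          then show ?case using B C by linarith
        qed
      qed (intro Bochner_Integration.integrable_diff Bochner_Integration.integrable_add iA iB iC iD)+
      moreover have "(\<integral>h. ?A h + ?B h - ?C h \<partial>lborel) = (\<integral>h. ?A h \<partial>lborel) + (\<integral>h. ?B h \<partial>lborel) - (\<integral>h. ?C h \<partial>lborel)"
        using Bochner_Integration.integral_diff[OF Bochner_Integration.integrable_add[OF iA iB] iC] Bochner_Integration.integral_add[OF iA iB] by simp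
      moreover have "(\<integral>h. ?A h \<partial>lborel) = s * ?X powr (\<gamma> - \<tau>) * levy_op \<alpha> \<epsilon> riesz x" by (simp add: levy_op_def)
      moreover have "(\<integral>h. ?B h \<partial>lborel) = c1 * ?X powr (- \<tau> - 2 * \<alpha>)"
      proof -
        have "(\<integral>h. ?B h \<partial>lborel) = (q0 * ?X powr (- \<tau>) * (3 / 2 * ?X) powr (- q)) * (unit_ball_vol (real DIM('a)) * (?X / 2) ^ DIM('a))"
          using integral_indicator_cball_shift(2)[of "?X / 2" x] by simp
        also have "\<dots> = (q0 * ?X powr (- \<tau>) * ((3 / 2) powr (- q) * ?X powr (- q))) * (unit_ball_vol (real DIM('a)) * (?X / 2) ^ DIM('a))"
          by (simp only: powr_mult)
        also have "(q0 * ?X powr (- \<tau>) * ((3 / 2) powr (- q) * ?X powr (- q))) * (unit_ball_vol (real DIM('a)) * (?X / 2) ^ DIM('a))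
          = c1 * (?X powr (- \<tau>) * ?X powr (- q) * ?X ^ DIM('a))"
          by (simp add: c1_def power_divide)
        also have "?X powr (- \<tau>) * ?X powr (- q) * ?X ^ DIM('a) = ?X powr (- \<tau> - 2 * \<alpha>)"
        proof -
          have "?X ^ DIM('a) = ?X powr real DIM('a)" using X by (simp add: powr_realpow)
          then show ?thesis
            by (simp only: powr_add[symmetric]) (rule arg_cong[where f="(powr) ?X"], simp add: q_def)
        qed
        finally show ?thesis .
      qed
      moreover have "(\<integral>h. ?C h \<partial>lborel) = 2 powr q * W * ?X powr (- q)"
      proof -
        have "(\<integral>h. ?C h \<partial>lborel) = (?X / 2) powr (- q) * W" unfolding integral_mult_right_zero iC0(2) ..
        also have "\<dots> = 2 powr q * W * ?X powr (- q)" by (simp add: powr_divide powr_minus field_simps)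
        finally show ?thesis .
      qed
      ultimately show ?thesis unfolding levy_op_def by linarith
    qed
    have cut: "2 powr q * W * ?X powr (- q) \<le> c1 / 4 * ?X powr (- \<tau> - 2 * \<alpha>)"
    proof -
      let ?Z = "4 * (2 powr q * W) / c1"
      have "?Z \<le> ?X powr dd"
      proof (cases "W = 0")
        case False
        then have "?Z = (?Z powr (1 / dd)) powr dd" using W c1 dd by (simp add: powr_powr)
        also have "\<dots> \<le> ?X powr dd" using R(3) xR dd by (intro powr_mono2) auto
        finally show ?thesis .
      qed simp
      then have "2 powr q * W \<le> c1 / 4 * ?X powr dd" using c1 by (simp add: field_simps)
      then have "2 powr q * W * ?X powr (- q) \<le> c1 / 4 * ?X powr dd * ?X powr (- q)" by (intro mult_right_mono) auto
      also have "\<dots> = c1 / 4 * ?X powr (- \<tau> - 2 * \<alpha>)" by (simp add: powr_add[symmetric] dd_def q_def)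
      finally show ?thesis .
    qed
    have "((\<lambda>\<epsilon>. s * ?X powr (\<gamma> - \<tau>) * levy_op \<alpha> \<epsilon> riesz x) \<longlongrightarrow> s * ?X powr (\<gamma> - \<tau>) * 0) (at_right 0)"
      using riesz_levy_op(1)[OF d x0] levy_lim_riesz[OF d x0] by (intro tendsto_mult tendsto_const) simp
    then have "\<forall>\<^sub>F \<epsilon> in at_right 0. - (c1 / 4 * ?X powr (- \<tau> - 2 * \<alpha>)) < s * ?X powr (\<gamma> - \<tau>) * levy_op \<alpha> \<epsilon> riesz x"
      by (rule order_tendstoD) (use c1 X in simp)
    moreover have "\<forall>\<^sub>F \<epsilon> in at_right (0::real). 0 < \<epsilon> \<and> \<epsilon> < ?X / 2"
      using X by (auto simp: eventually_at_right_field intro!: exI[of _ "?X / 2"])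
    ultimately show "\<forall>\<^sub>F \<epsilon> in at_right 0. c1 / 2 * norm x powr (- \<tau> - 2 * \<alpha>) \<le> levy_op \<alpha> \<epsilon> w x"
    proof eventually_elim
      case (elim \<epsilon>)
      then show ?case using est[of \<epsilon>] cut by linarith
    qed
  qed (use c1 R in auto)
qed

end

context frac_solution
begin

section \<open>Lower bound in the supercritical range\<close>

text \<open>A small multiple of the cut-off power lies below \<open>U\<close> on the compact annulus where it is not yet a
  subsolution, so any violation occurs further out. There the comparison would give
  \<open>c \<kappa> \<le> c powr p\<close>, which is false for small \<open>c\<close>.\<close>

theorem lower_bound_supercritical:
  assumes d: "2 * \<alpha> < real DIM('a)"
    and \<tau>: "\<tau> * p = \<tau> + 2 * \<alpha>" "real DIM('a) - 2 * \<alpha> < \<tau>" "\<tau> < real DIM('a)"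
  shows "\<exists>c>0. \<exists>R. \<forall>x. norm x \<ge> R \<longrightarrow> c * norm x powr (- \<tau>) \<le> U x"
proof -
  obtain r where r: "r > 0" "\<And>x. norm x \<ge> r \<Longrightarrow> U x > 0" using U_pos_far by blast
  define w where "w = (\<lambda>x::'a. if r \<le> norm x then norm x powr (- \<tau>) else 0)"
  have \<tau>0: "\<tau> > 0" using \<tau> d by simp
  obtain \<kappa> R where R: "\<kappa> > 0" "R > 0"
    "\<And>x. R \<le> norm x \<Longrightarrow> \<forall>\<^sub>F \<epsilon> in at_right 0. \<kappa> * norm x powr (- \<tau> - 2 * \<alpha>) \<le> levy_op \<alpha> \<epsilon> w x"
    using power_barrier[OF d \<tau>(2,3) r(1)] unfolding w_def by blast
  let ?K = "cball (0::'a) (max r R) - ball 0 r"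
  have K: "compact ?K" by (simp add: compact_diff)
  obtain b :: 'a where "norm b = r" using vector_choose_size[of r] r by auto
  then have "b \<in> ?K" by simp
  then have "?K \<noteq> {}" by blast
  moreover have "continuous_on ?K U" by (rule continuous_on_subset[OF U_cont]) (use r in auto)
  ultimately obtain x0 where x0: "x0 \<in> ?K" "\<And>x. x \<in> ?K \<Longrightarrow> U x0 \<le> U x" using continuous_attains_inf[OF K] by blast
  define \<mu> where "\<mu> = U x0"
  have \<mu>: "\<mu> > 0" unfolding \<mu>_def using r(2) x0(1) by auto
  have \<mu>le: "\<mu> \<le> U x" if "r \<le> norm x" "norm x \<le> R" for x using x0(2)[of x] that by (auto simp: \<mu>_def)
  define c where "c = min (\<mu> * r powr \<tau>) ((\<kappa> / 2) powr (1 / (p - 1)))"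
  have c: "c > 0" "c \<le> \<mu> * r powr \<tau>" "c \<le> (\<kappa> / 2) powr (1 / (p - 1))" using \<mu> r R by (auto simp: c_def)
  have cp: "c powr p < c * \<kappa>"
  proof -
    have "c powr (p - 1) \<le> ((\<kappa> / 2) powr (1 / (p - 1))) powr (p - 1)" using c p by (intro powr_mono2) auto
    also have "\<dots> = \<kappa> / 2" using p R by (simp add: powr_powr)
    also have "\<dots> < \<kappa>" using R by simp
    finally have "c * c powr (p - 1) < c * \<kappa>" using c by simp
    moreover have "c * c powr (p - 1) = c powr p" using c by (simp add: powr_diff)
    ultimately show ?thesis by simp
  qed
  have small: "c * norm x powr (- \<tau>) \<le> \<mu>" if "r \<le> norm x" for x :: 'a
  proof -
    have "c * norm x powr (- \<tau>) \<le> (\<mu> * r powr \<tau>) * r powr (- \<tau>)"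
      using c \<mu> that r \<tau>0 by (intro mult_mono powr_mono2') auto
    also have "\<dots> = \<mu>" using r by (simp add: powr_minus)
    finally show ?thesis .
  qed
  define v where "v = (\<lambda>x. c * w x)"
  have [measurable]: "w \<in> borel_measurable borel" unfolding w_def by measurable
  have v_r: "v x = c * norm x powr (- \<tau>)" if "r \<le> norm x" for x using that by (simp add: v_def w_def)
  have v_op: "levy_op \<alpha> \<epsilon> v x = c * levy_op \<alpha> \<epsilon> w x" for \<epsilon> x
    unfolding levy_op_def v_def by (simp add: right_diff_distrib[symmetric] mult.assoc)
  have "c * norm x powr (- \<tau>) \<le> U x" if x: "r \<le> norm x" for x
  proof (rule ccontr)
    assume "\<not> c * norm x powr (- \<tau>) \<le> U x"
    then have less: "U x < v x" using v_r[OF x] by simp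
    obtain y where y: "r \<le> norm y" "U y < v y"
      "c * \<kappa> * norm y powr (- \<tau> - 2 * \<alpha>) + (2 * norm y) powr (- (real DIM('a) + 2 * \<alpha>)) * mass U (r / 2) \<le> U y powr p"
    proof (rule comparison_from_below[of "r / 2" r v \<mu> "\<lambda>x. c * \<kappa> * norm x powr (- \<tau> - 2 * \<alpha>)" x])
      show "v \<in> borel_measurable borel" unfolding v_def by measurable
      show "\<bar>v z\<bar> \<le> \<mu>" for z
        using small[of z] c \<mu> v_r[of z] by (cases "r \<le> norm z") (auto simp: v_def w_def)
      show "v z = 0" if "norm z < r" for z using that by (simp add: v_def w_def)
      have "continuous_on {z. r \<le> norm z} (\<lambda>z::'a. c * norm z powr (- \<tau>))"
        using r by (intro continuous_intros) auto
      then show "continuous_on {z. r \<le> norm z} v"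
        by (rule continuous_on_eq) (simp add: v_r)
      show "continuous_on {z::'a. r \<le> norm z} (\<lambda>z. c * \<kappa> * norm z powr (- \<tau> - 2 * \<alpha>))"
        using r by (intro continuous_intros) auto
      have "((\<lambda>t. t powr (- \<tau>)) \<longlongrightarrow> 0) at_top" using \<tau>0 by (intro tendsto_neg_powr filterlim_ident) auto
      then have "((\<lambda>z::'a. norm z powr (- \<tau>)) \<longlongrightarrow> 0) at_infinity"
        by (rule filterlim_compose[OF _ filterlim_norm_at_top])
      then have "((\<lambda>z::'a. c * norm z powr (- \<tau>)) \<longlongrightarrow> 0) at_infinity" by (rule tendsto_mult_right_zero)
      moreover have "\<forall>\<^sub>F z in at_infinity. c * norm z powr (- \<tau>) = v z"
        unfolding eventually_at_infinity by (rule exI[of _ r]) (simp add: v_r)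
      ultimately show "(v \<longlongrightarrow> 0) at_infinity" by (rule Lim_transform_eventually)
      show "\<forall>\<^sub>F \<epsilon> in at_right 0. c * \<kappa> * norm z powr (- \<tau> - 2 * \<alpha>) \<le> levy_op \<alpha> \<epsilon> v z" if z: "r \<le> norm z" "U z < v z" for z
      proof -
        have "R \<le> norm z" using small[OF z(1)] \<mu>le[OF z(1)] z v_r[OF z(1)] by linarith
        from R(3)[OF this] show ?thesis
        proof eventually_elim
          case (elim \<epsilon>)
          then show ?case unfolding v_op mult.assoc using c(1) by (intro mult_left_mono) auto
        qed
      qed
    qed (use r x less that in auto)
    have "0 \<le> (2 * norm y) powr (- (real DIM('a) + 2 * \<alpha>)) * mass U (r / 2)"
      by (intro mult_nonneg_nonneg mass_nonneg U_nonneg) auto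
    then have "c * \<kappa> * norm y powr (- \<tau> - 2 * \<alpha>) \<le> U y powr p" using y(3) by linarith
    also have "\<dots> \<le> (c * norm y powr (- \<tau>)) powr p"
      using y(2) v_r[OF y(1)] U_nonneg[of y] p by (intro powr_mono2) auto
    also have "\<dots> = c powr p * norm y powr (- \<tau> - 2 * \<alpha>)"
    proof -
      have "- \<tau> * p = - \<tau> - 2 * \<alpha>" using \<tau>(1) by simp
      then show ?thesis by (simp add: powr_mult powr_powr)
    qed
    finally have "c * \<kappa> * norm y powr (- \<tau> - 2 * \<alpha>) \<le> c powr p * norm y powr (- \<tau> - 2 * \<alpha>)" .
    moreover have "0 < norm y powr (- \<tau> - 2 * \<alpha>)" using y(1) r(1) by auto
    ultimately have "c * \<kappa> \<le> c powr p" by (simp only: mult_le_cancel_right_pos)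
    then show False using cp by simp
  qed
  then show ?thesis using c(1) by blast
qed

end

section \<open>The decay rates\<close>

text \<open>Two points need attention: the solution is nonnegative almost everywhere, hence everywhere off the
  origin by continuity, and its integrals are taken with respect to the completed measure.\<close>

lemma weak_solution_representative:
  fixes u :: "'a::euclidean_space \<Rightarrow> real"
  assumes \<alpha>: "0 < \<alpha>" "\<alpha> < 1" and p: "1 < p" and u: "weak_solution \<alpha> p u" and c: "continuous_on (- {0}) u"
  shows "frac_solution \<alpha> p (\<lambda>x. if x = 0 then 0 else u x)"
proof -
  interpret fractional_order \<alpha> by unfold_locales (rule \<alpha>)+
  define U where "U = (\<lambda>x. if x = 0 then 0 else u x)"
  have ae: "AE x in lebesgue. U x = u x"
  proof -
    have "AE x in lborel. x \<noteq> (0::'a)" by (rule AE_lborel_singleton)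
    then have "AE x in lebesgue. x \<noteq> (0::'a)" by (rule AE_completion)
    then show ?thesis by eventually_elim (simp add: U_def)
  qed
  then have ae2: "AE x in lebesgue. U x powr p = u x powr p" by eventually_elim simp
  have om: "f \<in> borel_measurable lebesgue" if "integrable (omega \<alpha>) f" for f :: "'a \<Rightarrow> real"
    using that unfolding omega_def by auto
  have U_cont: "continuous_on (- {0}) U"
    by (rule continuous_on_eq[OF c]) (simp add: U_def)
  have [measurable]: "U \<in> borel_measurable borel"
  proof -
    have "(\<lambda>x. indicator (- {0}) x *\<^sub>R u x) \<in> borel_measurable borel"
      using c by (intro borel_measurable_continuous_on_indicator) auto
    moreover have "(\<lambda>x. indicator (- {0}) x *\<^sub>R u x) = U" by (auto simp: U_def indicator_def)
    ultimately show ?thesis by simp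
  qed
  have U_nonneg: "0 \<le> U x" for x
  proof (cases "x = 0")
    case False
    show ?thesis
    proof (rule ccontr)
      assume n: "\<not> 0 \<le> U x"
      let ?S = "{y \<in> - {0}. u y \<in> {..<0}}"
      have op: "open ?S"
      proof -
        have "?S = - {0} \<inter> u -` {..<0}" by auto
        moreover have "open (- {0} \<inter> u -` {..<0})" by (rule continuous_open_preimage[OF c]) (auto simp: open_Compl)
        ultimately show ?thesis by (simp only:)
      qed
      have xS: "x \<in> ?S" using n False by (simp add: U_def)
      obtain \<eta> where \<eta>: "\<eta> > 0" "cball x \<eta> \<subseteq> ?S" using op xS open_contains_cball by metis
      have "AE y in lebesgue. 0 \<le> u y" using u by (simp add: weak_solution_def)
      then have "AE y in lebesgue. y \<notin> cball x \<eta>"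
      proof eventually_elim
        case (elim y) then show ?case using \<eta>(2) by auto
      qed
      then have "AE y in lborel. y \<notin> cball x \<eta>"
        by (simp only: AE_completion_iff)
      then have "emeasure lborel (cball x \<eta>) = 0"
        using AE_iff_measurable[of "cball x \<eta>" lborel "\<lambda>y. y \<notin> cball x \<eta>"] by (simp add: cball_def)
      moreover have "0 < unit_ball_vol (real DIM('a)) * \<eta> ^ DIM('a)" using \<eta>(1) by (intro mult_pos_pos) auto
      ultimately show False using \<eta>(1) emeasure_cball[of \<eta> x] by (simp add: ennreal_eq_0_iff)
    qed
  qed (simp add: U_def)
  have wt: "weighted g" if g: "integrable (omega \<alpha>) f" and gm: "g \<in> borel_measurable borel" and gf: "AE x in lebesgue. g x = f x" for f g :: "'a \<Rightarrow> real"
  proof -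
    have omd: "omega \<alpha> = density lebesgue (\<lambda>x::'a. ennreal (wgt \<alpha> x))" by (simp add: omega_def wgt_def)
    have wl: "(wgt \<alpha> :: 'a \<Rightarrow> real) \<in> borel_measurable lebesgue" by (rule measurable_completion) simp
    have "f \<in> borel_measurable lebesgue" using g unfolding omega_def by auto
    then have "integrable lebesgue (\<lambda>x. wgt \<alpha> x *\<^sub>R f x)"
      using g wl unfolding omd by (subst (asm) integrable_density) (auto intro: less_imp_le[OF wgt_pos])
    moreover have "integrable lebesgue (\<lambda>x. wgt \<alpha> x *\<^sub>R f x) \<longleftrightarrow> integrable lebesgue (\<lambda>x. g x * wgt \<alpha> x)"
    proof (rule integrable_cong_AE)
      have "g \<in> borel_measurable lebesgue" by (rule measurable_completion) (use gm in simp)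
      then show "(\<lambda>x. g x * wgt \<alpha> x) \<in> borel_measurable lebesgue" using wl by (rule borel_measurable_times)
      show "(\<lambda>x. wgt \<alpha> x *\<^sub>R f x) \<in> borel_measurable lebesgue"
        unfolding real_scaleR_def using wl \<open>f \<in> borel_measurable lebesgue\<close> by (rule borel_measurable_times)
      show "AE x in lebesgue. wgt \<alpha> x *\<^sub>R f x = g x * wgt \<alpha> x"
        using gf by eventually_elim simp
    qed
    ultimately have "integrable lborel (\<lambda>x. g x * wgt \<alpha> x)"
      using gm by (subst (asm) integrable_completion) auto
    then show ?thesis using gm by (simp add: weighted_def)
  qed
  have "frac_solution \<alpha> p U"
  proof
    show "1 < p" by (rule p)
    show "0 \<le> U x" for x by (rule U_nonneg)
    show "continuous_on (- {0}) U" by (rule U_cont)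
    show "weighted U" by (rule wt[of u]) (use u ae in \<open>auto simp: weak_solution_def\<close>)
    show "weighted (\<lambda>x. U x powr p)"
      by (rule wt[of "\<lambda>x. u x powr p"]) (use u ae2 in \<open>auto simp: weak_solution_def\<close>)
    have "(u \<longlongrightarrow> 0) at_infinity" using u by (simp add: weak_solution_def)
    moreover have "\<forall>\<^sub>F x in at_infinity. u x = U x"
      unfolding eventually_at_infinity by (rule exI[of _ 1]) (auto simp: U_def)
    ultimately show "(U \<longlongrightarrow> 0) at_infinity" by (rule Lim_transform_eventually)
    fix \<xi> :: "'a \<Rightarrow> real" assume \<xi>: "c11_supported \<xi>"
    then have [measurable]: "\<xi> \<in> borel_measurable borel" using c11_supportedD by metis
    have [measurable]: "levy_lim \<xi> \<in> borel_measurable borel" unfolding levy_lim_def[abs_def] sdiff_def by measurable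
    have "(LINT x|lebesgue. u x * frac_lap \<alpha> \<xi> x + u x powr p * \<xi> x) = \<xi> 0"
      using u c11_supported_in_test_space[OF \<xi>] by (simp add: weak_solution_def)
    moreover have "(LINT x|lebesgue. u x * frac_lap \<alpha> \<xi> x + u x powr p * \<xi> x) = (LINT x|lebesgue. U x powr p * \<xi> x - U x * levy_lim \<xi> x)"
    proof (rule integral_cong_AE)
      have "u \<in> borel_measurable lebesgue" "(\<lambda>x. u x powr p) \<in> borel_measurable lebesgue"
        using u by (auto simp: weak_solution_def intro: om)
      moreover have "levy_lim \<xi> \<in> borel_measurable lebesgue" "\<xi> \<in> borel_measurable lebesgue"
        by (rule measurable_completion, simp)+
      ultimately show "(\<lambda>x. u x * frac_lap \<alpha> \<xi> x + u x powr p * \<xi> x) \<in> borel_measurable lebesgue"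
        unfolding frac_lap_eq_levy_lim(2)[OF \<xi>]
        by (intro borel_measurable_add borel_measurable_times borel_measurable_uminus)
      show "(\<lambda>x. U x powr p * \<xi> x - U x * levy_lim \<xi> x) \<in> borel_measurable lebesgue"
        by (rule measurable_completion) measurable
      show "AE x in lebesgue. u x * frac_lap \<alpha> \<xi> x + u x powr p * \<xi> x = U x powr p * \<xi> x - U x * levy_lim \<xi> x"
        using ae by eventually_elim (simp add: frac_lap_eq_levy_lim(2)[OF \<xi>])
    qed
    moreover have "(LINT x|lebesgue. U x powr p * \<xi> x - U x * levy_lim \<xi> x) = (\<integral>x. U x powr p * \<xi> x - U x * levy_lim \<xi> x \<partial>lborel)"
      by (rule integral_completion) measurable
    ultimately show "(\<integral>x. U x powr p * \<xi> x - U x * levy_lim \<xi> x \<partial>lborel) = \<xi> 0" by simp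
  qed
  then show ?thesis unfolding U_def .
qed

theorem theorem1p3:
  fixes u\<^sub>1 :: "'a::euclidean_space \<Rightarrow> real" and \<alpha> p :: real
  assumes "DIM('a) \<ge> 2"
    and "0 < \<alpha>" "\<alpha> < 1"
    and "1 < p" "p < real DIM('a) / (real DIM('a) - 2 * \<alpha>)"
    and "weak_solution \<alpha> p u\<^sub>1"
    and "continuous_on (- {0}) u\<^sub>1"
  shows "\<exists>c\<^sub>2>1. \<exists>R>2. \<forall>x. norm x \<ge> R \<longrightarrow>
    (p < 1 + 2 * \<alpha> / real DIM('a) \<longrightarrow>
       1 / c\<^sub>2 * norm x powr (- ((real DIM('a) + 2 * \<alpha>) / p)) \<le> u\<^sub>1 x \<and>
       u\<^sub>1 x \<le> c\<^sub>2 * norm x powr (- ((real DIM('a) + 2 * \<alpha>) / p))) \<and>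
    (p = 1 + 2 * \<alpha> / real DIM('a) \<longrightarrow>
       1 / c\<^sub>2 * norm x powr (- real DIM('a)) * ln (norm x) powr (real DIM('a) / (2 * \<alpha>)) \<le> u\<^sub>1 x \<and>
       u\<^sub>1 x \<le> c\<^sub>2 * norm x powr (- real DIM('a)) * ln (norm x) powr (real DIM('a) / (2 * \<alpha>))) \<and>
    (p > 1 + 2 * \<alpha> / real DIM('a) \<longrightarrow>
       1 / c\<^sub>2 * norm x powr (- (2 * \<alpha> / (p - 1))) \<le> u\<^sub>1 x \<and>
       u\<^sub>1 x \<le> c\<^sub>2 * norm x powr (- (2 * \<alpha> / (p - 1))))"
proof -
  define U where "U = (\<lambda>x. if x = 0 then 0 else u\<^sub>1 x)"
  interpret frac_solution \<alpha> p U
    unfolding U_def by (rule weak_solution_representative[OF assms(2,3,4,6,7)])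
  let ?N = "real DIM('a)"
  have N: "?N \<ge> 2" using assms(1) by simp
  have d: "2 * \<alpha> < ?N" using N assms(3) by linarith
  have Uu: "U x = u\<^sub>1 x" if "1 \<le> norm x" for x using that by (auto simp: U_def)
  have weaken: "\<exists>C>0. \<forall>x. norm x \<ge> 4 \<longrightarrow> U x \<le> C * f x" if up: "\<exists>C>0. \<forall>x. norm x \<ge> 1 \<longrightarrow> U x \<le> C * f x" for f
  proof -
    obtain C where C: "C > 0" "\<And>x. norm x \<ge> 1 \<Longrightarrow> U x \<le> C * f x" using up by blast
    have "U x \<le> C * f x" if x: "norm x \<ge> 4" for x using x by (intro C(2)) linarith
    then show ?thesis using C(1) by blast
  qed
  have two_sided: "\<exists>c\<^sub>2>1. \<exists>R>2. \<forall>x. norm x \<ge> R \<longrightarrow> 1 / c\<^sub>2 * f x \<le> u\<^sub>1 x \<and> u\<^sub>1 x \<le> c\<^sub>2 * f x"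
    if up: "\<exists>C>0. \<forall>x. norm x \<ge> 4 \<longrightarrow> U x \<le> C * f x" and lo: "\<exists>c>0. \<exists>R. \<forall>x. norm x \<ge> R \<longrightarrow> c * f x \<le> U x"
      and f: "\<And>x. 0 \<le> f x" for f :: "'a \<Rightarrow> real"
  proof -
    obtain C where C: "C > 0" "\<And>x. norm x \<ge> 4 \<Longrightarrow> U x \<le> C * f x" using up by blast
    obtain c R where c: "c > 0" "\<And>x. norm x \<ge> R \<Longrightarrow> c * f x \<le> U x" using lo by blast
    define c2 where "c2 = max 2 (max C (1 / c))"
    have c2: "c2 > 1" "C \<le> c2" "1 / c \<le> c2" by (auto simp: c2_def)
    have "1 / c2 \<le> c" using c2 c(1) by (simp add: field_simps)
    show ?thesis
    proof (rule exI[of _ c2], rule conjI[OF c2(1) exI[of _ "max R 4"]], intro conjI allI impI)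
      fix x :: 'a assume "max R 4 \<le> norm x"
      then have x: "R \<le> norm x" "4 \<le> norm x" by auto
      have "U x = u\<^sub>1 x" using x by (intro Uu) linarith
      moreover have "1 / c2 * f x \<le> c * f x" "C * f x \<le> c2 * f x"
        by (rule mult_right_mono[OF \<open>1 / c2 \<le> c\<close> f] mult_right_mono[OF c2(2) f])+
      ultimately show "1 / c2 * f x \<le> u\<^sub>1 x" "u\<^sub>1 x \<le> c2 * f x"
        using C(2)[OF x(2)] c(2)[OF x(1)] by linarith+
    qed simp
  qed
  consider "p < 1 + 2 * \<alpha> / ?N" | "p = 1 + 2 * \<alpha> / ?N" | "p > 1 + 2 * \<alpha> / ?N" by linarith
  then show ?thesis
  proof cases
    case 1
    have "?N * p < ?N * (1 + 2 * \<alpha> / ?N)" using 1 N by (intro mult_strict_left_mono) auto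
    also have "\<dots> = ?N + 2 * \<alpha>" using N by (simp add: distrib_left)
    finally have sub: "?N < (?N + 2 * \<alpha>) / p" using assms(4) by (simp add: pos_less_divide_eq)
    have up: "\<exists>C>0. \<forall>x. norm x \<ge> 4 \<longrightarrow> U x \<le> C * norm x powr (- ((?N + 2 * \<alpha>) / p))"
      by (rule weaken[OF upper_bound_subcritical[OF sub]])
    have "\<exists>c\<^sub>2>1. \<exists>R>2. \<forall>x. norm x \<ge> R \<longrightarrow> 1 / c\<^sub>2 * norm x powr (- ((?N + 2 * \<alpha>) / p)) \<le> u\<^sub>1 x \<and> u\<^sub>1 x \<le> c\<^sub>2 * norm x powr (- ((?N + 2 * \<alpha>) / p))"
      by (rule two_sided[OF up lower_bound_subcritical]) (use sub in auto)
    moreover have "(p < 1 + 2 * \<alpha> / ?N) = True" "(p = 1 + 2 * \<alpha> / ?N) = False" "(1 + 2 * \<alpha> / ?N < p) = False" using 1 by auto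
    ultimately show ?thesis by (simp only: simp_thms)
  next
    case 2
    have crit: "?N * p = ?N + 2 * \<alpha>" unfolding 2 using N by (simp add: distrib_left)
    define \<beta> where "\<beta> = ?N / (2 * \<alpha>)"
    have \<beta>: "\<beta> * p = \<beta> + 1" "\<beta> > 0"
      unfolding \<beta>_def 2 using N assms(2) by (simp_all add: distrib_left)
    have up: "\<exists>C>0. \<forall>x. norm x \<ge> 4 \<longrightarrow> U x \<le> C * (norm x powr (- ?N) * ln (norm x) powr \<beta>)"
      using upper_bound_critical[OF crit \<beta>] by (simp add: mult.assoc)
    have lo: "\<exists>c>0. \<exists>R. \<forall>x. norm x \<ge> R \<longrightarrow> c * (norm x powr (- ?N) * ln (norm x) powr \<beta>) \<le> U x"
      using lower_bound_critical[OF crit \<beta>] by (simp add: mult.assoc)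
    have "\<exists>c\<^sub>2>1. \<exists>R>2. \<forall>x. norm x \<ge> R \<longrightarrow> 1 / c\<^sub>2 * (norm x powr (- ?N) * ln (norm x) powr \<beta>) \<le> u\<^sub>1 x \<and> u\<^sub>1 x \<le> c\<^sub>2 * (norm x powr (- ?N) * ln (norm x) powr \<beta>)"
      by (rule two_sided[OF up lo]) simp
    moreover have "(p < 1 + 2 * \<alpha> / ?N) = False" "(p = 1 + 2 * \<alpha> / ?N) = True" "(1 + 2 * \<alpha> / ?N < p) = False" using 2 by auto
    ultimately show ?thesis unfolding \<beta>_def by (simp only: simp_thms mult.assoc)
  next
    case 3
    define \<tau> where "\<tau> = 2 * \<alpha> / (p - 1)"
    have "\<tau> * (p - 1) = 2 * \<alpha>" using assms(4) by (simp add: \<tau>_def)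
    then have \<tau>: "\<tau> * p = \<tau> + 2 * \<alpha>" by (simp add: algebra_simps)
    have \<tau>0: "0 < \<tau>" using assms(2,4) by (simp add: \<tau>_def)
    have "2 * \<alpha> / ?N < p - 1" using 3 by linarith
    then have "2 * \<alpha> < (p - 1) * ?N" using N by (simp add: pos_divide_less_eq)
    then have \<tau>N: "\<tau> < ?N" unfolding \<tau>_def using assms(4) by (simp add: pos_divide_less_eq mult.commute)
    have "p * (?N - 2 * \<alpha>) < ?N" using assms(5) d by (simp add: pos_less_divide_eq)
    then have "(?N - 2 * \<alpha>) * (p - 1) < 2 * \<alpha>" by (simp add: algebra_simps)
    then have \<tau>G: "?N - 2 * \<alpha> < \<tau>" unfolding \<tau>_def using assms(4) by (simp add: pos_less_divide_eq)
    have up: "\<exists>C>0. \<forall>x. norm x \<ge> 4 \<longrightarrow> U x \<le> C * norm x powr (- \<tau>)"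
      by (rule weaken[OF upper_bound_supercritical[OF \<tau> \<tau>0 \<tau>N]])
    have "\<exists>c\<^sub>2>1. \<exists>R>2. \<forall>x. norm x \<ge> R \<longrightarrow> 1 / c\<^sub>2 * norm x powr (- \<tau>) \<le> u\<^sub>1 x \<and> u\<^sub>1 x \<le> c\<^sub>2 * norm x powr (- \<tau>)"
      by (rule two_sided[OF up lower_bound_supercritical[OF d \<tau> \<tau>G \<tau>N]]) simp
    moreover have "(p < 1 + 2 * \<alpha> / ?N) = False" "(p = 1 + 2 * \<alpha> / ?N) = False" "(1 + 2 * \<alpha> / ?N < p) = True" using 3 by auto
    ultimately show ?thesis unfolding \<tau>_def by (simp only: simp_thms)
  qed
qed

end
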